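(* Let $\mathcal{G}$ be a non-compact connected metric graph with a finite number of vertices and edges. If $\mathcal{G}$ has no tips (terminal points), admits no cycle covering, and has at least $2$ half-lines, then $\mu_{\mathcal{G}}>\mu_{\mathbb{R}^+}$.
   Context: Metric graphs: each edge $e$ is identified either with a closed bounded interval $[0,|e|]$ (bounded edge) or with a copy of $[0,+\infty)$ (half-line, whose end at $+\infty$ is a vertex at infinity; distinct half-lines have distinct vertices at infinity). Loops and multiple edges are allowed. A graph is non-compact if it has at least one half-line. Without loss of generality every vertex is assumed to have degree different from $2$ (possible unless $\mathcal{G}$ is isometric to $\mathbb{R}$, which is seen as two half-lines glued at a vertex of degree $2$). A terminal point (tip) is a vertex, not at infinity, of degree $1$. A cycle is either a bounded loop (closed path) or an unbounded path joining two distinct vertices at infinity; $\mathcal{G}$ admits a cycle covering if every edge of $\mathcal{G}$ belongs to a cycle. Equivalently: $\mathcal{G}$ has at least two half-lines and no terminal point, and whenever removing a bounded edge $e$ leaves two connected components, both are unbounded. $H^1(\mathcal{G})$ is the space of continuous (real-valued) functions $u$ on $\mathcal{G}$ with $u|_e\in H^1(e)$ for every edge $e$. Critical mass: for a non-compact metric graph $\mathcal{G}$, $\mu_{\mathcal{G}}>0$ is defined by $\frac{3}{\mu_{\mathcal{G}}^2}=\sup_{0\ne u\in H^1(\mathcal{G})}\frac{\|u\|_{L^6}^6}{\|u\|_{L^2}^4\|u'\|_{L^2}^2}$ (the optimal constant in the Gagliardo–Nirenberg inequality). In particular, $\mu_{\mathbb{R}}=\pi\sqrt3/2$ and, for the half-line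 $\mathbb{R}^+=[0,+\infty)$, $\mu_{\mathbb{R}^+}=\mu_{\mathbb{R}}/2=\pi\sqrt3/4$. *)

theory Defs
  imports "HOL-Analysis.Analysis" "Graph_Theory.Graph_Theory"
begin

section \<open>Metric graphs\<close>

text \<open>
  A metric graph is a finite multigraph \<open>G\<close> (loops and parallel edges allowed) together with the
  edge lengths \<open>len\<close>; an edge of length \<open>\<infinity>\<close> is a half-line.  The vertices of \<open>G\<close> include the
  vertices at infinity.  The direction of an arc \<open>e\<close> only fixes the coordinate on \<open>e\<close>: the point
  \<open>0\<close> is at \<open>tail G e\<close>, and \<open>len e\<close> is at \<open>head G e\<close>.
\<close>

definition half_lines :: "('v, 'e) pre_digraph \<Rightarrow> ('e \<Rightarrow> ereal) \<Rightarrow> 'e set" where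
  "half_lines G len = {e \<in> arcs G. len e = \<infinity>}"

definition verts_at_inf :: "('v, 'e) pre_digraph \<Rightarrow> ('e \<Rightarrow> ereal) \<Rightarrow> 'v set" where
  "verts_at_inf G len = head G ` half_lines G len"

text \<open>
  Vertices of degree 2 are not excluded: requiring their absence is only a normalization of the
  presentation, and none of the notions below depends on it.
\<close>

locale metric_graph = fin_digraph G for G :: "('v, 'e) pre_digraph" +
  fixes len :: "'e \<Rightarrow> ereal"
  assumes len_pos: "e \<in> arcs G \<Longrightarrow> 0 < len e"
    and distinct_verts_at_inf: "inj_on (head G) (half_lines G len)"
    and tail_not_at_inf: "e \<in> arcs G \<Longrightarrow> tail G e \<notin> verts_at_inf G len"
    and head_not_at_inf: "e \<in> arcs G \<Longrightarrow> len e \<noteq> \<infinity> \<Longrightarrow> head G e \<notin> verts_at_inf G len"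

definition noncompact :: "('v, 'e) pre_digraph \<Rightarrow> ('e \<Rightarrow> ereal) \<Rightarrow> bool" where
  "noncompact G len \<longleftrightarrow> half_lines G len \<noteq> {}"

text \<open>A loop counts twice in the degree, once as an incoming and once as an outgoing arc.\<close>

definition degree :: "('v, 'e) pre_digraph \<Rightarrow> 'v \<Rightarrow> nat" where
  "degree G v = in_degree G v + out_degree G v"

definition tips :: "('v, 'e) pre_digraph \<Rightarrow> ('e \<Rightarrow> ereal) \<Rightarrow> 'v set" where
  "tips G len = {v \<in> verts G - verts_at_inf G len. degree G v = 1}"

text \<open>
  Edges may be traversed in both directions: \<open>(e, True)\<close> is \<open>e\<close> with its own direction, \<open>(e, False)\<close>
  is \<open>e\<close> reversed.
\<close>

definition both_directions :: "('v, 'e) pre_digraph \<Rightarrow> ('v, 'e \<times> bool) pre_digraph" where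
  "both_directions G =
     \<lparr>verts = verts G, arcs = arcs G \<times> UNIV,
      tail = (\<lambda>(e, d). if d then tail G e else head G e),
      head = (\<lambda>(e, d). if d then head G e else tail G e)\<rparr>"

text \<open>
  Distinctness of the underlying edges rules out going along an edge and straight back, which is a
  directed cycle of \<open>both_directions G\<close> but not a cycle of \<open>G\<close>.
\<close>

definition bounded_loop :: "('v, 'e) pre_digraph \<Rightarrow> ('e \<Rightarrow> ereal) \<Rightarrow> ('e \<times> bool) list \<Rightarrow> bool" where
  "bounded_loop G len p \<longleftrightarrow>
     pre_digraph.cycle (both_directions G) p \<and> distinct (map fst p) \<and>
     fst ` set p \<inter> half_lines G len = {}"

definition unbounded_path :: "('v, 'e) pre_digraph \<Rightarrow> ('e \<Rightarrow> ereal) \<Rightarrow> ('e \<times> bool) list \<Rightarrow> bool" where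
  "unbounded_path G len p \<longleftrightarrow>
     (\<exists>a \<in> verts_at_inf G len. \<exists>b \<in> verts_at_inf G len.
        a \<noteq> b \<and> pre_digraph.apath (both_directions G) a p b)"

definition admits_cycle_covering :: "('v, 'e) pre_digraph \<Rightarrow> ('e \<Rightarrow> ereal) \<Rightarrow> bool" where
  "admits_cycle_covering G len \<longleftrightarrow>
     (\<forall>e \<in> arcs G. \<exists>p. (bounded_loop G len p \<or> unbounded_path G len p) \<and> e \<in> fst ` set p)"


section \<open>The Sobolev space \<open>H\<^sup>1\<close>\<close>

definition L2_on :: "real set \<Rightarrow> (real \<Rightarrow> real) \<Rightarrow> bool" where
  "L2_on I f \<longleftrightarrow> set_borel_measurable lborel I f \<and> set_integrable lborel I (\<lambda>x. (f x)\<^sup>2)"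

text \<open>\<open>\<phi>\<close> is a \<open>C\<^sup>1\<close> function with derivative \<open>\<phi>'\<close> and compact support in the open set \<open>I\<close>.\<close>

definition test_function :: "real set \<Rightarrow> (real \<Rightarrow> real) \<Rightarrow> (real \<Rightarrow> real) \<Rightarrow> bool" where
  "test_function I \<phi> \<phi>' \<longleftrightarrow>
     (\<forall>x. (\<phi> has_real_derivative \<phi>' x) (at x)) \<and> continuous_on UNIV \<phi>' \<and>
     (\<exists>K. compact K \<and> K \<subseteq> I \<and> (\<forall>x. x \<notin> K \<longrightarrow> \<phi> x = 0))"

definition has_weak_L2_deriv :: "real set \<Rightarrow> (real \<Rightarrow> real) \<Rightarrow> (real \<Rightarrow> real) \<Rightarrow> bool" where
  "has_weak_L2_deriv I f g \<longleftrightarrow>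
     L2_on I g \<and>
     (\<forall>\<phi> \<phi>'. test_function I \<phi> \<phi>' \<longrightarrow>
        (LBINT x:I. f x * \<phi>' x) = - (LBINT x:I. g x * \<phi> x))"

definition H1_on :: "real set \<Rightarrow> (real \<Rightarrow> real) \<Rightarrow> bool" where
  "H1_on I f \<longleftrightarrow> L2_on I f \<and> (\<exists>g. has_weak_L2_deriv I f g)"

text \<open>Weak derivatives are unique up to null sets, so the choice does not affect any integral.\<close>

definition weak_deriv :: "real set \<Rightarrow> (real \<Rightarrow> real) \<Rightarrow> real \<Rightarrow> real" where
  "weak_deriv I f = (SOME g. has_weak_L2_deriv I f g)"

definition edge_points :: "ereal \<Rightarrow> real set" where
  "edge_points l = {x. 0 \<le> x \<and> ereal x \<le> l}"

definition edge_interior :: "ereal \<Rightarrow> real set" where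
  "edge_interior l = {x. 0 < x \<and> ereal x < l}"

text \<open>
  A function on \<open>G\<close> is a family \<open>u\<close> of functions on the edges, with \<open>u e x\<close> the value at the point of
  \<open>e\<close> with coordinate \<open>x\<close>; values outside \<open>edge_points (len e)\<close> are ignored.  The function is
  continuous if it is so along every edge and the values \<open>w v\<close> at the vertices are consistent.
  Vertices at infinity are not points of \<open>G\<close>, hence the restriction to bounded edges at \<open>head G e\<close>.
\<close>

definition continuous_on_graph ::
    "('v, 'e) pre_digraph \<Rightarrow> ('e \<Rightarrow> ereal) \<Rightarrow> ('e \<Rightarrow> real \<Rightarrow> real) \<Rightarrow> bool" where
  "continuous_on_graph G len u \<longleftrightarrow>
     (\<forall>e \<in> arcs G. continuous_on (edge_points (len e)) (u e)) \<and>
     (\<exists>w. \<forall>e \<in> arcs G. u e 0 = w (tail G e) \<and>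
        (len e \<noteq> \<infinity> \<longrightarrow> u e (real_of_ereal (len e)) = w (head G e)))"

definition H1 :: "('v, 'e) pre_digraph \<Rightarrow> ('e \<Rightarrow> ereal) \<Rightarrow> ('e \<Rightarrow> real \<Rightarrow> real) set" where
  "H1 G len =
     {u. continuous_on_graph G len u \<and> (\<forall>e \<in> arcs G. H1_on (edge_interior (len e)) (u e))}"

definition nonzero_on :: "('v, 'e) pre_digraph \<Rightarrow> ('e \<Rightarrow> ereal) \<Rightarrow> ('e \<Rightarrow> real \<Rightarrow> real) \<Rightarrow> bool" where
  "nonzero_on G len u \<longleftrightarrow> (\<exists>e \<in> arcs G. \<exists>x \<in> edge_points (len e). u e x \<noteq> 0)"

definition graph_deriv :: "('e \<Rightarrow> ereal) \<Rightarrow> ('e \<Rightarrow> real \<Rightarrow> real) \<Rightarrow> 'e \<Rightarrow> real \<Rightarrow> real" where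
  "graph_deriv len u = (\<lambda>e. weak_deriv (edge_interior (len e)) (u e))"


section \<open>Critical mass\<close>

text \<open>The \<open>p\<close>-th power of the norm of \<open>L\<^sup>p(G)\<close>.\<close>

definition Lp_norm_pow ::
    "('v, 'e) pre_digraph \<Rightarrow> ('e \<Rightarrow> ereal) \<Rightarrow> nat \<Rightarrow> ('e \<Rightarrow> real \<Rightarrow> real) \<Rightarrow> real" where
  "Lp_norm_pow G len p u = (\<Sum>e\<in>arcs G. LBINT x:edge_interior (len e). \<bar>u e x\<bar> ^ p)"

definition GN_quotient ::
    "('v, 'e) pre_digraph \<Rightarrow> ('e \<Rightarrow> ereal) \<Rightarrow> ('e \<Rightarrow> real \<Rightarrow> real) \<Rightarrow> real" where
  "GN_quotient G len u =
     Lp_norm_pow G len 6 u / ((Lp_norm_pow G len 2 u)\<^sup>2 * Lp_norm_pow G len 2 (graph_deriv len u))"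

text \<open>
  For a connected non-compact graph the denominators are positive, and the quotients are bounded
  above by the Gagliardo--Nirenberg inequality, so that the real supremum is meaningful.
\<close>

definition critical_mass :: "('v, 'e) pre_digraph \<Rightarrow> ('e \<Rightarrow> ereal) \<Rightarrow> real" where
  "critical_mass G len =
     (THE \<mu>. 0 < \<mu> \<and> 3 / \<mu>\<^sup>2 = (SUP u \<in> {u \<in> H1 G len. nonzero_on G len u}. GN_quotient G len u))"

text \<open>The half-line \<open>[0,\<infinity>)\<close>: one half-line from the vertex \<open>False\<close> to \<open>True\<close>, the one at infinity.\<close>

definition half_line_graph :: "(bool, unit) pre_digraph" where
  "half_line_graph = \<lparr>verts = UNIV, arcs = UNIV, tail = (\<lambda>_. False), head = (\<lambda>_. True)\<rparr>"

definition half_line_len :: "unit \<Rightarrow> ereal" where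
  "half_line_len = (\<lambda>_. \<infinity>)"

lemma metric_graph_half_line: "metric_graph half_line_graph half_line_len"
  by unfold_locales
    (auto simp: half_line_graph_def half_line_len_def half_lines_def verts_at_inf_def inj_on_def)

end

theory Submission
  imports Defs
begin

text \<open>
  Normalise \<open>u\<close> to \<open>max \<bar>u\<bar> = 1\<close>, put \<open>m = \<parallel>u\<parallel>\<^sub>2\<^sup>2\<close> and \<open>\<beta> = \<nu> / m\<close>. For \<open>a \<ge> 1\<close>, completing the square in
  \<open>(\<bar>u'\<bar> - \<beta> \<bar>u\<bar> \<surd>(a\<^sup>4 - u\<^sup>4) / \<surd>3)\<^sup>2 \<ge> 0\<close> gives
  \<open>\<parallel>u'\<parallel>\<^sub>2\<^sup>2 + \<beta>\<^sup>2 (a\<^sup>4 m - \<parallel>u\<parallel>\<^sub>6\<^sup>6) / 3 \<ge> (2 \<beta> / \<surd>3) \<integral> \<bar>u'\<bar> \<bar>u\<bar> \<surd>(a\<^sup>4 - u\<^sup>4)\<close>, and the right-hand integral is at least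
  \<open>\<integral>\<^sub>0\<^sup>1 N t * (t \<surd>(a\<^sup>4 - t\<^sup>4)) dt\<close>, where \<open>N t\<close> counts how often \<open>\<bar>u\<bar>\<close> crosses the level \<open>t\<close>. Since \<open>N \<ge> 1\<close>
  everywhere, \<open>a = 1\<close> yields the half-line constant. A level with \<open>N t = 1\<close> is crossed on a bounded
  edge only (there are two half-lines), and \<open>\<bar>u\<bar> \<ge> t\<close> holds on an entire bounded edge (there are no tips).
  The first fact gives a uniform gain when \<open>\<beta>\<close> is small: either \<open>u\<close> oscillates enough on the bounded
  edges, whose total length is finite, to make \<open>\<parallel>u'\<parallel>\<^sub>2\<close> large, or \<open>N \<ge> 2\<close> on most levels. When \<open>\<beta>\<close> is
  bounded below, either \<open>N \<ge> 2\<close> near the top level, or \<open>\<bar>u\<bar>\<close> is nearly \<open>1\<close> on an edge of length bounded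
  below; there \<open>a\<close> slightly above \<open>1\<close> gains to first order in \<open>a - 1\<close> and loses only \<open>O((a - 1)\<^bsup>3/2\<^esup>)\<close>.
\<close>

section \<open>Level crossings\<close>

text \<open>A strict inequality for each single \<open>u\<close> would not separate two suprema, so
  the gain has to be a constant \<nu> > \<open>half_line_mass\<close> that depends on the graph
  alone. The weight is dictated by the equality case: for \<open>a = 1\<close> the square vanishes
  when \<bar>u'\<bar> = \<beta> u sqrt(1 - u^4) / sqrt 3, which the half-soliton
  \<open>1 / sqrt (cosh x)\<close> solves, and 2 sqrt 3 times the integral of t sqrt(1 - t^4) over
  [0,1] is exactly \<open>half_line_mass\<close>. At \<open>a = 1\<close> nothing is lost on a
  half-line, so any surplus is a true gain. A plateau at height 1 gives no such surplus, because
  there \<open>u^2 - u^6 = 0\<close>; raising \<open>a\<close> above 1 turns its length into one.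
  Since \<nu>^2 power6 \<le> 3 mass^2 energy is the same as \<beta>^2 power6 \<le> 3 energy, \<beta>
  is the only parameter that separates spread-out from concentrated functions. The level count is
  not the number of preimages, which would call for a coarea formula, but a lower bound for it read
  off from four values per edge; its weighted integral is then a sum of three increments, and the
  topology reduces to asking which vertex values lie above t.\<close>

definition cross :: "real \<Rightarrow> real \<Rightarrow> real \<Rightarrow> nat" where
  "cross p q t = (if (t \<le> p) = (t \<le> q) then 0 else 1)"

text \<open>Crossings forced on a path that visits the values a, p, q, b in this order. The
  half-open convention of \<open>cross\<close> (above means \<open>t \<le> p\<close>) makes the
  parity arguments valid at every level, with no exceptional set.\<close>

definition chain_crossings :: "real \<Rightarrow> real \<Rightarrow> real \<Rightarrow> real \<Rightarrow> real \<Rightarrow> nat" where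
  "chain_crossings a p q b t = cross a p t + cross p q t + cross q b t"

text \<open>The cut argument used below: a vertex property that no edge changes is the same at all
  vertices, even though connectedness is stated through the symmetrised digraph.\<close>

lemma (in metric_graph) connected_constant:
  assumes conn: "Digraph_Component.connected G"
    and step: "\<And>e. e \<in> arcs G \<Longrightarrow> P (tail G e) = P (head G e)"
    and uv: "u \<in> verts G" "v \<in> verts G"
  shows "P u = P v"
proof -
  have "u \<rightarrow>\<^sup>*\<^bsub>with_proj (mk_symmetric G)\<^esub> v"
    using conn uv unfolding Digraph_Component.connected_def strongly_connected_def by auto
  then have "(u, v) \<in> rtrancl_on (verts G) (parcs (mk_symmetric G))"
    by (simp add: reachable_def)
  then show ?thesis
    by (induction rule: rtrancl_on_induct) (auto simp: parcs_mk_symmetric step)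
qed

text \<open>
  On a bounded edge \<open>p e\<close> and \<open>q e\<close> are the two extreme values of \<open>\<bar>u\<bar>\<close>, in the order in which they are
  attained; on a half-line \<open>p e\<close> is the maximum and \<open>q e = 0\<close> the limit at infinity.
\<close>

locale level_profile = metric_graph G len
  for G :: "('v, 'e) pre_digraph" and len :: "'e \<Rightarrow> ereal" +
  fixes w :: "'v \<Rightarrow> real" and p q :: "'e \<Rightarrow> real"
  assumes connected: "Digraph_Component.connected G"
    and noncompact: "half_lines G len \<noteq> {}"
    and w_inf: "\<And>v. v \<in> verts_at_inf G len \<Longrightarrow> w v = 0"
    and q_inf: "\<And>e. e \<in> half_lines G len \<Longrightarrow> q e = 0"
    and tail_between: "\<And>e. e \<in> arcs G \<Longrightarrow> w (tail G e) \<in> {min (p e) (q e)..max (p e) (q e)}"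
    and head_between: "\<And>e. e \<in> arcs G \<Longrightarrow> w (head G e) \<in> {min (p e) (q e)..max (p e) (q e)}"
    and max_1: "\<exists>e\<in>arcs G. 1 \<le> max (p e) (q e)"
begin

definition crossings :: "'e \<Rightarrow> real \<Rightarrow> nat" where
  "crossings e = chain_crossings (w (tail G e)) (p e) (q e) (w (head G e))"

lemma crossings_eq_0_iff:
  assumes "e \<in> arcs G"
  shows "crossings e t = 0 \<longleftrightarrow> t \<le> min (p e) (q e) \<or> max (p e) (q e) < t"
  using tail_between[OF assms] head_between[OF assms] unfolding crossings_def chain_crossings_def cross_def
  by (auto split: if_splits)

lemma crossings_eq_1D:
  assumes "e \<in> arcs G" "crossings e t = 1"
  shows "(t \<le> w (tail G e)) \<noteq> (t \<le> w (head G e))"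
  using assms unfolding crossings_def chain_crossings_def cross_def by (auto split: if_splits)

lemma crossings_0D:
  assumes "e \<in> arcs G" "crossings e t = 0"
  shows "(t \<le> w (tail G e)) = (t \<le> w (head G e))"
  using assms unfolding crossings_def chain_crossings_def cross_def by (auto split: if_splits)

lemma arc_at_half_line_end:
  assumes "e \<in> half_lines G len" "f \<in> arcs G" "f \<noteq> e"
  shows "tail G f \<noteq> head G e" "head G f \<noteq> head G e"
proof -
  have "head G e \<in> verts_at_inf G len" using assms by (auto simp: verts_at_inf_def)
  then show "tail G f \<noteq> head G e" using tail_not_at_inf assms by metis
  show "head G f \<noteq> head G e"
  proof (cases "len f = \<infinity>")
    case True
    then have "f \<in> half_lines G len" using assms by (auto simp: half_lines_def)
    then show ?thesis using distinct_verts_at_inf assms by (meson inj_onD)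
  next
    case False
    then show ?thesis using head_not_at_inf[OF assms(2)] \<open>head G e \<in> _\<close> by metis
  qed
qed

lemma sum_crossings_ge_1:
  assumes t: "0 < t" "t \<le> 1"
  shows "1 \<le> (\<Sum>e\<in>arcs G. crossings e t)"
proof (rule ccontr)
  assume "\<not> ?thesis"
  then have "(\<Sum>e\<in>arcs G. crossings e t) = 0" by linarith
  then have zero: "crossings e t = 0" if "e \<in> arcs G" for e
    using that finite_arcs by simp
  obtain h where h: "h \<in> half_lines G len" using noncompact by auto
  then have hG: "h \<in> arcs G" and hinf: "head G h \<in> verts_at_inf G len"
    by (auto simp: half_lines_def verts_at_inf_def)
  obtain e where e: "e \<in> arcs G" "1 \<le> max (p e) (q e)" using max_1 by auto
  \<comment> \<open>Without crossings no edge leaves the superlevel set of t, so the vertex at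
    infinity, where w is 0, forces every vertex below t. An edge that reaches 1 would then have to
    cross.\<close>
  have "(t \<le> w (tail G e)) = (t \<le> w (head G h))"
    by (rule connected_constant[OF connected]) (use zero crossings_0D e hG in auto)
  then have "\<not> t \<le> w (tail G e)" using w_inf[OF hinf] t by auto
  then show False
    using crossings_eq_0_iff[OF e(1), of t] zero[OF e(1)] e(2) t tail_between[OF e(1)] by auto
qed

text \<open>The only crossing edge \<open>e\<close> is a cut of the graph between the vertices above
  and below t. This excludes half-lines for \<open>e\<close>, and at its upper endpoint the missing
  tip supplies a further edge, which has no crossing and stays above t.\<close>

lemma single_crossing:
  assumes tips: "tips G len = {}" and two: "card (half_lines G len) \<ge> 2"
    and t: "0 < t" "t \<le> 1" and less: "(\<Sum>e\<in>arcs G. crossings e t) < 2"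
  shows "\<exists>e\<in>arcs G - half_lines G len. min (p e) (q e) < t \<and> t \<le> max (p e) (q e)"
    and "\<exists>f\<in>arcs G - half_lines G len. t \<le> min (p f) (q f)"
proof -
  have one: "(\<Sum>e\<in>arcs G. crossings e t) = 1"
    using less sum_crossings_ge_1[OF t] by simp
  obtain e where e: "e \<in> arcs G" "crossings e t = 1"
    and zero: "\<And>f. f \<in> arcs G \<Longrightarrow> f \<noteq> e \<Longrightarrow> crossings f t = 0"
    using one[unfolded sum_eq_1_iff[OF finite_arcs]] by (elim bexE) auto
  have diff: "(t \<le> w (tail G e)) \<noteq> (t \<le> w (head G e))" using crossings_eq_1D[OF e] .
  have bounded_e: "e \<notin> half_lines G len"
  proof
    assume eh: "e \<in> half_lines G len"
    then have hinf: "head G e \<in> verts_at_inf G len" by (auto simp: verts_at_inf_def)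
    then have te: "t \<le> w (tail G e)" using diff w_inf t by auto
    have "\<not> half_lines G len \<subseteq> {e}"
      using two card_mono[of "{e}" "half_lines G len"] by auto
    then obtain f where f: "f \<in> half_lines G len" "f \<noteq> e" by auto
    then have fG: "f \<in> arcs G" by (auto simp: half_lines_def)
    \<comment> \<open>Adding the end of \<open>e\<close> at infinity to the superlevel set repairs
      its only cut edge. The enlarged set is preserved by all edges, yet it contains the tail of
      \<open>e\<close> and misses the end of the second half-line \<open>f\<close>.\<close>
    let ?P = "\<lambda>v. v = head G e \<or> t \<le> w v"
    have "?P (tail G g) = ?P (head G g)" if g: "g \<in> arcs G" for g
    proof (cases "g = e")
      case True then show ?thesis using te by auto
    next
      case False
      then show ?thesis using arc_at_half_line_end[OF eh g] crossings_0D[OF g zero[OF g]] by auto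
    qed
    then have "?P (tail G e) = ?P (head G f)"
      by (rule connected_constant[OF connected]) (use e fG in auto)
    moreover have "head G f \<in> verts_at_inf G len" using f by (auto simp: verts_at_inf_def)
    ultimately show False
      using te w_inf[of "head G f"] t arc_at_half_line_end[OF eh fG f(2)] by auto
  qed
  show "\<exists>e\<in>arcs G - half_lines G len. min (p e) (q e) < t \<and> t \<le> max (p e) (q e)"
    using e bounded_e crossings_eq_0_iff[OF e(1), of t] by (intro bexI[of _ e]) auto
  obtain v where v: "v = tail G e \<or> v = head G e" "t \<le> w v" using diff by auto
  have "v \<in> verts G" using v(1) e(1) by auto
  moreover have "v \<notin> verts_at_inf G len" using w_inf[of v] v(2) t(1) by auto
  ultimately have deg: "degree G v \<noteq> 1" using tips by (auto simp: tips_def)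
  have "\<exists>f\<in>arcs G. f \<noteq> e \<and> (tail G f = v \<or> head G f = v)"
  proof (rule ccontr)
    assume "\<not> ?thesis"
    then have sub: "in_arcs G v \<subseteq> {e}" "out_arcs G v \<subseteq> {e}" by auto
    \<comment> \<open>The endpoints lie on different sides of t, so \<open>e\<close> is no loop and
      would count only once in the degree of \<open>v\<close>; alone at \<open>v\<close> it would
      make \<open>v\<close> a tip.\<close>
    have ne: "tail G e \<noteq> head G e"
    proof
      assume "tail G e = head G e"
      then show False using diff by simp
    qed
    show False
    proof (cases "v = tail G e")
      case True
      then have "out_arcs G v = {e}" "in_arcs G v = {}" using sub ne e(1) by auto
      then show False using deg by (simp add: degree_def in_degree_def out_degree_def)
    next
      case False
      then have "in_arcs G v = {e}" "out_arcs G v = {}" using sub ne e(1) v(1) by auto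
      then show False using deg by (simp add: degree_def in_degree_def out_degree_def)
    qed
  qed
  then obtain f where f: "f \<in> arcs G" "f \<noteq> e" "tail G f = v \<or> head G f = v" by auto
  have "t \<le> max (p f) (q f)" using f v tail_between[OF f(1)] head_between[OF f(1)] by auto
  then have "t \<le> min (p f) (q f)" using crossings_eq_0_iff[OF f(1), of t] zero[OF f(1,2)] by auto
  moreover from this have "f \<notin> half_lines G len" using q_inf t by force
  ultimately show "\<exists>f\<in>arcs G - half_lines G len. t \<le> min (p f) (q f)" using f(1) by auto
qed

end

section \<open>Weak derivatives\<close>

lemma L2_on_set_integrable_mult:
  assumes "L2_on I f" "L2_on I g" "I \<in> sets borel"
  shows "set_integrable lborel I (\<lambda>x. f x * g x)"
proof -
  have f: "set_borel_measurable lborel I f" "set_integrable lborel I (\<lambda>x. (f x)\<^sup>2)"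
    and g: "set_borel_measurable lborel I g" "set_integrable lborel I (\<lambda>x. (g x)\<^sup>2)"
    using assms by (auto simp: L2_on_def)
  have *: "set_integrable lborel I (\<lambda>x. (f x)\<^sup>2 + (g x)\<^sup>2)"
    using f g by (intro set_integral_add)
  show ?thesis
  proof (rule set_integrable_bound[OF *])
    have "(\<lambda>x. (indicator I x * f x) * (indicator I x * g x)) \<in> borel_measurable lborel"
      using borel_measurable_times[OF f(1)[unfolded set_borel_measurable_def]
          g(1)[unfolded set_borel_measurable_def]] by simp
    then show "set_borel_measurable lborel I (\<lambda>x. f x * g x)"
      unfolding set_borel_measurable_def
      by (rule measurable_cong[THEN iffD1, rotated]) (auto simp: indicator_def)
    have "\<bar>a * b\<bar> \<le> a\<^sup>2 + b\<^sup>2" for a b :: real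
      using sum_squares_bound[of "\<bar>a\<bar>" "\<bar>b\<bar>"] abs_ge_zero[of "a*b"] unfolding abs_mult power2_abs by linarith
    then show "AE x in lborel. x \<in> I \<longrightarrow> norm (f x * g x) \<le> norm ((f x)\<^sup>2 + (g x)\<^sup>2)"
      by auto
  qed
qed

lemma L2_on_const:
  assumes "J \<in> sets borel" "bounded J"
  shows "L2_on J (\<lambda>_. c)"
proof -
  have "emeasure lborel J < \<infinity>" using assms(2) by (rule emeasure_bounded_finite)
  then show ?thesis
    unfolding L2_on_def set_borel_measurable_def set_integrable_def
    using assms(1) by (auto intro!: integrable_real_indicator)
qed

lemma L2_on_subset:
  assumes "L2_on I f" "J \<subseteq> I" "J \<in> sets borel"
  shows "L2_on J f"
  using assms set_integrable_subset[of lborel I] set_borel_measurable_subset[of lborel I f J]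
  unfolding L2_on_def by auto

lemma L2_on_set_integrable:
  assumes "L2_on I g" "J \<subseteq> I" "J \<in> sets borel" "bounded J"
  shows "set_integrable lborel J g"
  using L2_on_set_integrable_mult[OF L2_on_subset[OF assms(1-3)] L2_on_const[OF assms(3,4), of 1] assms(3)]
  by simp

lemma L2_on_integral_Icc:
  assumes "L2_on I g" "{x<..<y} \<subseteq> I"
  shows "g integrable_on {x..y}" "(LBINT z:{x<..<y}. g z) = integral {x..y} g"
        "(\<lambda>z. \<bar>g z\<bar>) integrable_on {x..y}"
proof -
  have *: "set_integrable lborel {x<..<y} g" 
    by (rule L2_on_set_integrable[OF assms]) auto
  show "g integrable_on {x..y}"
    using set_borel_integral_eq_integral(1)[OF *] by (simp add: integrable_on_open_interval_real)
  show "(LBINT z:{x<..<y}. g z) = integral {x..y} g"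
    using set_borel_integral_eq_integral(2)[OF *] by (simp add: integral_open_interval_real)
  have "set_integrable lborel {x<..<y} (\<lambda>z. \<bar>g z\<bar>)" using * by (rule set_integrable_abs)
  from set_borel_integral_eq_integral(1)[OF this]
  show "(\<lambda>z. \<bar>g z\<bar>) integrable_on {x..y}" by (simp add: integrable_on_open_interval_real)
qed

lemma has_real_derivative_max_0_power2:
  "((\<lambda>s. (max 0 s)\<^sup>2) has_real_derivative 2 * max 0 s) (at (s::real))"
proof (cases "s = 0")
  case True
  have "(\<lambda>h::real. max 0 h) \<midarrow>0\<rightarrow> max 0 0" by (intro tendsto_intros)
  then have "(\<lambda>h::real. (max 0 h)\<^sup>2 / h) \<midarrow>0\<rightarrow> 0"
    by (rule filterlim_cong[THEN iffD1, rotated -1])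
       (auto simp: max_def power2_eq_square eventually_at_filter)
  then show ?thesis using True by (simp add: DERIV_def)
next
  case False
  show ?thesis
  proof (cases "s > 0")
    case True
    have "((\<lambda>s. s\<^sup>2) has_real_derivative 2 * s) (at s)" by (auto intro!: derivative_eq_intros)
    then have "((\<lambda>s. (max 0 s)\<^sup>2) has_real_derivative 2 * s) (at s)"
      by (rule DERIV_cong_ev[OF refl _ refl, THEN iffD1, rotated])
         (use True in \<open>auto intro!: eventually_mono[OF eventually_nhds_in_open[of "{0<..}" s]]\<close>)
    then show ?thesis using True by simp
  next
    case neg: False
    have "((\<lambda>s. 0) has_real_derivative 0) (at s)" by auto
    then have "((\<lambda>s. (max 0 s)\<^sup>2) has_real_derivative 0) (at s)"
      by (rule DERIV_cong_ev[OF refl _ refl, THEN iffD1, rotated])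
         (use neg False in \<open>auto intro!: eventually_mono[OF eventually_nhds_in_open[of "{..<0}" s]]\<close>)
    then show ?thesis using neg False by simp
  qed
qed

section \<open>Cutoffs of class \<open>C^1\<close> and the fundamental theorem for weak
  derivatives\<close>

definition smooth_step :: "real \<Rightarrow> real" where
  "smooth_step s = 2 * ((max 0 s)\<^sup>2 - 2 * (max 0 (s - 1/2))\<^sup>2 + (max 0 (s - 1))\<^sup>2)"

text \<open>The tent of height 2 on [0,1], zero outside, with integral 1. Its primitive is piecewise
  quadratic and only \<open>C^1\<close>, which is all that \<open>test_function\<close> asks
  for.\<close>

definition smooth_step' :: "real \<Rightarrow> real" where
  "smooth_step' s = 4 * (max 0 s - 2 * max 0 (s - 1/2) + max 0 (s - 1))"

lemma smooth_step_deriv: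
  "(smooth_step has_real_derivative smooth_step' s) (at s)"
proof -
  have *: "((\<lambda>s. (max 0 (s - c))\<^sup>2) has_real_derivative 2 * max 0 (s - c)) (at s)" for c :: real
  proof -
    have "((\<lambda>s. s - c) has_real_derivative 1) (at s)" by (auto intro!: derivative_eq_intros)
    from DERIV_chain2[OF has_real_derivative_max_0_power2 this] show ?thesis by simp
  qed
  show ?thesis
    unfolding smooth_step_def[abs_def] smooth_step'_def
    by (rule derivative_eq_intros has_real_derivative_max_0_power2 * refl)+ simp
qed

lemma smooth_step_eq_0: "s \<le> 0 \<Longrightarrow> smooth_step s = 0"
  and smooth_step_eq_1: "s \<ge> 1 \<Longrightarrow> smooth_step s = 1"
  and smooth_step'_eq_0: "s \<le> 0 \<or> s \<ge> 1 \<Longrightarrow> smooth_step' s = 0"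
  by (auto simp: smooth_step_def smooth_step'_def max_def power2_eq_square field_simps)

lemma smooth_step'_nonneg: "smooth_step' s \<ge> 0"
  by (auto simp: smooth_step'_def max_def)

lemma continuous_smooth_step': "continuous_on A smooth_step'"
  unfolding smooth_step'_def[abs_def] by (intro continuous_intros)

lemma mono_smooth_step: "mono smooth_step"
proof
  fix x y :: real assume "x \<le> y"
  then show "smooth_step x \<le> smooth_step y"
    using DERIV_nonneg_imp_nondecreasing smooth_step_deriv smooth_step'_nonneg by metis
qed

lemma smooth_step_bounds: "0 \<le> smooth_step s" "smooth_step s \<le> 1"
proof -
  show "0 \<le> smooth_step s"
    using monoD[OF mono_smooth_step, of 0 s] monoD[OF mono_smooth_step, of s 0] smooth_step_eq_0[of s] smooth_step_eq_0[of 0]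
    by (cases "s \<le> 0") auto
  show "smooth_step s \<le> 1"
    using monoD[OF mono_smooth_step, of s 1] smooth_step_eq_1[of s] smooth_step_eq_1[of 1]
    by (cases "s \<le> 1") auto
qed

lemma smooth_step_scaled_deriv:
  assumes "0 < d"
  shows "((\<lambda>z. smooth_step ((z - x) / d)) has_real_derivative smooth_step' ((z - x) / d) / d) (at z)"
proof -
  have "((\<lambda>z. (z - x) / d) has_real_derivative 1 / d) (at z)"
    using assms by (auto intro!: derivative_eq_intros)
  from DERIV_chain2[OF smooth_step_deriv this] show ?thesis by simp
qed

lemma integral_smooth_step':
  assumes "0 < d"
  shows "((\<lambda>z. smooth_step' ((z - x) / d) / d) has_integral 1) {x..x + d}"
proof -
  have deriv: "((\<lambda>z. smooth_step ((z - x) / d)) has_real_derivative smooth_step' ((z - x) / d) / d) (at z within S)"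
    for z S
    using smooth_step_scaled_deriv[OF assms] has_field_derivative_at_within by blast
  have "((\<lambda>z. smooth_step' ((z - x) / d) / d) has_integral
      smooth_step ((x + d - x) / d) - smooth_step ((x - x) / d)) {x..x + d}"
    by (rule fundamental_theorem_of_calculus)
       (use assms deriv in \<open>auto simp flip: has_real_derivative_iff_has_vector_derivative\<close>)
  then show ?thesis using assms by (simp add: smooth_step_eq_0 smooth_step_eq_1)
qed

text \<open>The scaled tent is a probability density on [x, x + d], so the integral is a weighted
  mean of \<open>f\<close> and inherits its distance to c.\<close>

lemma integral_mult_smooth_step':
  assumes d: "0 < d" and cont: "continuous_on {x..x + d} f"
    and bound: "\<And>z. z \<in> {x..x + d} \<Longrightarrow> \<bar>f z - c\<bar> \<le> e"
  shows "\<bar>integral {x..x + d} (\<lambda>z. f z * (smooth_step' ((z - x) / d) / d)) - c\<bar> \<le> e"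
proof -
  let ?k = "\<lambda>z. smooth_step' ((z - x) / d) / d"
  have k: "continuous_on {x..x + d} ?k"
    by (intro continuous_intros continuous_on_compose2[OF continuous_smooth_step'[of UNIV]])
       (use d in auto)
  have c: "((\<lambda>z. c * ?k z) has_integral c) {x..x + d}" "((\<lambda>z. e * ?k z) has_integral e) {x..x + d}"
    using has_integral_mult_right[OF integral_smooth_step'[OF d, of x]] by fastforce+
  have fk: "(\<lambda>z. f z * ?k z) integrable_on {x..x + d}"
    by (intro integrable_continuous_real continuous_intros cont k)
  have "integral {x..x + d} (\<lambda>z. f z * ?k z) - c = integral {x..x + d} (\<lambda>z. f z * ?k z - c * ?k z)"
    using Henstock_Kurzweil_Integration.integral_diff[OF fk has_integral_integrable[OF c(1)]]
      integral_unique[OF c(1)] by simp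
  also have "norm \<dots> \<le> integral {x..x + d} (\<lambda>z. e * ?k z)"
  proof (rule integral_norm_bound_integral)
    show "(\<lambda>z. f z * ?k z - c * ?k z) integrable_on {x..x + d}"
      using fk c(1) by (intro Henstock_Kurzweil_Integration.integrable_diff) auto
    show "norm (f z * ?k z - c * ?k z) \<le> e * ?k z" if "z \<in> {x..x + d}" for z
    proof -
      have "0 \<le> ?k z" using d smooth_step'_nonneg by simp
      then have "\<bar>f z - c\<bar> * \<bar>?k z\<bar> \<le> e * ?k z"
        using mult_right_mono[OF bound[OF that], of "?k z"] by (simp only: abs_of_nonneg)
      then show ?thesis by (simp only: abs_mult[symmetric] real_norm_def left_diff_distrib)
    qed
  qed (use c in auto)
  finally show ?thesis using integral_unique[OF c(2)] by simp
qed

text \<open>The test functions are trapezoids that rise just after x and fall just after y, so their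
  derivatives approximate the difference of the point masses at x and y. Continuity of
  \<open>f\<close> gives the limit on one side, dominated convergence on the other.\<close>

lemma weak_deriv_FTC_interior:
  assumes wd: "has_weak_L2_deriv I f g" and I: "open I" and cont: "continuous_on I f"
    and xy: "x < y" "{x..y} \<subseteq> I"
  shows "f y - f x = integral {x..y} g"
proof -
  have g: "L2_on I g" and test: "\<And>\<phi> \<phi>'. test_function I \<phi> \<phi>' \<Longrightarrow>
        (LBINT x:I. f x * \<phi>' x) = - (LBINT x:I. g x * \<phi> x)"
    using wd by (auto simp: has_weak_L2_deriv_def)
  have "y \<in> I" using xy by auto
  then obtain r where r: "r > 0" "cball y r \<subseteq> I" using I by (auto simp: open_contains_cball)
  \<comment> \<open>Room to the right of y for the descending flank, whose width \<open>d n\<close>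
    never exceeds \<open>b - y\<close>. The bound by \<open>y - x\<close> ensures that the rising
    flank also ends before b.\<close>
  define b where "b = y + min r (y - x)"
  have b: "y < b" "{x..b} \<subseteq> I"
  proof -
    show "y < b" using r xy by (simp add: b_def)
    have "{y..b} \<subseteq> cball y r" by (auto simp: b_def dist_real_def)
    moreover have "{x..b} \<subseteq> {x..y} \<union> {y..b}" by auto
    ultimately show "{x..b} \<subseteq> I" using r(2) xy(2) by blast
  qed
  define d where "d n = (b - y) / real (Suc n)" for n
  have d: "0 < d n" "d n \<le> b - y" for n using b by (auto simp: d_def field_simps intro: mult_right_mono)
  have d0: "d \<longlonglongrightarrow> 0" unfolding d_def by (rule LIMSEQ_Suc[OF lim_const_over_n])
  define \<phi> where "\<phi> n z = smooth_step ((z - x) / d n) - smooth_step ((z - y) / d n)" for n z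
  define k where "k n a z = smooth_step' ((z - a) / d n) / d n" for n a z
  have k0: "k n a z = 0" if "z \<notin> {a..a + d n}" for n a z
    using that d[of n] by (auto simp: k_def field_simps intro!: smooth_step'_eq_0)
  have \<phi>0: "\<phi> n z = 0" if "z \<notin> {x..b}" for n z
  proof (cases "z < x")
    case True
    then show ?thesis using d(1)[of n] xy by (simp add: \<phi>_def smooth_step_eq_0 field_simps)
  next
    case False
    then have "z > b" using that by auto
    then have "(z - x) / d n \<ge> 1" "(z - y) / d n \<ge> 1" using d[of n] xy by (auto simp: field_simps)
    then show ?thesis by (simp add: \<phi>_def smooth_step_eq_1)
  qed
  have \<phi>1: "\<bar>\<phi> n z\<bar> \<le> 1" for n z
    using smooth_step_bounds[of "(z - x) / d n"] smooth_step_bounds[of "(z - y) / d n"]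
    by (auto simp: \<phi>_def abs_le_iff)
  have k_cont: "continuous_on A (k n a)" for A n a
    unfolding k_def[abs_def]
    by (intro continuous_intros continuous_on_compose2[OF continuous_smooth_step'[of UNIV]])
       (use d[of n] in auto)
  have \<phi>_deriv: "(\<phi> n has_real_derivative k n x z - k n y z) (at z)" for n z
    unfolding \<phi>_def[abs_def] k_def
    by (intro derivative_intros smooth_step_scaled_deriv d)
  have tf: "test_function I (\<phi> n) (\<lambda>z. k n x z - k n y z)" for n
    unfolding test_function_def using \<phi>_deriv \<phi>0 b(2)
    by (auto intro!: continuous_intros k_cont exI[of _ "{x..b}"])
  have cont_\<phi>: "continuous_on UNIV (\<phi> n)" for n
    using \<phi>_deriv by (meson DERIV_isCont continuous_at_imp_continuous_on)
  have gb: "set_integrable lborel {x..b} g" by (rule L2_on_set_integrable[OF g b(2)]) auto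
  have "(\<lambda>n. LINT z|lborel. indicator {x..b} z * g z * \<phi> n z)
      \<longlonglongrightarrow> (LINT z|lborel. indicator {x<..<y} z * g z)"
  proof (rule integral_dominated_convergence[where w = "\<lambda>z. \<bar>indicator {x..b} z * g z\<bar>"])
    have m: "(\<lambda>z. indicator {x..b} z * g z) \<in> borel_measurable lborel"
      using gb by (auto simp: set_integrable_def)
    show "(\<lambda>z. indicator {x..b} z * g z * \<phi> n z) \<in> borel_measurable lborel" for n
      using borel_measurable_times[OF m, of "\<phi> n"] borel_measurable_continuous_onI[OF cont_\<phi>[of n]] by simp
    have "(\<lambda>z. indicator {x<..<y} z * (indicator {x..b} z * g z)) \<in> borel_measurable lborel"
      using borel_measurable_times[OF _ m, of "indicator {x<..<y}"] by simp
    then show "(\<lambda>z. indicator {x<..<y} z * g z) \<in> borel_measurable lborel"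
      by (rule measurable_cong[THEN iffD1, rotated]) (use b in \<open>auto simp: indicator_def\<close>)
    show "integrable lborel (\<lambda>z. \<bar>indicator {x..b} z * g z\<bar>)"
      using gb by (auto simp: set_integrable_def)
    show "AE z in lborel. norm (indicator {x..b} z * g z * \<phi> n z) \<le> \<bar>indicator {x..b} z * g z\<bar>" for n
      using mult_left_mono[OF \<phi>1] by (intro AE_I2) (simp add: abs_mult mult_left_le)
    have "(\<lambda>n. indicator {x..b} z * g z * \<phi> n z) \<longlonglongrightarrow> indicator {x<..<y} z * g z" if "z \<noteq> y" for z
    proof -
      have far: "eventually (\<lambda>n. smooth_step ((z - a) / d n) = (if z \<le> a then 0 else 1)) sequentially" for a
      proof (cases "z \<le> a")
        case True
        then show ?thesis using d(1) by (simp add: smooth_step_eq_0 divide_nonpos_pos)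
      next
        case False
        then have "eventually (\<lambda>n. d n < z - a) sequentially"
          using order_tendstoD(2)[OF d0, of "z - a"] by simp
        then show ?thesis
          by eventually_elim (use False d(1) in \<open>auto intro!: smooth_step_eq_1 simp: field_simps\<close>)
      qed
      have "eventually (\<lambda>n. indicator {x..b} z * g z * \<phi> n z = indicator {x<..<y} z * g z) sequentially"
        using far[of x] far[of y]
      proof eventually_elim
        case (elim n)
        then show ?case using that \<phi>0[of z n] xy b unfolding \<phi>_def
          by (auto simp: indicator_def)
      qed
      then show ?thesis by (rule tendsto_eventually)
    qed
    \<comment> \<open>At z = y the trapezoids tend to 1 while the indicator of the open interval is
      0, so this single point is left out.\<close>
    then show "AE z in lborel. (\<lambda>n. indicator {x..b} z * g z * \<phi> n z) \<longlonglongrightarrow> indicator {x<..<y} z * g z"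
      using AE_lborel_singleton[of y] by auto
  qed
  moreover have "(LINT z|lborel. indicator {x<..<y} z * g z) = integral {x..y} g"
  proof -
    have "{x<..<y} \<subseteq> I" using xy(2) by force
    from L2_on_integral_Icc(2)[OF g this] show ?thesis by (simp add: set_lebesgue_integral_def)
  qed
  moreover have "(LINT z|lborel. indicator {x..b} z * g z * \<phi> n z) = (LBINT z:I. g z * \<phi> n z)" for n
    unfolding set_lebesgue_integral_def
    by (rule Bochner_Integration.integral_cong) (use \<phi>0 b(2) in \<open>auto simp: indicator_def\<close>)
  ultimately have lim_g: "(\<lambda>n. LBINT z:I. g z * \<phi> n z) \<longlonglongrightarrow> integral {x..y} g" by simp
  have lim_f: "(\<lambda>n. integral {a..a + d n} (\<lambda>z. f z * k n a z)) \<longlonglongrightarrow> f a" if a: "a \<in> {x..y}" for a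
  proof (rule tendstoI)
    fix e :: real assume "e > 0"
    have "isCont f a" using cont I a xy(2) by (auto simp: continuous_on_eq_continuous_at)
    then obtain \<delta> where \<delta>: "\<delta> > 0" "\<And>z. dist z a < \<delta> \<Longrightarrow> dist (f z) (f a) < e / 2"
      using \<open>e > 0\<close> unfolding continuous_at_eps_delta by (metis half_gt_zero)
    have "eventually (\<lambda>n. d n < \<delta>) sequentially" using order_tendstoD(2)[OF d0 \<delta>(1)] .
    then show "eventually (\<lambda>n. dist (integral {a..a + d n} (\<lambda>z. f z * k n a z)) (f a) < e) sequentially"
    proof eventually_elim
      case (elim n)
      have "\<bar>integral {a..a + d n} (\<lambda>z. f z * (smooth_step' ((z - a) / d n) / d n)) - f a\<bar> \<le> e / 2"
      proof (rule integral_mult_smooth_step'[OF d(1)])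
        have "{a..a + d n} \<subseteq> {x..b}" using a d[of n] by auto
        then show "continuous_on {a..a + d n} f" using b(2) cont continuous_on_subset by blast
        show "\<bar>f z - f a\<bar> \<le> e / 2" if "z \<in> {a..a + d n}" for z
          using \<delta>(2)[of z] that elim by (auto simp: dist_real_def)
      qed
      then show ?case using \<open>e > 0\<close> by (simp add: k_def dist_real_def)
    qed
  qed
  have fk: "set_integrable lborel I (\<lambda>z. f z * k n a z)"
    "(LBINT z:I. f z * k n a z) = integral {a..a + d n} (\<lambda>z. f z * k n a z)" if a: "a \<in> {x..y}" for a n
  proof -
    have sub: "{a..a + d n} \<subseteq> I" using b(2) a d[of n] by auto
    have *: "set_integrable lborel {a..a + d n} (\<lambda>z. f z * k n a z)"
      by (intro borel_integrable_atLeastAtMost' continuous_intros k_cont continuous_on_subset[OF cont sub])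
    have eq: "indicator {a..a + d n} z * (f z * k n a z) = indicator I z * (f z * k n a z)" for z
      using sub k0[of z a n] by (auto simp: indicator_def)
    show "set_integrable lborel I (\<lambda>z. f z * k n a z)"
      using * unfolding set_integrable_def by (simp add: eq)
    show "(LBINT z:I. f z * k n a z) = integral {a..a + d n} (\<lambda>z. f z * k n a z)"
      unfolding set_borel_integral_eq_integral(2)[OF *, symmetric]
      by (simp add: set_lebesgue_integral_def eq)
  qed
  have "(LBINT z:I. f z * (k n x z - k n y z)) =
      integral {x..x + d n} (\<lambda>z. f z * k n x z) - integral {y..y + d n} (\<lambda>z. f z * k n y z)" for n
    using set_integral_diff(2)[OF fk(1) fk(1), of x y n n] fk(2)[of x n] fk(2)[of y n] xy(1)
    by (simp add: right_diff_distrib)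
  then have "(\<lambda>n. - (LBINT z:I. g z * \<phi> n z)) \<longlonglongrightarrow> f x - f y"
    using tendsto_diff[OF lim_f[of x] lim_f[of y]] xy test[OF tf] by simp
  from LIMSEQ_unique[OF this tendsto_minus[OF lim_g]] show ?thesis by simp
qed

section \<open>Functions of class \<open>H\<^sup>1\<close> on an edge\<close>

lemma set_integrable_Icc:
  fixes F :: "real \<Rightarrow> real"
  assumes "set_integrable lborel I F" "{x<..<y} \<subseteq> I"
  shows "F integrable_on {x..y}" "(LBINT z:{x<..<y}. F z) = integral {x..y} F"
proof -
  have *: "set_integrable lborel {x<..<y} F"
    by (rule set_integrable_subset[OF assms(1)]) (use assms(2) in auto)
  show "F integrable_on {x..y}"
    using set_borel_integral_eq_integral(1)[OF *] by (simp add: integrable_on_open_interval_real)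
  show "(LBINT z:{x<..<y}. F z) = integral {x..y} F"
    using set_borel_integral_eq_integral(2)[OF *] by (simp add: integral_open_interval_real)
qed

lemma set_integral_Icc_le:
  fixes F :: "real \<Rightarrow> real"
  assumes F: "set_integrable lborel I F" "{x<..<y} \<subseteq> I" and pos: "\<And>z. z \<in> I \<Longrightarrow> 0 \<le> F z"
  shows "integral {x..y} F \<le> (LBINT z:I. F z)"
proof -
  have "integral {x<..<y} F \<le> integral I F"
    using set_integrable_Icc(1)[OF F] set_borel_integral_eq_integral(1)[OF F(1)] F(2) pos
    by (intro integral_subset_le) (auto simp: integrable_on_open_interval_real)
  then show ?thesis
    using set_borel_integral_eq_integral(2)[OF F(1)] by (simp add: integral_open_interval_real)
qed

text \<open>A chain rule in the form of an inequality: only the increments of p are controlled, so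
  it applies to \<bar>u\<bar> without differentiating the absolute value or discussing almost
  everywhere derivatives.\<close>

lemma variation_le_integral:
  fixes p h \<gamma> \<Gamma> :: "real \<Rightarrow> real"
  assumes xy: "x \<le> y" and p: "continuous_on {x..y} p" "\<And>z. z \<in> {x..y} \<Longrightarrow> p z \<in> J"
    and h: "h integrable_on {x..y}" "\<And>z. 0 \<le> h z"
    and inc: "\<And>c d. x \<le> c \<Longrightarrow> c \<le> d \<Longrightarrow> d \<le> y \<Longrightarrow> \<bar>p d - p c\<bar> \<le> integral {c..d} h"
    and \<gamma>: "continuous_on J \<gamma>" "\<And>s. s \<in> J \<Longrightarrow> 0 \<le> \<gamma> s" and J: "convex J"
    and \<Gamma>: "\<And>s. s \<in> J \<Longrightarrow> (\<Gamma> has_real_derivative \<gamma> s) (at s within J)"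
    and int: "(\<lambda>z. \<gamma> (p z) * h z) integrable_on {x..y}"
  shows "\<bar>\<Gamma> (p y) - \<Gamma> (p x)\<bar> \<le> integral {x..y} (\<lambda>z. \<gamma> (p z) * h z)"
proof -
  have *: "\<bar>\<Gamma> (p y) - \<Gamma> (p x)\<bar> \<le> integral {x..y} (\<lambda>z. \<gamma> (p z) * h z) + e * integral {x..y} h"
    if "e > 0" for e
  proof -
    let ?P = "\<lambda>c d. x \<le> c \<and> c \<le> d \<and> d \<le> y \<longrightarrow> \<bar>\<Gamma> (p d) - \<Gamma> (p c)\<bar> \<le>
      integral {c..d} (\<lambda>z. \<gamma> (p z) * h z) + e * integral {c..d} h"
    have sub: "h integrable_on {c..d}" "(\<lambda>z. \<gamma> (p z) * h z) integrable_on {c..d}" if "x \<le> c" "d \<le> y" for c d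
      using integrable_on_subinterval[OF h(1)] integrable_on_subinterval[OF int] that by auto
    \<comment> \<open>The estimate with error \<open>e\<close> times the integral of h is additive
      over adjacent intervals. By the bisection principle it only has to hold on short intervals
      around each point.\<close>
    have "?P x y"
      using xy
    proof (induction rule: Bolzano[where P = ?P])
      case (trans a b c)
      show ?case
      proof (rule impI)
        assume A: "x \<le> a \<and> a \<le> c \<and> c \<le> y"
        have "integral {a..c} (\<lambda>z. \<gamma> (p z) * h z) =
            integral {a..b} (\<lambda>z. \<gamma> (p z) * h z) + integral {b..c} (\<lambda>z. \<gamma> (p z) * h z)"
          "integral {a..c} h = integral {a..b} h + integral {b..c} h"
          using trans sub[of a c] A by (simp_all add: Henstock_Kurzweil_Integration.integral_combine)
        then show "\<bar>\<Gamma> (p c) - \<Gamma> (p a)\<bar> \<le> integral {a..c} (\<lambda>z. \<gamma> (p z) * h z) + e * integral {a..c} h"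
          using trans A by (simp add: distrib_left)
      qed
    next
      case (local t)
      have t: "t \<in> {x..y}" using local by simp
      have "continuous (at (p t) within J) \<gamma>"
        using \<gamma>(1) p(2)[OF t] by (simp add: continuous_on_eq_continuous_within)
      then obtain \<eta> where \<eta>: "\<eta> > 0" "\<And>s. s \<in> J \<Longrightarrow> dist s (p t) < \<eta> \<Longrightarrow> dist (\<gamma> s) (\<gamma> (p t)) < e / 2"
        unfolding continuous_within_eps_delta using \<open>e > 0\<close> by (metis half_gt_zero)
      have "continuous (at t within {x..y}) p"
        using p(1) t by (simp add: continuous_on_eq_continuous_within)
      then obtain \<delta> where \<delta>: "\<delta> > 0" "\<And>z. z \<in> {x..y} \<Longrightarrow> dist z t < \<delta> \<Longrightarrow> dist (p z) (p t) < \<eta>"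
        unfolding continuous_within_eps_delta using \<eta>(1) by metis
      have "?P c d" if cd: "c \<le> t \<and> t \<le> d \<and> d - c < \<delta>" for c d
      proof
        assume A: "x \<le> c \<and> c \<le> d \<and> d \<le> y"
        let ?S = "J \<inter> ball (p t) \<eta>"
        have near: "p z \<in> ?S" if "z \<in> {c..d}" for z
          using \<delta>(2)[of z] p(2)[of z] that cd A by (auto simp: dist_commute dist_real_def)
        \<comment> \<open>On a short interval \<gamma> varies by less than e / 2 along the values of
          p, hence the mean value bound for \<Gamma> costs e / 2, and returning from
          \<open>p t\<close> to \<open>p z\<close> costs another e / 2.\<close>
        have lin: "norm (\<Gamma> (p d) - \<Gamma> (p c)) \<le> (\<gamma> (p t) + e / 2) * norm (p d - p c)"
        proof (rule field_differentiable_bound[of ?S \<Gamma> \<gamma>])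
          show "convex ?S" using J by (intro convex_Int) auto
          show "(\<Gamma> has_field_derivative \<gamma> s) (at s within ?S)" if "s \<in> ?S" for s
            using \<Gamma>[of s] that by (auto intro: DERIV_subset)
          show "norm (\<gamma> s) \<le> \<gamma> (p t) + e / 2" if "s \<in> ?S" for s
          proof -
            have "\<bar>\<gamma> s - \<gamma> (p t)\<bar> < e / 2"
              using \<eta>(2)[of s] that by (simp add: dist_commute dist_real_def)
            then show ?thesis using \<gamma>(2)[of s] that unfolding abs_diff_less_iff by simp
          qed
        qed (use near[of c] near[of d] A in auto)
        have ge: "0 \<le> \<gamma> (p t)" using \<gamma>(2) p(2) t by auto
        have "\<bar>\<Gamma> (p d) - \<Gamma> (p c)\<bar> \<le> (\<gamma> (p t) + e / 2) * integral {c..d} h"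
        proof -
          have "\<bar>p d - p c\<bar> \<le> integral {c..d} h" "0 \<le> \<gamma> (p t) + e / 2" using inc[of c d] A ge \<open>e > 0\<close> by auto
          then have "(\<gamma> (p t) + e / 2) * \<bar>p d - p c\<bar> \<le> (\<gamma> (p t) + e / 2) * integral {c..d} h"
            by (rule mult_left_mono)
          then show ?thesis using lin by simp
        qed
        also have "\<dots> = integral {c..d} (\<lambda>z. (\<gamma> (p t) + e / 2) * h z)"
          by simp
        also have "\<dots> \<le> integral {c..d} (\<lambda>z. \<gamma> (p z) * h z + e * h z)"
        proof (rule integral_le)
          show "(\<gamma> (p t) + e / 2) * h z \<le> \<gamma> (p z) * h z + e * h z" if "z \<in> {c..d}" for z
          proof -
            have "\<gamma> (p t) + e / 2 \<le> \<gamma> (p z) + e"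
            proof -
              have "\<bar>\<gamma> (p z) - \<gamma> (p t)\<bar> < e / 2"
                using \<eta>(2)[of "p z"] near[OF that] by (simp add: abs_minus_commute dist_real_def)
              then show ?thesis unfolding abs_diff_less_iff by simp
            qed
            from mult_right_mono[OF this h(2)[of z]] show ?thesis by (simp only: distrib_right)
          qed
        qed (use sub[of c d] A in \<open>auto intro!: integrable_add integrable_on_mult_right\<close>)
        also have "\<dots> = integral {c..d} (\<lambda>z. \<gamma> (p z) * h z) + e * integral {c..d} h"
          using sub[of c d] A by (subst Henstock_Kurzweil_Integration.integral_add)
            (auto intro!: integrable_on_mult_right)
        finally show "\<bar>\<Gamma> (p d) - \<Gamma> (p c)\<bar> \<le> integral {c..d} (\<lambda>z. \<gamma> (p z) * h z) + e * integral {c..d} h" .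
      qed
      then show ?case using \<delta>(1) by blast
    qed
    then show ?thesis using xy by simp
  qed
  have H: "0 \<le> integral {x..y} h" using h by (intro Henstock_Kurzweil_Integration.integral_nonneg) auto
  show ?thesis
  proof (rule field_le_epsilon)
    fix e :: real assume "e > 0"
    let ?e = "e / (integral {x..y} h + 1)"
    have "?e * integral {x..y} h \<le> e" using H \<open>e > 0\<close> by (simp add: field_simps)
    then show "\<bar>\<Gamma> (p y) - \<Gamma> (p x)\<bar> \<le> integral {x..y} (\<lambda>z. \<gamma> (p z) * h z) + e"
      using *[of ?e] H \<open>e > 0\<close> by simp
  qed
qed

text \<open>The Sobolev condition in integrated form, with increments up to the endpoints of the
  edge. It is what all later estimates use, and it passes directly to multiples of
  \<open>f\<close>.\<close>

definition H1_edge :: "ereal \<Rightarrow> (real \<Rightarrow> real) \<Rightarrow> (real \<Rightarrow> real) \<Rightarrow> bool" where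
  "H1_edge l f g \<longleftrightarrow> continuous_on (edge_points l) f \<and> L2_on (edge_interior l) f \<and>
     L2_on (edge_interior l) g \<and>
     (\<forall>x y. 0 \<le> x \<longrightarrow> x \<le> y \<longrightarrow> ereal y \<le> l \<longrightarrow> f y - f x = integral {x..y} g)"

lemma open_edge_interior: "open (edge_interior l)"
proof -
  have "edge_interior l = {x. 0 < x} \<inter> {x. ereal x < l}" by (auto simp: edge_interior_def)
  then show ?thesis by (auto intro!: open_Int open_Collect_less continuous_intros)
qed

lemma edge_interior_borel [measurable]: "edge_interior l \<in> sets borel"
  using open_edge_interior by auto

lemma edge_interior_subset: "edge_interior l \<subseteq> edge_points l"
  by (auto simp: edge_interior_def edge_points_def)

lemma Ioo_subset_edge_interior:
  assumes "0 \<le> x" "ereal y \<le> l"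
  shows "{x<..<y} \<subseteq> edge_interior l"
  using assms by (auto simp: edge_interior_def) (metis ereal_less_eq(3) less_ereal.simps(1) order_less_le_trans)

lemma Icc_subset_edge_points:
  assumes "0 \<le> x" "ereal y \<le> l"
  shows "{x..y} \<subseteq> edge_points l"
  using assms by (auto simp: edge_points_def) (metis ereal_less_eq(3) order_trans)

lemma H1_edgeI:
  assumes cont: "continuous_on (edge_points l) f" and f: "L2_on (edge_interior l) f"
    and wd: "has_weak_L2_deriv (edge_interior l) f g"
  shows "H1_edge l f g"
  unfolding H1_edge_def
proof (intro conjI allI impI)
  show g: "L2_on (edge_interior l) g" using wd by (simp add: has_weak_L2_deriv_def)
  fix x y assume A: "0 \<le> x" "x \<le> y" "ereal y \<le> l"
  show "f y - f x = integral {x..y} g"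
  proof (cases "x = y")
    case False
    then have xy: "x < y" using A by simp
    have gi: "g integrable_on {x..y}" by (rule L2_on_integral_Icc(1)[OF g Ioo_subset_edge_interior[OF A(1,3)]])
    \<comment> \<open>\<open>D\<close> is constant in the open interval by the interior version, and
      continuous on the closed one, so the endpoints, which test functions cannot see, are reached
      by closure.\<close>
    define D where "D s = f s - integral {x..s} g" for s
    have Dc: "continuous_on {x..y} D" unfolding D_def
      using cont Icc_subset_edge_points[OF A(1,3)] indefinite_integral_continuous_1[OF gi]
      by (intro continuous_intros) (auto intro: continuous_on_subset)
    define m where "m = (x + y) / 2"
    have m: "m \<in> {x<..<y}" using xy by (auto simp: m_def)
    have eq: "D s = D r" if "x < s" "s < r" "r < y" for s r
    proof -
      have "f r - f s = integral {s..r} g"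
      proof (rule weak_deriv_FTC_interior[OF wd open_edge_interior])
        show "continuous_on (edge_interior l) f" using cont edge_interior_subset continuous_on_subset by blast
        show "{s..r} \<subseteq> edge_interior l" using Ioo_subset_edge_interior[OF A(1,3)] that by force
      qed (use that in auto)
      moreover have "integral {x..s} g + integral {s..r} g = integral {x..r} g"
        using that integrable_on_subinterval[OF gi, of x r]
        by (intro Henstock_Kurzweil_Integration.integral_combine) auto
      ultimately show ?thesis by (simp add: D_def)
    qed
    have const: "D s = D m" if "s \<in> {x<..<y}" for s
      using eq[of s m] eq[of m s] m that by (cases s m rule: linorder_cases) auto
    have "D s = D m" if "s \<in> {x..y}" for s
      using continuous_constant_on_closure[of "{x<..<y}" D "D m" s] Dc const xy that by simp
    from this[of x] this[of y] show ?thesis using xy by (simp add: D_def)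
  qed auto
qed (use assms in auto)

lemma H1_edge_mult_integrable:
  assumes "H1_edge l f g"
  shows "set_integrable lborel (edge_interior l) (\<lambda>x. \<bar>f x\<bar> * \<bar>g x\<bar>)"
    "set_integrable lborel (edge_interior l) (\<lambda>x. (f x)\<^sup>2)"
    "set_integrable lborel (edge_interior l) (\<lambda>x. (g x)\<^sup>2)"
  using assms set_integrable_abs[OF L2_on_set_integrable_mult[of "edge_interior l" f g]]
  by (auto simp: H1_edge_def L2_on_def abs_mult edge_interior_borel)

lemma H1_edge_increment:
  assumes H: "H1_edge l f g" and A: "0 \<le> x" "x \<le> y" "ereal y \<le> l"
  shows "\<bar>\<bar>f y\<bar> - \<bar>f x\<bar>\<bar> \<le> integral {x..y} (\<lambda>z. \<bar>g z\<bar>)"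
    "(\<lambda>z. \<bar>g z\<bar>) integrable_on {x..y}"
proof -
  have g: "L2_on (edge_interior l) g" using H by (simp add: H1_edge_def)
  note int = L2_on_integral_Icc[OF g Ioo_subset_edge_interior[OF A(1,3)]]
  show "(\<lambda>z. \<bar>g z\<bar>) integrable_on {x..y}" by (rule int(3))
  have "\<bar>\<bar>f y\<bar> - \<bar>f x\<bar>\<bar> \<le> \<bar>f y - f x\<bar>" by simp
  also have "f y - f x = integral {x..y} g" using H A by (simp add: H1_edge_def)
  also have "\<bar>integral {x..y} g\<bar> \<le> integral {x..y} (\<lambda>z. \<bar>g z\<bar>)"
    using integral_norm_bound_integral[OF int(1,3)] by simp
  finally show "\<bar>\<bar>f y\<bar> - \<bar>f x\<bar>\<bar> \<le> integral {x..y} (\<lambda>z. \<bar>g z\<bar>)" .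
qed

lemma H1_edge_variation:
  assumes H: "H1_edge l f g" and A: "0 \<le> x" "x \<le> y" "ereal y \<le> l"
    and \<gamma>: "continuous_on J \<gamma>" "\<And>s. s \<in> J \<Longrightarrow> 0 \<le> \<gamma> s" and J: "convex J"
    and \<Gamma>: "\<And>s. s \<in> J \<Longrightarrow> (\<Gamma> has_real_derivative \<gamma> s) (at s within J)"
    and range: "\<And>z. z \<in> edge_points l \<Longrightarrow> \<bar>f z\<bar> \<in> J"
    and int: "set_integrable lborel (edge_interior l) (\<lambda>z. \<gamma> \<bar>f z\<bar> * \<bar>g z\<bar>)"
  shows "\<bar>\<Gamma> \<bar>f y\<bar> - \<Gamma> \<bar>f x\<bar>\<bar> \<le> integral {x..y} (\<lambda>z. \<gamma> \<bar>f z\<bar> * \<bar>g z\<bar>)"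
proof (rule variation_le_integral[OF A(2), where J = J])
  show "continuous_on {x..y} (\<lambda>z. \<bar>f z\<bar>)"
    using H Icc_subset_edge_points[OF A(1,3)] by (auto simp: H1_edge_def intro!: continuous_intros intro: continuous_on_subset)
  show "\<bar>f z\<bar> \<in> J" if "z \<in> {x..y}" for z
    using range that Icc_subset_edge_points[OF A(1,3)] by auto
  show "(\<lambda>z. \<bar>g z\<bar>) integrable_on {x..y}" by (rule H1_edge_increment(2)[OF H A])
  fix c d assume cd: "x \<le> c" "c \<le> d" "d \<le> y"
  have "ereal d \<le> l" using cd A(3) by (metis ereal_less_eq(3) order_trans)
  then show "\<bar>\<bar>f d\<bar> - \<bar>f c\<bar>\<bar> \<le> integral {c..d} (\<lambda>z. \<bar>g z\<bar>)"
    using H1_edge_increment(1)[OF H, of c d] A cd by simp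
next
  show "(\<lambda>z. \<gamma> \<bar>f z\<bar> * \<bar>g z\<bar>) integrable_on {x..y}"
    by (rule set_integrable_Icc(1)[OF int Ioo_subset_edge_interior[OF A(1,3)]])
qed (use \<gamma> J \<Gamma> in auto)

text \<open>The increments of \<open>f^2\<close> are bounded by integrals of
  \<open>f^2 + g^2\<close>, whose tails vanish. So \<open>f^2\<close> varies little far out, and it
  cannot stay away from 0 on a whole unit interval there.\<close>

lemma H1_edge_tendsto_0:
  assumes H: "H1_edge \<infinity> f g"
  shows "(f \<longlongrightarrow> 0) at_top"
proof -
  let ?I = "edge_interior \<infinity>"
  have I: "?I = {0<..}" by (auto simp: edge_interior_def)
  let ?F = "\<lambda>z. (f z)\<^sup>2 + (g z)\<^sup>2"
  have F: "set_integrable lborel ?I ?F" using H1_edge_mult_integrable[OF H] by (intro set_integral_add)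
  have F1: "?F integrable_on {x..y}" if "0 \<le> x" for x y
    using set_integrable_Icc(1)[OF F Ioo_subset_edge_interior[OF that]] by simp
  have f1: "(\<lambda>z. (f z)\<^sup>2) integrable_on {x..y}" if "0 \<le> x" for x y
    using set_integrable_Icc(1)[OF H1_edge_mult_integrable(2)[OF H] Ioo_subset_edge_interior[OF that]] by simp
  have sq: "\<bar>(f y)\<^sup>2 - (f x)\<^sup>2\<bar> \<le> integral {x..y} ?F" if "0 \<le> x" "x \<le> y" for x y
  proof -
    have int: "set_integrable lborel ?I (\<lambda>z. 2 * \<bar>f z\<bar> * \<bar>g z\<bar>)"
      using set_integrable_mult_right[OF H1_edge_mult_integrable(1)[OF H], of 2] by (simp add: mult.assoc)
    have "\<bar>\<bar>f y\<bar>\<^sup>2 - \<bar>f x\<bar>\<^sup>2\<bar> \<le> integral {x..y} (\<lambda>z. 2 * \<bar>f z\<bar> * \<bar>g z\<bar>)"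
      by (rule H1_edge_variation[OF H that, where J = "{0..}" and \<gamma> = "\<lambda>s. 2 * s"])
         (use int in \<open>auto intro!: continuous_intros derivative_eq_intros\<close>)
    also have "\<dots> \<le> integral {x..y} ?F"
      using set_integrable_Icc(1)[OF int Ioo_subset_edge_interior[OF that(1)]] F1[OF that(1)]
      by (intro integral_le) (auto simp: sum_squares_bound[of "\<bar>_\<bar>" "\<bar>_\<bar>", simplified])
    finally show ?thesis by simp
  qed
  have lim: "(\<lambda>n. LBINT z:{0<..<real n}. ?F z) \<longlonglongrightarrow> (LBINT z:(\<Union>n. {0<..<real n}). ?F z)"
  proof (rule set_integral_cont_up)
    have "(\<Union>n. {0<..<real n}) = ?I" unfolding I using reals_Archimedean2 by auto
    then show "set_integrable lborel (\<Union>n. {0<..<real n}) ?F" using F by simp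
  qed (auto simp: incseq_def)
  have "((\<lambda>x. (f x)\<^sup>2) \<longlongrightarrow> 0) at_top"
  proof (rule tendstoI)
    fix e :: real assume e: "e > 0"
    have "Cauchy (\<lambda>n. LBINT z:{0<..<real n}. ?F z)" using lim LIMSEQ_imp_Cauchy by blast
    then obtain N where N: "\<And>m n. m \<ge> N \<Longrightarrow> n \<ge> N \<Longrightarrow>
        dist (LBINT z:{0<..<real m}. ?F z) (LBINT z:{0<..<real n}. ?F z) < e / 2"
      using metric_CauchyD[OF _ half_gt_zero[OF e]] by blast
    have small: "integral {x..y} ?F < e / 2" if "real N \<le> x" "x \<le> y" for x y
    proof -
      obtain m where m: "y \<le> real m" using real_arch_simple by blast
      have Nm: "real N \<le> real m" using that m by simp
      have "integral {x..y} ?F \<le> integral {real N..real m} ?F"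
        using F1[of x y] F1[of "real N" "real m"] that m by (intro integral_subset_le) auto
      also have "\<dots> = integral {0..real m} ?F - integral {0..real N} ?F"
        using Henstock_Kurzweil_Integration.integral_combine[of 0 "real N" "real m" ?F] F1[of 0 "real m"] Nm by simp
      also have "\<dots> = (LBINT z:{0<..<real m}. ?F z) - (LBINT z:{0<..<real N}. ?F z)"
        using set_integrable_Icc(2)[OF F Ioo_subset_edge_interior, of 0] by simp
      also have "\<dots> < e / 2" 
        by (rule order_le_less_trans[OF abs_ge_self]) (use N[of m N] Nm in \<open>simp add: dist_real_def\<close>)
      finally show ?thesis .
    qed
    have "(f x)\<^sup>2 < e" if x: "x \<ge> real N" for x
    proof -
      have x0: "0 \<le> x" using x by (meson of_nat_0_le_iff order_trans)
      have "\<exists>y\<in>{x..x + 1}. (f y)\<^sup>2 < e / 2"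
      proof (rule ccontr)
        assume "\<not> ?thesis"
        then have "integral {x..x + 1} (\<lambda>_. e / 2) \<le> integral {x..x + 1} ?F"
          using F1[OF x0] by (intro integral_le) (auto simp: not_less intro: add_increasing2)
        then show False using small[OF x, of "x + 1"] by simp
      qed
      then obtain y where y: "y \<in> {x..x + 1}" "(f y)\<^sup>2 < e / 2" by blast
      then show ?thesis using sq[OF x0, of y] small[OF x, of y] by auto
    qed
    then show "eventually (\<lambda>x. dist ((f x)\<^sup>2) 0 < e) at_top"
      by (auto simp: eventually_at_top_linorder intro!: exI[of _ "real N"])
  qed
  then have "((\<lambda>x. sqrt ((f x)\<^sup>2)) \<longlongrightarrow> sqrt 0) at_top" by (rule tendsto_real_sqrt)
  then show ?thesis by (simp add: tendsto_rabs_zero_iff)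
qed

section \<open>Weighted integrals of crossing counts along one edge\<close>

lemma cross_has_integral:
  assumes pq: "p \<in> {0..1}" "q \<in> {0..1}" and \<gamma>: "continuous_on {0..1} \<gamma>" "\<And>s. s \<in> {0..1} \<Longrightarrow> 0 \<le> \<gamma> s"
  shows "((\<lambda>t. real (cross p q t) * \<gamma> t) has_integral \<bar>integral {0..q} \<gamma> - integral {0..p} \<gamma>\<bar>) {0..1}"
proof -
  have *: "((\<lambda>t. real (cross p q t) * \<gamma> t) has_integral (integral {0..q} \<gamma> - integral {0..p} \<gamma>)) {0..1}"
    "0 \<le> integral {0..q} \<gamma> - integral {0..p} \<gamma>" if pq: "0 \<le> p" "p \<le> q" "q \<le> 1" for p q
  proof -
    have int: "\<gamma> integrable_on {0..1}" using \<gamma>(1) by (rule integrable_continuous_real)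
    have int': "\<gamma> integrable_on {a..b}" if "0 \<le> a" "b \<le> 1" for a b
      by (rule integrable_on_subinterval[OF int]) (use that in auto)
    have eq: "integral {0..q} \<gamma> - integral {0..p} \<gamma> = integral {p..q} \<gamma>"
      using Henstock_Kurzweil_Integration.integral_combine[of 0 p q \<gamma>] int'[of 0 q] pq by simp
    have "(\<gamma> has_integral integral {p..q} \<gamma>) {p..q}" using int'[of p q] pq by (simp add: integrable_integral)
    then have "((\<lambda>t. if t \<in> {p..q} then \<gamma> t else 0) has_integral integral {p..q} \<gamma>) {0..1}"
      using pq by (subst has_integral_restrict) auto
    then show "((\<lambda>t. real (cross p q t) * \<gamma> t) has_integral (integral {0..q} \<gamma> - integral {0..p} \<gamma>)) {0..1}"
      unfolding eq
      \<comment> \<open>\<open>cross\<close> is the indicator of the half-open interval from p to q,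
        which differs from the closed one at p alone.\<close>
      by (rule has_integral_spike_finite[of "{p}", rotated 2]) (use pq in \<open>auto simp: cross_def\<close>)
    show "0 \<le> integral {0..q} \<gamma> - integral {0..p} \<gamma>"
      unfolding eq using int'[of p q] pq \<gamma>(2) by (intro Henstock_Kurzweil_Integration.integral_nonneg) auto
  qed
  have sym: "cross p q t = cross q p t" for t by (auto simp: cross_def)
  show ?thesis
  proof (cases "p \<le> q")
    case True then show ?thesis using *[of p q] pq by simp
  next
    case False
    then show ?thesis using *[of q p] pq by (simp add: sym abs_minus_commute)
  qed
qed

lemma chain_crossings_has_integral:
  assumes "a \<in> {0..1}" "p \<in> {0..1}" "q \<in> {0..1}" "b \<in> {0..1}"
    and \<gamma>: "continuous_on {0..1} \<gamma>" "\<And>s. s \<in> {0..1} \<Longrightarrow> 0 \<le> \<gamma> s"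
  shows "((\<lambda>t. real (chain_crossings a p q b t) * \<gamma> t) has_integral
    \<bar>integral {0..p} \<gamma> - integral {0..a} \<gamma>\<bar> + \<bar>integral {0..q} \<gamma> - integral {0..p} \<gamma>\<bar> +
    \<bar>integral {0..b} \<gamma> - integral {0..q} \<gamma>\<bar>) {0..1}"
  unfolding chain_crossings_def of_nat_add distrib_right
  by (intro has_integral_add cross_has_integral) (use assms in auto)

lemma H1_edge_attains_sup:
  assumes H: "H1_edge l f g" and l: "0 < l"
  shows "\<exists>x\<in>edge_points l. \<forall>y\<in>edge_points l. \<bar>f y\<bar> \<le> \<bar>f x\<bar>"
proof -
  have cont: "continuous_on (edge_points l) (\<lambda>x. \<bar>f x\<bar>)"
    using H by (auto simp: H1_edge_def intro!: continuous_intros)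
  show ?thesis
  proof (cases "l = \<infinity>")
    case False
    then obtain L where L: "l = ereal L" "0 < L" using l by (cases l) auto
    have pts: "edge_points l = {0..L}" by (auto simp: edge_points_def L)
    show ?thesis unfolding pts
      by (rule continuous_attains_sup) (use L cont pts in auto)
  next
    case inf: True
    have pts: "edge_points l = {0..}" by (auto simp: edge_points_def inf)
    have lim: "((\<lambda>x. \<bar>f x\<bar>) \<longlongrightarrow> 0) at_top"
      using H1_edge_tendsto_0 H inf by (auto intro: tendsto_rabs_zero)
    show ?thesis
    proof (cases "\<exists>z\<ge>0. f z \<noteq> 0")
      case True
      then obtain z where z: "0 \<le> z" "f z \<noteq> 0" by auto
      obtain N where N: "\<And>x. x \<ge> N \<Longrightarrow> \<bar>f x\<bar> < \<bar>f z\<bar>"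
        using order_tendstoD(2)[OF lim, of "\<bar>f z\<bar>"] z by (auto simp: eventually_at_top_linorder)
      define K where "K = max N z"
      have "continuous_on {0..K} (\<lambda>x. \<bar>f x\<bar>)" using cont unfolding pts by (rule continuous_on_subset) auto
      then obtain x1 where x1: "x1 \<in> {0..K}" "\<And>x. x \<in> {0..K} \<Longrightarrow> \<bar>f x\<bar> \<le> \<bar>f x1\<bar>"
        using continuous_attains_sup[OF compact_Icc, of 0 K "\<lambda>x. \<bar>f x\<bar>"] z by (fastforce simp: K_def)
      have "\<bar>f x\<bar> \<le> \<bar>f x1\<bar>" if "0 \<le> x" for x
      proof (cases "x \<le> K")
        case False
        then have "\<bar>f x\<bar> < \<bar>f z\<bar>" by (intro N) (auto simp: K_def)
        moreover have "\<bar>f z\<bar> \<le> \<bar>f x1\<bar>" using x1(2)[of z] z by (auto simp: K_def)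
        ultimately show ?thesis by simp
      qed (use x1 that in auto)
      then show ?thesis using x1(1) pts by auto
    next
      case False
      then show ?thesis using pts by (auto intro!: bexI[of _ 0])
    qed
  qed
qed

text \<open>The edge is cut at the points where the extreme values are taken, and each stretch
  contributes at least the increment of the primitive of \<gamma>. The values p and q are fixed
  before \<gamma>, since the weight is later varied through its parameter a.\<close>

lemma H1_edge_crossings:
  assumes H: "H1_edge l f g" and l: "0 < l" and le1: "\<And>x. x \<in> edge_points l \<Longrightarrow> \<bar>f x\<bar> \<le> 1"
  defines "b \<equiv> (if l = \<infinity> then 0 else \<bar>f (real_of_ereal l)\<bar>)"
  obtains p q where
    "0 \<le> p" "0 \<le> q" "\<And>x. x \<in> edge_points l \<Longrightarrow> \<bar>f x\<bar> \<in> {min p q..max p q}"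
    "\<exists>x\<in>edge_points l. \<bar>f x\<bar> = max p q" "l = \<infinity> \<Longrightarrow> q = 0" "b \<in> {min p q..max p q}"
    "\<And>\<gamma>. continuous_on {0..1} \<gamma> \<Longrightarrow> (\<And>s. s \<in> {0..1} \<Longrightarrow> 0 \<le> \<gamma> s) \<Longrightarrow>
       set_integrable lborel (edge_interior l) (\<lambda>x. \<gamma> \<bar>f x\<bar> * \<bar>g x\<bar>) \<Longrightarrow>
       integral {0..1} (\<lambda>t. real (chain_crossings \<bar>f 0\<bar> p q b t) * \<gamma> t) \<le>
         (LBINT x:edge_interior l. \<gamma> \<bar>f x\<bar> * \<bar>g x\<bar>)"
    "l \<noteq> \<infinity> \<Longrightarrow> \<bar>q - p\<bar> \<le> (LBINT x:edge_interior l. \<bar>g x\<bar>)"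
proof (cases "l = \<infinity>")
  case False
  then obtain L where L: "l = ereal L" "0 < L" using l by (cases l) auto
  have pts: "edge_points l = {0..L}" "edge_interior l = {0<..<L}"
    by (auto simp: edge_points_def edge_interior_def L)
  have b: "b = \<bar>f L\<bar>" by (simp add: b_def L)
  have cont: "continuous_on {0..L} (\<lambda>x. \<bar>f x\<bar>)"
    using H pts by (auto simp: H1_edge_def intro!: continuous_intros)
  obtain x1 where x1: "x1 \<in> {0..L}" "\<And>x. x \<in> {0..L} \<Longrightarrow> \<bar>f x\<bar> \<le> \<bar>f x1\<bar>"
    using H1_edge_attains_sup[OF H l] pts by auto
  obtain x2 where x2: "x2 \<in> {0..L}" "\<And>x. x \<in> {0..L} \<Longrightarrow> \<bar>f x2\<bar> \<le> \<bar>f x\<bar>"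
    using continuous_attains_inf[OF compact_Icc _ cont] L by fastforce
  \<comment> \<open>The maximum may come before or after the minimum; ordering the two points makes
    0, y1, y2, L a subdivision of the edge.\<close>
  define y1 y2 where "y1 = min x1 x2" and "y2 = max x1 x2"
  have y: "0 \<le> y1" "y1 \<le> y2" "y2 \<le> L" using x1 x2 by (auto simp: y1_def y2_def)
  define p q where "p = \<bar>f y1\<bar>" and "q = \<bar>f y2\<bar>"
  have mm: "max p q = \<bar>f x1\<bar>" "min p q = \<bar>f x2\<bar>"
    using x1(2)[OF x2(1)] unfolding p_def q_def y1_def y2_def by (auto simp: max_def min_def)
  show thesis
  proof (rule that[of p q])
    show "\<bar>f x\<bar> \<in> {min p q..max p q}" if "x \<in> edge_points l" for x
      using x1(2) x2(2) that by (auto simp: pts mm)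
    show "\<exists>x\<in>edge_points l. \<bar>f x\<bar> = max p q" using x1(1) pts mm by auto
    show "b \<in> {min p q..max p q}" using x1(2) x2(2) L by (auto simp: b mm)
    show "\<bar>q - p\<bar> \<le> (LBINT x:edge_interior l. \<bar>g x\<bar>)"
    proof -
      have g: "set_integrable lborel (edge_interior l) (\<lambda>x. \<bar>g x\<bar>)"
        using H by (intro set_integrable_abs L2_on_set_integrable[of _ g]) (auto simp: H1_edge_def pts)
      have "\<bar>q - p\<bar> \<le> integral {y1..y2} (\<lambda>z. \<bar>g z\<bar>)"
        unfolding p_def q_def by (rule H1_edge_increment(1)[OF H]) (use y L in auto)
      also have "\<dots> \<le> (LBINT x:edge_interior l. \<bar>g x\<bar>)"
        by (rule set_integral_Icc_le[OF g]) (use y pts in auto)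
      finally show ?thesis .
    qed
    fix \<gamma> :: "real \<Rightarrow> real"
    assume \<gamma>: "continuous_on {0..1} \<gamma>" "\<And>s. s \<in> {0..1} \<Longrightarrow> 0 \<le> \<gamma> s"
      and int: "set_integrable lborel (edge_interior l) (\<lambda>x. \<gamma> \<bar>f x\<bar> * \<bar>g x\<bar>)"
    let ?F = "\<lambda>z. \<gamma> \<bar>f z\<bar> * \<bar>g z\<bar>" and ?G = "\<lambda>s. integral {0..s} \<gamma>"
    have F: "?F integrable_on {x..y}" if "0 \<le> x" "y \<le> L" for x y
      using set_integrable_Icc(1)[OF int Ioo_subset_edge_interior[OF that(1)]] that L by simp
    have var: "\<bar>?G \<bar>f y\<bar> - ?G \<bar>f x\<bar>\<bar> \<le> integral {x..y} ?F" if "0 \<le> x" "x \<le> y" "y \<le> L" for x y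
      by (rule H1_edge_variation[OF H that(1,2) _ \<gamma> _ integral_has_real_derivative[OF \<gamma>(1)] _ int])
         (use that L le1 in auto)
    have "integral {0..1} (\<lambda>t. real (chain_crossings \<bar>f 0\<bar> p q b t) * \<gamma> t) =
        \<bar>?G p - ?G \<bar>f 0\<bar>\<bar> + \<bar>?G q - ?G p\<bar> + \<bar>?G b - ?G q\<bar>"
      using le1 y L(2) pts by (intro integral_unique chain_crossings_has_integral \<gamma>) (auto simp: b p_def q_def)
    also have "\<dots> \<le> integral {0..y1} ?F + integral {y1..y2} ?F + integral {y2..L} ?F"
      unfolding b p_def q_def by (intro add_mono var) (use y in auto)
    also have "\<dots> = integral {0..L} ?F"
      using y F by (simp add: Henstock_Kurzweil_Integration.integral_combine)
    also have "\<dots> = (LBINT x:edge_interior l. ?F x)"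
      using set_integrable_Icc(2)[OF int, of 0 L] pts by simp
    finally show "integral {0..1} (\<lambda>t. real (chain_crossings \<bar>f 0\<bar> p q b t) * \<gamma> t) \<le> \<dots>" .
  qed (use False in \<open>auto simp: p_def q_def\<close>)
next
  case True
  have pts: "edge_points l = {0..}" "edge_interior l = {0<..}"
    by (auto simp: edge_points_def edge_interior_def True)
  have b: "b = 0" by (simp add: b_def True)
  have lim: "((\<lambda>x. \<bar>f x\<bar>) \<longlongrightarrow> 0) at_top" using H1_edge_tendsto_0 H True by (auto intro: tendsto_rabs_zero)
  obtain x1 where x1: "0 \<le> x1" "\<And>x. 0 \<le> x \<Longrightarrow> \<bar>f x\<bar> \<le> \<bar>f x1\<bar>"
    using H1_edge_attains_sup[OF H l] pts by auto
  define p where "p = \<bar>f x1\<bar>"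
  show thesis
  proof (rule that[of p 0])
    show "\<bar>f x\<bar> \<in> {min p 0..max p 0}" if "x \<in> edge_points l" for x
      using x1(2) that by (auto simp: pts p_def)
    show "\<exists>x\<in>edge_points l. \<bar>f x\<bar> = max p 0" using x1(1) pts by (auto simp: p_def)
    fix \<gamma> :: "real \<Rightarrow> real"
    assume \<gamma>: "continuous_on {0..1} \<gamma>" "\<And>s. s \<in> {0..1} \<Longrightarrow> 0 \<le> \<gamma> s"
      and int: "set_integrable lborel (edge_interior l) (\<lambda>x. \<gamma> \<bar>f x\<bar> * \<bar>g x\<bar>)"
    let ?F = "\<lambda>z. \<gamma> \<bar>f z\<bar> * \<bar>g z\<bar>" and ?G = "\<lambda>s. integral {0..s} \<gamma>"
    have F: "?F integrable_on {x..y}" if "0 \<le> x" for x y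
      using set_integrable_Icc(1)[OF int Ioo_subset_edge_interior[OF that(1)]] True by simp
    have var: "\<bar>?G \<bar>f y\<bar> - ?G \<bar>f x\<bar>\<bar> \<le> integral {x..y} ?F" if "0 \<le> x" "x \<le> y" for x y
      by (rule H1_edge_variation[OF H that(1,2) _ \<gamma> _ integral_has_real_derivative[OF \<gamma>(1)] _ int])
         (use that True le1 in auto)
    have lim_le: "\<bar>?G p - ?G \<bar>f 0\<bar>\<bar> + \<bar>?G \<bar>f y\<bar> - ?G p\<bar> \<le> (LBINT x:edge_interior l. ?F x)" if "y \<ge> x1" for y
    proof -
      have "\<bar>?G p - ?G \<bar>f 0\<bar>\<bar> + \<bar>?G \<bar>f y\<bar> - ?G p\<bar> \<le> integral {0..x1} ?F + integral {x1..y} ?F"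
        unfolding p_def by (intro add_mono var) (use x1 that in auto)
      also have "\<dots> = integral {0..y} ?F"
        using x1(1) that F by (simp add: Henstock_Kurzweil_Integration.integral_combine)
      also have "\<dots> \<le> (LBINT x:edge_interior l. ?F x)"
        by (rule set_integral_Icc_le[OF int]) (use pts le1 \<gamma>(2) in auto)
      finally show ?thesis .
    qed
    have "continuous_on {0..1} ?G"
      by (rule indefinite_integral_continuous_1[OF integrable_continuous_real[OF \<gamma>(1)]])
    \<comment> \<open>The stretch from the maximum to infinity is exhausted by bounded ones. Its far
      value is the limit 0, which serves both as q and as the value b at the end, so the third leg
      of the chain is trivial.\<close>
    then have "((\<lambda>y. ?G \<bar>f y\<bar>) \<longlongrightarrow> ?G 0) at_top"
      by (rule continuous_on_tendsto_compose[OF _ lim])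
         (use le1 pts in \<open>auto simp: eventually_at_top_linorder intro!: exI[of _ 0]\<close>)
    then have "((\<lambda>y. \<bar>?G p - ?G \<bar>f 0\<bar>\<bar> + \<bar>?G \<bar>f y\<bar> - ?G p\<bar>) \<longlongrightarrow>
        \<bar>?G p - ?G \<bar>f 0\<bar>\<bar> + \<bar>?G 0 - ?G p\<bar>) at_top" by (intro tendsto_intros)
    then have "\<bar>?G p - ?G \<bar>f 0\<bar>\<bar> + \<bar>?G 0 - ?G p\<bar> \<le> (LBINT x:edge_interior l. ?F x)"
      by (rule tendsto_upperbound) (use lim_le in \<open>auto simp: eventually_at_top_linorder\<close>)
    moreover have "integral {0..1} (\<lambda>t. real (chain_crossings \<bar>f 0\<bar> p 0 b t) * \<gamma> t) =
        \<bar>?G p - ?G \<bar>f 0\<bar>\<bar> + \<bar>?G 0 - ?G p\<bar> + \<bar>?G b - ?G 0\<bar>"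
      using le1 x1 pts by (intro integral_unique chain_crossings_has_integral \<gamma>) (auto simp: b p_def)
    ultimately show "integral {0..1} (\<lambda>t. real (chain_crossings \<bar>f 0\<bar> p 0 b t) * \<gamma> t)
        \<le> (LBINT x:edge_interior l. ?F x)" by (simp add: b)
  qed (use True in \<open>auto simp: p_def b\<close>)
qed

section \<open>The weight of the soliton\<close>

lemma sqrt_power4: "sqrt (a ^ 4) = a\<^sup>2" for a :: real
proof -
  have "a ^ 4 = (a\<^sup>2)\<^sup>2" by (simp flip: power_mult)
  then show ?thesis by (simp only: real_sqrt_abs abs_power2)
qed

text \<open>Up to the factor \<beta> / sqrt 3, the slope of a soliton at height s when its maximum
  is a, written as a function of the height through the first-order equation it satisfies.\<close>

definition soliton_weight :: "real \<Rightarrow> real \<Rightarrow> real" where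
  "soliton_weight a s = s * sqrt (a ^ 4 - s ^ 4)"

lemma continuous_soliton_weight: "continuous_on A (soliton_weight a)"
  unfolding soliton_weight_def[abs_def] by (intro continuous_intros)

lemma soliton_weight_nonneg: "0 \<le> s \<Longrightarrow> s \<le> a \<Longrightarrow> 0 \<le> soliton_weight a s"
  by (simp add: soliton_weight_def power_mono)

lemma soliton_weight_le:
  assumes "0 \<le> s" shows "soliton_weight a s \<le> a\<^sup>2 * s"
proof -
  have "sqrt (a ^ 4 - s ^ 4) \<le> sqrt (a ^ 4)" by (intro real_sqrt_le_mono) simp
  then have "sqrt (a ^ 4 - s ^ 4) \<le> a\<^sup>2" by (simp only: sqrt_power4)
  from mult_left_mono[OF this assms] show ?thesis by (simp add: soliton_weight_def mult.commute)
qed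

lemma soliton_weight_integrable: "soliton_weight a integrable_on {x..y}"
  by (rule integrable_continuous_real[OF continuous_soliton_weight])

lemma integral_soliton_weight:
  assumes a: "0 < a"
  shows "integral {0..a} (soliton_weight a) = a ^ 4 * pi / 8"
proof -
  \<comment> \<open>The substitution v = s^2 turns the integrand into half the circular profile
    sqrt(a^4 - v^2), whence the arcsine. \<open>F\<close> fails the derivative rules at s = a, so
    only interior derivatives are used.\<close>
  define F where "F s = (s\<^sup>2 * sqrt (a ^ 4 - s ^ 4) + a ^ 4 * arcsin (s\<^sup>2 / a\<^sup>2)) / 4" for s
  have "(soliton_weight a has_integral F a - F 0) {0..a}"
  proof (rule fundamental_theorem_of_calculus_interior)
    show "continuous_on {0..a} F"
      unfolding F_def
    proof (intro continuous_intros)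
      show "\<forall>x\<in>{0..a}. - 1 \<le> x\<^sup>2 / a\<^sup>2 \<and> x\<^sup>2 / a\<^sup>2 \<le> 1"
        using a by (auto simp: field_simps power_mono intro: order_trans[of "-_" 0])
    qed (use a in auto)
    fix s assume s: "s \<in> {0<..<a}"
    define S where "S = sqrt (a ^ 4 - s ^ 4)"
    have pos: "s ^ 4 < a ^ 4" using s by (intro power_strict_mono) auto
    then have S: "S > 0" "S\<^sup>2 = a ^ 4 - s ^ 4" by (auto simp: S_def)
    have sq: "s\<^sup>2 / a\<^sup>2 < 1" "-1 < s\<^sup>2 / a\<^sup>2"
      using s a by (auto simp: power_strict_mono intro: less_le_trans[of "-1" 0])
    have rt: "sqrt (1 - (s\<^sup>2 / a\<^sup>2)\<^sup>2) = S / a\<^sup>2"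
    proof -
      have "1 - (s\<^sup>2 / a\<^sup>2)\<^sup>2 = (a ^ 4 - s ^ 4) / (a\<^sup>2)\<^sup>2"
        using a by (simp add: field_simps flip: power_mult)
      then show ?thesis using a by (simp add: S_def real_sqrt_divide sqrt_power4)
    qed
    have "((\<lambda>s. s\<^sup>2 * sqrt (a ^ 4 - s ^ 4)) has_real_derivative
        2 * s * S + s\<^sup>2 * (- 4 * s ^ 3 * (inverse S / 2))) (at s)"
      using pos unfolding S_def by (auto intro!: derivative_eq_intros)
    moreover have "((\<lambda>s. arcsin (s\<^sup>2 / a\<^sup>2)) has_real_derivative
        inverse (S / a\<^sup>2) * (2 * s / a\<^sup>2)) (at s)"
      unfolding rt[symmetric]
      by (rule DERIV_chain2[OF DERIV_arcsin])
         (use sq a in \<open>auto intro!: derivative_eq_intros simp: power2_eq_square power4_eq_xxxx\<close>)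
    ultimately have "(F has_real_derivative
        (2 * s * S + s\<^sup>2 * (- 4 * s ^ 3 * (inverse S / 2)) + a ^ 4 * (inverse (S / a\<^sup>2) * (2 * s / a\<^sup>2))) / 4) (at s)"
      unfolding F_def by (intro DERIV_cdivide DERIV_add DERIV_cmult)
    also have "(2 * s * S + s\<^sup>2 * (- 4 * s ^ 3 * (inverse S / 2)) + a ^ 4 * (inverse (S / a\<^sup>2) * (2 * s / a\<^sup>2))) / 4
        = (2 * s * S\<^sup>2 + 2 * s * (a ^ 4 - s ^ 4)) / (4 * S)"
      using S(1) a by (simp add: field_simps power2_eq_square power4_eq_xxxx power3_eq_cube)
    also have "\<dots> = soliton_weight a s"
      using S(1) by (simp add: S(2)[symmetric] soliton_weight_def S_def[symmetric] power2_eq_square)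
    finally show "(F has_vector_derivative soliton_weight a s) (at s)"
      by (simp add: has_real_derivative_iff_has_vector_derivative)
  qed (use a in auto)
  moreover have "F a - F 0 = a ^ 4 * pi / 8" using a by (simp add: F_def)
  ultimately show ?thesis by (simp add: integral_unique)
qed

text \<open>Bounds what is lost when the levels between t and a are given up. With t near 1 and a
  near 1 the loss is a product of two small factors.\<close>

lemma integral_soliton_weight_ge:
  assumes a: "0 \<le> t" "t \<le> a" "0 < a"
  shows "a ^ 4 * pi / 8 - (a - t) * (a * sqrt (a ^ 4 - t ^ 4)) \<le> integral {0..t} (soliton_weight a)"
proof -
  have "integral {t..a} (soliton_weight a) \<le> integral {t..a} (\<lambda>_. a * sqrt (a ^ 4 - t ^ 4))"
  proof (rule integral_le[OF soliton_weight_integrable])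
    fix s assume "s \<in> {t..a}"
    then have "sqrt (a ^ 4 - s ^ 4) \<le> sqrt (a ^ 4 - t ^ 4)" "0 \<le> sqrt (a ^ 4 - s ^ 4)"
      using a by (auto simp: power_mono)
    then show "soliton_weight a s \<le> a * sqrt (a ^ 4 - t ^ 4)"
      unfolding soliton_weight_def using \<open>s \<in> _\<close> a by (intro mult_mono) auto
  qed auto
  moreover have "integral {0..t} (soliton_weight a) + integral {t..a} (soliton_weight a) = a ^ 4 * pi / 8"
    using Henstock_Kurzweil_Integration.integral_combine[OF a(1,2) soliton_weight_integrable]
      integral_soliton_weight[OF a(3)] by simp
  moreover have "integral {t..a} (\<lambda>_. a * sqrt (a ^ 4 - t ^ 4)) = (a - t) * (a * sqrt (a ^ 4 - t ^ 4))"
    using a by simp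
  ultimately show ?thesis by linarith
qed

lemma integral_soliton_weight_1_pos:
  assumes "0 < \<delta>" "\<delta> \<le> 1"
  shows "0 < integral {1 - \<delta>..1} (soliton_weight 1)"
proof (cases "\<delta> = 1")
  case True
  then have "integral {1 - \<delta>..1} (soliton_weight 1) = pi / 8" using integral_soliton_weight[of 1] by simp
  then show ?thesis using pi_gt_zero by linarith
next
  case False
  \<comment> \<open>An elementary minorant: s^4 \<le> s, and sqrt y \<ge> y on [0,1]. It vanishes
    identically for \<delta> = 1, which is why that case is separate.\<close>
  have "integral {1 - \<delta>..1} (\<lambda>s. (1 - \<delta>) * (1 - s)) \<le> integral {1 - \<delta>..1} (soliton_weight 1)"
  proof (rule integral_le)
    fix s assume s: "s \<in> {1 - \<delta>..1}"
    have "s ^ 4 \<le> s ^ 1" using s assms by (intro power_decreasing) auto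
    moreover have "1 - s ^ 4 \<le> sqrt (1 - s ^ 4)"
      using s assms by (intro real_le_rsqrt) (auto simp: power2_eq_square power_le_one mult_left_le)
    ultimately show "(1 - \<delta>) * (1 - s) \<le> soliton_weight 1 s"
      unfolding soliton_weight_def using s assms by (intro mult_mono) auto
  qed (auto intro!: integrable_continuous_real continuous_intros soliton_weight_integrable)
  moreover have "((\<lambda>s. (1 - \<delta>) * (1 - s)) has_integral
      - (1 - \<delta>) * (1 - 1)\<^sup>2 / 2 - (- (1 - \<delta>) * (1 - (1 - \<delta>))\<^sup>2 / 2)) {1 - \<delta>..1}"
    by (rule fundamental_theorem_of_calculus)
       (use assms in \<open>auto intro!: derivative_eq_intros simp: field_simps simp flip: has_real_derivative_iff_has_vector_derivative\<close>)
  then have "integral {1 - \<delta>..1} (\<lambda>s. (1 - \<delta>) * (1 - s)) =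
      - (1 - \<delta>) * (1 - 1)\<^sup>2 / 2 - (- (1 - \<delta>) * (1 - (1 - \<delta>))\<^sup>2 / 2)"
    by (rule integral_unique)
  moreover have "\<dots> = (1 - \<delta>) * \<delta>\<^sup>2 / 2" by (simp add: field_simps)
  moreover have "0 < (1 - \<delta>) * \<delta>\<^sup>2 / 2" using False assms by simp
  ultimately show ?thesis by linarith
qed

text \<open>The choice of a for the plateau case: the loss from the levels above t, plus a reserve
  \<epsilon>, is paid by the plateau term with coefficient K. It suffices to win strictly at t = 1;
  continuity in t then provides \<delta>.\<close>

lemma soliton_parameters:
  fixes K :: real
  assumes K: "0 < K"
  obtains a \<delta> \<epsilon> where "1 < a" "0 < \<delta>" "\<delta> < 1" "0 < \<epsilon>"
    "\<And>t. 1 - \<delta> \<le> t \<Longrightarrow> t \<le> 1 \<Longrightarrow>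
      2 * sqrt 3 * ((a - t) * (a * sqrt (a ^ 4 - t ^ 4))) + a ^ 4 * \<epsilon> \<le> K * (a ^ 4 - 1) * t\<^sup>2"
proof -
  \<comment> \<open>At t = 1 one needs 2 sqrt 3 h a < K sqrt(a^4 - 1) with a = 1 + h. The right side
    is at least K sqrt h, which is at least 8 h; the cap 1 gives a \<le> 2.\<close>
  define h where "h = min 1 ((K / 8)\<^sup>2)"
  define a where "a = 1 + h"
  have h: "0 < h" "h \<le> 1" "sqrt h \<le> K / 8" 
  proof -
    have "sqrt h \<le> sqrt ((K / 8)\<^sup>2)" unfolding h_def by (intro real_sqrt_le_mono) simp
    then show "sqrt h \<le> K / 8" using K by simp
  qed (use K in \<open>auto simp: h_def\<close>)
  have a: "1 < a" "a \<le> 2" using h by (auto simp: a_def)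
  have ah: "h \<le> a ^ 4 - 1"
    using power_increasing[of 1 4 a] a by (simp add: a_def)
  define F where "F t = 2 * sqrt 3 * ((a - t) * (a * sqrt (a ^ 4 - t ^ 4))) - K * (a ^ 4 - 1) * t\<^sup>2" for t
  have "F 1 < 0"
  proof -
    have "2 * sqrt 3 * (h * a) \<le> 7 * h"
    proof -
      \<comment> \<open>The left side is then at most 2 times 7/4 times 2 times h, that is 7 h,
        strictly below the 8 h available.\<close>
      have "sqrt 3 \<le> 7 / 4" by (rule real_le_lsqrt) (auto simp: power2_eq_square)
      then have "2 * sqrt 3 * a \<le> 2 * (7/4) * 2" using a by (intro mult_mono) auto
      from mult_right_mono[OF this, of h] show ?thesis using h by (simp add: mult_ac)
    qed
    also have "7 * h < 8 * (sqrt h * sqrt h)" using h by simp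
    also have "\<dots> \<le> K * sqrt h" using h mult_right_mono[OF h(3), of "sqrt h"] by (simp add: mult_ac)
    also have "\<dots> \<le> K * sqrt (a ^ 4 - 1)" using K ah by simp
    finally have "2 * sqrt 3 * (h * a) * sqrt (a ^ 4 - 1) < K * sqrt (a ^ 4 - 1) * sqrt (a ^ 4 - 1)"
      using ah h by (intro mult_strict_right_mono) auto
    also have "\<dots> = K * (a ^ 4 - 1)" using ah h by (simp add: mult.assoc)
    finally show ?thesis by (simp add: F_def mult_ac) (simp add: a_def mult_ac)
  qed
  have "isCont F 1" unfolding F_def by (intro continuous_intros)
  then obtain d where d: "d > 0" "\<And>t. dist t 1 < d \<Longrightarrow> dist (F t) (F 1) < - F 1 / 2"
    unfolding continuous_at_eps_delta using \<open>F 1 < 0\<close> by (metis divide_pos_pos neg_0_less_iff_less zero_less_numeral)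
  show thesis
  proof (rule that[of a "min (d / 2) (1 / 2)" "- F 1 / (2 * a ^ 4)"])
    show "0 < - F 1 / (2 * a ^ 4)" using \<open>F 1 < 0\<close> a by (intro divide_pos_pos) auto
    fix t assume t: "1 - min (d / 2) (1 / 2) \<le> t" "t \<le> 1"
    then have "dist t 1 < d" using d(1) by (auto simp: dist_real_def)
    then have "F t < F 1 / 2" using d(2)[of t] by (simp add: dist_real_def abs_diff_less_iff)
    then show "2 * sqrt 3 * ((a - t) * (a * sqrt (a ^ 4 - t ^ 4))) + a ^ 4 * (- F 1 / (2 * a ^ 4)) \<le> K * (a ^ 4 - 1) * t\<^sup>2"
    proof -
      have "a ^ 4 * (- F 1 / (2 * a ^ 4)) = - F 1 / 2" using a by simp
      moreover have "F t = 2 * sqrt 3 * ((a - t) * (a * sqrt (a ^ 4 - t ^ 4))) - K * (a ^ 4 - 1) * t\<^sup>2"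
        by (simp add: F_def)
      ultimately show ?thesis using \<open>F t < F 1 / 2\<close> \<open>F 1 < 0\<close> by linarith
    qed
  qed (use a d in auto)
qed

section \<open>Completing the square on one edge\<close>

lemma H1_edge_power6_integrable:
  assumes H: "H1_edge l f g" and le1: "\<And>x. x \<in> edge_points l \<Longrightarrow> \<bar>f x\<bar> \<le> 1"
  shows "set_integrable lborel (edge_interior l) (\<lambda>x. \<bar>f x\<bar> ^ 6)"
proof (rule set_integrable_bound[OF H1_edge_mult_integrable(2)[OF H]])
  have "(\<lambda>x. (indicator (edge_interior l) x * f x) ^ 6) \<in> borel_measurable lborel"
    using H unfolding H1_edge_def L2_on_def set_borel_measurable_def by (intro borel_measurable_power) auto
  then show "set_borel_measurable lborel (edge_interior l) (\<lambda>x. \<bar>f x\<bar> ^ 6)"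
    unfolding set_borel_measurable_def
    by (rule measurable_cong[THEN iffD1, rotated]) (auto simp: indicator_def)
  have "norm (\<bar>f x\<bar> ^ 6) \<le> norm ((f x)\<^sup>2)" if "x \<in> edge_interior l" for x
  proof -
    have "\<bar>f x\<bar> ^ 6 \<le> \<bar>f x\<bar> ^ 2"
      using le1[of x] that edge_interior_subset by (intro power_decreasing) auto
    then show ?thesis by simp
  qed
  then show "AE x in lborel. x \<in> edge_interior l \<longrightarrow> norm (\<bar>f x\<bar> ^ 6) \<le> norm ((f x)\<^sup>2)" by auto
qed

lemma H1_edge_soliton_weight_integrable:
  assumes H: "H1_edge l f g" and le1: "\<And>x. x \<in> edge_points l \<Longrightarrow> \<bar>f x\<bar> \<le> 1" and a: "1 \<le> a"
  shows "set_integrable lborel (edge_interior l) (\<lambda>x. soliton_weight a \<bar>f x\<bar> * \<bar>g x\<bar>)"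
proof -
  have *: "set_integrable lborel (edge_interior l) (\<lambda>x. a\<^sup>2 * (\<bar>f x\<bar> * \<bar>g x\<bar>))"
    using set_integrable_mult_right[OF H1_edge_mult_integrable(1)[OF H]] by blast
  show ?thesis
  proof (rule set_integrable_bound[OF *])
    let ?I = "edge_interior l"
    have f: "(\<lambda>x. indicator ?I x * f x) \<in> borel_measurable borel"
      and g: "(\<lambda>x. indicator ?I x * g x) \<in> borel_measurable borel"
      using H by (auto simp: H1_edge_def L2_on_def set_borel_measurable_def)
    have "(\<lambda>x. soliton_weight a \<bar>indicator ?I x * f x\<bar>) \<in> borel_measurable borel"
      by (rule borel_measurable_continuous_on[OF continuous_soliton_weight borel_measurable_abs[OF f]])
    from borel_measurable_times[OF this borel_measurable_abs[OF g]]
    show "set_borel_measurable lborel ?I (\<lambda>x. soliton_weight a \<bar>f x\<bar> * \<bar>g x\<bar>)"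
      unfolding set_borel_measurable_def measurable_lborel2
      by (rule measurable_cong[THEN iffD1, rotated]) (auto simp: indicator_def)
    have "norm (soliton_weight a \<bar>f x\<bar> * \<bar>g x\<bar>) \<le> norm (a\<^sup>2 * (\<bar>f x\<bar> * \<bar>g x\<bar>))"
      if "x \<in> ?I" for x
    proof -
      have "\<bar>f x\<bar> \<le> a" using le1[of x] a that edge_interior_subset by force
      then have "0 \<le> soliton_weight a \<bar>f x\<bar>" by (intro soliton_weight_nonneg) auto
      moreover have "soliton_weight a \<bar>f x\<bar> * \<bar>g x\<bar> \<le> a\<^sup>2 * \<bar>f x\<bar> * \<bar>g x\<bar>"
        by (intro mult_right_mono soliton_weight_le) auto
      ultimately show ?thesis by (simp add: abs_mult mult.assoc)
    qed
    then show "AE x in lborel. x \<in> ?I \<longrightarrow> norm (soliton_weight a \<bar>f x\<bar> * \<bar>g x\<bar>) \<le> norm (a\<^sup>2 * (\<bar>f x\<bar> * \<bar>g x\<bar>))"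
      by auto
  qed
qed

lemma edge_soliton_inequality:
  assumes H: "H1_edge l f g" and le1: "\<And>x. x \<in> edge_points l \<Longrightarrow> \<bar>f x\<bar> \<le> 1" and a: "1 \<le> a"
  shows "2 * \<beta> / sqrt 3 * (LBINT x:edge_interior l. soliton_weight a \<bar>f x\<bar> * \<bar>g x\<bar>) \<le>
    (LBINT x:edge_interior l. (g x)\<^sup>2) +
    \<beta>\<^sup>2 / 3 * (a ^ 4 * (LBINT x:edge_interior l. (f x)\<^sup>2) - (LBINT x:edge_interior l. \<bar>f x\<bar> ^ 6))"
proof -
  let ?I = "edge_interior l"
  note int = H1_edge_mult_integrable[OF H] H1_edge_power6_integrable[OF H le1] H1_edge_soliton_weight_integrable[OF H le1 a]
  have pw: "2 * \<beta> / sqrt 3 * (soliton_weight a \<bar>f x\<bar> * \<bar>g x\<bar>) \<le>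
      (g x)\<^sup>2 + \<beta>\<^sup>2 / 3 * (a ^ 4 * (f x)\<^sup>2 - \<bar>f x\<bar> ^ 6)" if x: "x \<in> ?I" for x
  proof -
    define S where "S = sqrt (a ^ 4 - \<bar>f x\<bar> ^ 4)"
    have "\<bar>f x\<bar> ^ 4 \<le> a ^ 4" using le1[of x] x edge_interior_subset a by (intro power_mono) force+
    then have S: "S\<^sup>2 = a ^ 4 - \<bar>f x\<bar> ^ 4" by (simp add: S_def)
    have "0 \<le> (\<bar>g x\<bar> - \<beta> / sqrt 3 * (\<bar>f x\<bar> * S))\<^sup>2" by simp
    also have "\<dots> = (g x)\<^sup>2 + \<beta>\<^sup>2 / 3 * (\<bar>f x\<bar>\<^sup>2 * S\<^sup>2) - 2 * \<beta> / sqrt 3 * ((\<bar>f x\<bar> * S) * \<bar>g x\<bar>)"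
      by (simp add: power2_diff power_mult_distrib power_divide)
    also have "\<bar>f x\<bar>\<^sup>2 * S\<^sup>2 = a ^ 4 * (f x)\<^sup>2 - \<bar>f x\<bar> ^ 6"
      unfolding S by (simp add: algebra_simps power2_eq_square power4_eq_xxxx numeral_eq_Suc)
    finally show ?thesis by (simp add: soliton_weight_def S_def)
  qed
  have i1: "set_integrable lborel ?I (\<lambda>x. 2 * \<beta> / sqrt 3 * (soliton_weight a \<bar>f x\<bar> * \<bar>g x\<bar>))"
    using set_integrable_mult_right[OF int(5)] by blast
  have i2: "set_integrable lborel ?I (\<lambda>x. a ^ 4 * (f x)\<^sup>2)"
    using set_integrable_mult_right[OF int(2)] by blast
  have i3: "set_integrable lborel ?I (\<lambda>x. \<beta>\<^sup>2 / 3 * (a ^ 4 * (f x)\<^sup>2 - \<bar>f x\<bar> ^ 6))"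
    using set_integrable_mult_right[OF set_integral_diff(1)[OF i2 int(4)]] by blast
  have "(LBINT x:?I. 2 * \<beta> / sqrt 3 * (soliton_weight a \<bar>f x\<bar> * \<bar>g x\<bar>)) \<le>
      (LBINT x:?I. (g x)\<^sup>2 + \<beta>\<^sup>2 / 3 * (a ^ 4 * (f x)\<^sup>2 - \<bar>f x\<bar> ^ 6))"
    by (rule set_integral_mono[OF i1 set_integral_add(1)[OF int(3) i3] pw])
  then show ?thesis
    by (simp only: set_integral_add(2)[OF int(3) i3] set_integral_mult_right
        set_integral_diff(2)[OF i2 int(4)])
qed

text \<open>The surplus that appears only for a > 1: since \<bar>f\<bar> \<le> 1,
  \<open>a^4 f^2 - f^6\<close> is at least \<open>(a^4 - 1) f^2\<close>, hence at least
  \<open>(a^4 - 1) t^2\<close> along the whole edge.\<close>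

lemma edge_plateau_inequality:
  assumes H: "H1_edge (ereal L) f g" and L: "0 < L" and a: "1 \<le> a" "0 \<le> t"
    and f: "\<And>x. x \<in> edge_points (ereal L) \<Longrightarrow> t \<le> \<bar>f x\<bar> \<and> \<bar>f x\<bar> \<le> 1"
  shows "(a ^ 4 - 1) * t\<^sup>2 * L \<le>
    a ^ 4 * (LBINT x:edge_interior (ereal L). (f x)\<^sup>2) - (LBINT x:edge_interior (ereal L). \<bar>f x\<bar> ^ 6)"
proof -
  let ?I = "edge_interior (ereal L)"
  have I: "?I = {0<..<L}" by (auto simp: edge_interior_def)
  note int = H1_edge_mult_integrable[OF H] H1_edge_power6_integrable[OF H]
  have i6: "set_integrable lborel ?I (\<lambda>x. \<bar>f x\<bar> ^ 6)" by (rule int(4)) (use f in auto)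
  have i2: "set_integrable lborel ?I (\<lambda>x. a ^ 4 * (f x)\<^sup>2)"
    using set_integrable_mult_right[OF int(2)] by blast
  have ic: "set_integrable lborel ?I (\<lambda>_. (a ^ 4 - 1) * t\<^sup>2)"
    using L2_on_set_integrable[OF L2_on_const[of ?I]] by (auto simp: I)
  have "(LBINT x:?I. (a ^ 4 - 1) * t\<^sup>2) \<le> (LBINT x:?I. a ^ 4 * (f x)\<^sup>2 - \<bar>f x\<bar> ^ 6)"
  proof (rule set_integral_mono[OF ic set_integral_diff(1)[OF i2 i6]])
    fix x assume "x \<in> ?I"
    then have fx: "t \<le> \<bar>f x\<bar>" "\<bar>f x\<bar> \<le> 1" using f[of x] edge_interior_subset by auto
    have a4: "1 \<le> a ^ 4" using a by simp
    have "\<bar>f x\<bar> ^ 6 \<le> \<bar>f x\<bar> ^ 2" using fx by (intro power_decreasing) auto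
    moreover have "t\<^sup>2 \<le> \<bar>f x\<bar>\<^sup>2" using fx a by (intro power_mono) auto
    then have "(a ^ 4 - 1) * t\<^sup>2 \<le> (a ^ 4 - 1) * (f x)\<^sup>2" using a4 by (intro mult_left_mono) auto
    ultimately show "(a ^ 4 - 1) * t\<^sup>2 \<le> a ^ 4 * (f x)\<^sup>2 - \<bar>f x\<bar> ^ 6" by (simp add: algebra_simps)
  qed
  also have "(LBINT x:?I. (a ^ 4 - 1) * t\<^sup>2) = (a ^ 4 - 1) * t\<^sup>2 * L"
    using L by (simp add: I set_lebesgue_integral_def)
  also have "(LBINT x:?I. a ^ 4 * (f x)\<^sup>2 - \<bar>f x\<bar> ^ 6) =
      a ^ 4 * (LBINT x:?I. (f x)\<^sup>2) - (LBINT x:?I. \<bar>f x\<bar> ^ 6)"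
    using set_integral_diff(2)[OF i2 i6] by simp
  finally show ?thesis .
qed

section \<open>The inequality for normalised functions\<close>

text \<open>The explicit critical mass of the half-line. In the estimates it arises as 2 sqrt 3
  times pi / 8, the total integral of the weight with a = 1.\<close>

definition half_line_mass :: real where
  "half_line_mass = pi * sqrt 3 / 4"

text \<open>Collects all that is used of a function with maximum 1 and its derivative: integrated
  Sobolev bounds, the four values per edge, and the comparison of crossings with integrals for every
  admissible weight. The gain can then be proved for all profiles on the graph at once.\<close>

locale normalized_profile = level_profile G len w p q
  for G :: "('v, 'e) pre_digraph" and len :: "'e \<Rightarrow> ereal"
    and w :: "'v \<Rightarrow> real" and p q :: "'e \<Rightarrow> real" +
  fixes f g :: "'e \<Rightarrow> real \<Rightarrow> real"
  assumes H1_edge: "\<And>e. e \<in> arcs G \<Longrightarrow> H1_edge (len e) (f e) (g e)"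
    and le1: "\<And>e x. e \<in> arcs G \<Longrightarrow> x \<in> edge_points (len e) \<Longrightarrow> \<bar>f e x\<bar> \<le> 1"
    and min_le: "\<And>e x. e \<in> arcs G \<Longrightarrow> x \<in> edge_points (len e) \<Longrightarrow> min (p e) (q e) \<le> \<bar>f e x\<bar>"
    and pq: "\<And>e. e \<in> arcs G \<Longrightarrow> p e \<in> {0..1} \<and> q e \<in> {0..1}"
    and crossings_le: "\<And>e \<gamma>. e \<in> arcs G \<Longrightarrow> continuous_on {0..1} \<gamma> \<Longrightarrow>
       (\<And>s. s \<in> {0..1} \<Longrightarrow> 0 \<le> \<gamma> s) \<Longrightarrow>
       set_integrable lborel (edge_interior (len e)) (\<lambda>x. \<gamma> \<bar>f e x\<bar> * \<bar>g e x\<bar>) \<Longrightarrow>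
       integral {0..1} (\<lambda>t. real (crossings e t) * \<gamma> t) \<le>
         (LBINT x:edge_interior (len e). \<gamma> \<bar>f e x\<bar> * \<bar>g e x\<bar>)"
    and variation: "\<And>e. e \<in> arcs G - half_lines G len \<Longrightarrow>
       \<bar>q e - p e\<bar> \<le> (LBINT x:edge_interior (len e). \<bar>g e x\<bar>)"
begin

abbreviation "mass \<equiv> Lp_norm_pow G len 2 f"
abbreviation "energy \<equiv> Lp_norm_pow G len 2 g"
abbreviation "power6 \<equiv> Lp_norm_pow G len 6 f"

lemma w_in_01: "e \<in> arcs G \<Longrightarrow> w (tail G e) \<in> {0..1} \<and> w (head G e) \<in> {0..1}"
  using tail_between[of e] head_between[of e] pq[of e] by auto

lemma crossings_integrable:
  assumes "e \<in> arcs G" "1 \<le> a"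
  shows "(\<lambda>t. real (crossings e t) * soliton_weight a t) integrable_on {0..1}"
proof -
  have \<gamma>: "\<And>s. s \<in> {0..1} \<Longrightarrow> 0 \<le> soliton_weight a s" using assms by (auto intro: soliton_weight_nonneg)
  show ?thesis
    unfolding crossings_def
    by (rule has_integral_integrable[OF chain_crossings_has_integral[OF _ _ _ _ continuous_soliton_weight \<gamma>]])
       (use w_in_01[OF assms(1)] pq[OF assms(1)] in auto)
qed

lemma edges_soliton_inequality:
  assumes E: "E \<subseteq> arcs G" and a: "1 \<le> a" and \<beta>: "0 \<le> \<beta>"
  shows "2 * \<beta> / sqrt 3 * integral {0..1} (\<lambda>t. real (\<Sum>e\<in>E. crossings e t) * soliton_weight a t) \<le>
    (\<Sum>e\<in>E. (LBINT x:edge_interior (len e). \<bar>g e x\<bar> ^ 2) +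
      \<beta>\<^sup>2 / 3 * (a ^ 4 * (LBINT x:edge_interior (len e). \<bar>f e x\<bar> ^ 2) -
        (LBINT x:edge_interior (len e). \<bar>f e x\<bar> ^ 6)))"
proof -
  have fin: "finite E" using E finite_arcs finite_subset by blast
  have "integral {0..1} (\<lambda>t. real (\<Sum>e\<in>E. crossings e t) * soliton_weight a t) =
      (\<Sum>e\<in>E. integral {0..1} (\<lambda>t. real (crossings e t) * soliton_weight a t))"
    unfolding of_nat_sum sum_distrib_right
    by (rule Henstock_Kurzweil_Integration.integral_sum[OF fin]) (use E a crossings_integrable in auto)
  then have "2 * \<beta> / sqrt 3 * integral {0..1} (\<lambda>t. real (\<Sum>e\<in>E. crossings e t) * soliton_weight a t) =
      (\<Sum>e\<in>E. 2 * \<beta> / sqrt 3 * integral {0..1} (\<lambda>t. real (crossings e t) * soliton_weight a t))"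
    by (simp only: sum_distrib_left)
  also have "\<dots> \<le> (\<Sum>e\<in>E. (LBINT x:edge_interior (len e). \<bar>g e x\<bar> ^ 2) +
      \<beta>\<^sup>2 / 3 * (a ^ 4 * (LBINT x:edge_interior (len e). \<bar>f e x\<bar> ^ 2) -
        (LBINT x:edge_interior (len e). \<bar>f e x\<bar> ^ 6)))"
  proof (rule sum_mono)
    fix e assume "e \<in> E"
    then have e: "e \<in> arcs G" using E by auto
    have "integral {0..1} (\<lambda>t. real (crossings e t) * soliton_weight a t) \<le>
        (LBINT x:edge_interior (len e). soliton_weight a \<bar>f e x\<bar> * \<bar>g e x\<bar>)"
      by (rule crossings_le[OF e continuous_soliton_weight _
            H1_edge_soliton_weight_integrable[OF H1_edge[OF e] le1[OF e] a]])
         (use a in \<open>auto intro: soliton_weight_nonneg\<close>)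
    then have "2 * \<beta> / sqrt 3 * integral {0..1} (\<lambda>t. real (crossings e t) * soliton_weight a t) \<le>
        2 * \<beta> / sqrt 3 * (LBINT x:edge_interior (len e). soliton_weight a \<bar>f e x\<bar> * \<bar>g e x\<bar>)"
      using \<beta> by (intro mult_left_mono) auto
    also note edge_soliton_inequality[OF H1_edge[OF e] le1[OF e] a, of \<beta>]
    finally show "2 * \<beta> / sqrt 3 * integral {0..1} (\<lambda>t. real (crossings e t) * soliton_weight a t) \<le>
        (LBINT x:edge_interior (len e). \<bar>g e x\<bar> ^ 2) +
      \<beta>\<^sup>2 / 3 * (a ^ 4 * (LBINT x:edge_interior (len e). \<bar>f e x\<bar> ^ 2) -
        (LBINT x:edge_interior (len e). \<bar>f e x\<bar> ^ 6))" by simp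
  qed
  finally show ?thesis .
qed

lemma soliton_inequality:
  assumes a: "1 \<le> a" and \<beta>: "0 \<le> \<beta>"
  shows "2 * \<beta> / sqrt 3 * integral {0..1} (\<lambda>t. real (\<Sum>e\<in>arcs G. crossings e t) * soliton_weight a t) \<le>
    energy + \<beta>\<^sup>2 / 3 * (a ^ 4 * mass - power6)"
  using edges_soliton_inequality[OF order_refl a \<beta>]
  unfolding Lp_norm_pow_def sum.distrib sum_subtractf sum_distrib_left[symmetric] .

lemma total_crossings_integrable:
  assumes a: "1 \<le> a" and E: "E \<subseteq> arcs G"
  shows "(\<lambda>t. real (\<Sum>e\<in>E. crossings e t) * soliton_weight a t) integrable_on {0..1}"
  unfolding of_nat_sum sum_distrib_right
  by (rule integrable_sum) (use E a crossings_integrable finite_subset[OF E] in auto)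

text \<open>Below t the plateau edge has no crossing, so one crossing per level survives on the
  other edges. Those edges pay for the soliton term, while \<open>e\<close> is free to contribute
  its surplus; levels above t are discarded.\<close>

lemma plateau_inequality:
  assumes a: "1 \<le> a" and \<beta>: "0 \<le> \<beta>" and e: "e \<in> arcs G" "len e = ereal L"
    and t: "0 \<le> t" "t \<le> 1" "t \<le> min (p e) (q e)"
  shows "2 * \<beta> / sqrt 3 * integral {0..t} (soliton_weight a) + \<beta>\<^sup>2 / 3 * ((a ^ 4 - 1) * t\<^sup>2 * L) \<le>
    energy + \<beta>\<^sup>2 / 3 * (a ^ 4 * mass - power6)"
proof -
  let ?E = "arcs G - {e}"
  let ?Q = "\<lambda>e. (LBINT x:edge_interior (len e). \<bar>g e x\<bar> ^ 2) +
      \<beta>\<^sup>2 / 3 * (a ^ 4 * (LBINT x:edge_interior (len e). \<bar>f e x\<bar> ^ 2) -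
        (LBINT x:edge_interior (len e). \<bar>f e x\<bar> ^ 6))"
  have "integral {0..t} (soliton_weight a) =
      integral {0..1} (\<lambda>s. if s \<in> {0..t} then soliton_weight a s else 0)"
    using t by (simp only: integral_restrict_Int) (simp add: min_absorb1)
  also have "\<dots> \<le> integral {0..1} (\<lambda>s. real (\<Sum>e\<in>?E. crossings e s) * soliton_weight a s)"
  proof (rule integral_le)
    show "(\<lambda>s. if s \<in> {0..t} then soliton_weight a s else 0) integrable_on {0..1}"
      using t by (subst integrable_restrict_Int) (auto intro!: soliton_weight_integrable simp: min_absorb1)
    show "(\<lambda>s. real (\<Sum>e\<in>?E. crossings e s) * soliton_weight a s) integrable_on {0..1}"
      by (rule total_crossings_integrable[OF a]) auto
    fix s :: real assume s: "s \<in> {0..1}"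
    have nonneg: "0 \<le> soliton_weight a s" using s a by (intro soliton_weight_nonneg) auto
    show "(if s \<in> {0..t} then soliton_weight a s else 0) \<le> real (\<Sum>e\<in>?E. crossings e s) * soliton_weight a s"
    proof (cases "s \<in> {0<..t}")
      case True
      then have "crossings e s = 0" using crossings_eq_0_iff[OF e(1)] t(3) by auto
      then have "1 \<le> (\<Sum>e\<in>?E. crossings e s)"
        using sum_crossings_ge_1[of s] True s sum.remove[OF finite_arcs e(1), of "\<lambda>e. crossings e s"] by simp
      then have "1 * soliton_weight a s \<le> real (\<Sum>e\<in>?E. crossings e s) * soliton_weight a s"
        by (intro mult_right_mono nonneg) (simp only: real_of_nat_ge_one_iff)
      then show ?thesis using True by simp
    next
      case False
      then have "(if s \<in> {0..t} then soliton_weight a s else 0) = 0"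
        by (auto simp: soliton_weight_def)
      then show ?thesis using nonneg by (simp only:) (intro mult_nonneg_nonneg of_nat_0_le_iff)
    qed
  qed
  finally have "2 * \<beta> / sqrt 3 * integral {0..t} (soliton_weight a) \<le>
      2 * \<beta> / sqrt 3 * integral {0..1} (\<lambda>s. real (\<Sum>e\<in>?E. crossings e s) * soliton_weight a s)"
    using \<beta> by (intro mult_left_mono) auto
  also have "\<dots> \<le> (\<Sum>e\<in>?E. ?Q e)" by (rule edges_soliton_inequality[OF Diff_subset a \<beta>])
  finally have "2 * \<beta> / sqrt 3 * integral {0..t} (soliton_weight a) \<le> (\<Sum>e\<in>?E. ?Q e)" .
  moreover have "\<beta>\<^sup>2 / 3 * ((a ^ 4 - 1) * t\<^sup>2 * L) \<le> ?Q e"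
  proof -
    have L: "0 < L" using len_pos[OF e(1)] e(2) by simp
    have "(a ^ 4 - 1) * t\<^sup>2 * L \<le> a ^ 4 * (LBINT x:edge_interior (len e). (f e x)\<^sup>2) -
        (LBINT x:edge_interior (len e). \<bar>f e x\<bar> ^ 6)"
      unfolding e(2)
    proof (rule edge_plateau_inequality[OF _ L a t(1)])
      show "H1_edge (ereal L) (f e) (g e)" using H1_edge[OF e(1)] e(2) by simp
      fix x assume "x \<in> edge_points (ereal L)"
      then show "t \<le> \<bar>f e x\<bar> \<and> \<bar>f e x\<bar> \<le> 1"
        using le1[OF e(1), of x] order_trans[OF t(3) min_le[OF e(1), of x]] e(2) by simp
    qed
    then have "\<beta>\<^sup>2 / 3 * ((a ^ 4 - 1) * t\<^sup>2 * L) \<le> \<beta>\<^sup>2 / 3 * (a ^ 4 * (LBINT x:edge_interior (len e). (f e x)\<^sup>2) -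
        (LBINT x:edge_interior (len e). \<bar>f e x\<bar> ^ 6))" by (intro mult_left_mono) auto
    moreover have "0 \<le> (LBINT x:edge_interior (len e). (g e x)\<^sup>2)"
      unfolding set_lebesgue_integral_def by (intro Bochner_Integration.integral_nonneg) auto
    ultimately show ?thesis by simp
  qed
  moreover have "(\<Sum>e\<in>arcs G. ?Q e) = ?Q e + (\<Sum>e\<in>?E. ?Q e)" by (rule sum.remove[OF finite_arcs e(1)])
  moreover have "(\<Sum>e\<in>arcs G. ?Q e) = energy + \<beta>\<^sup>2 / 3 * (a ^ 4 * mass - power6)"
    unfolding Lp_norm_pow_def sum.distrib sum_subtractf sum_distrib_left[symmetric] ..
  ultimately show ?thesis by linarith
qed

lemma power6_le_mass: "power6 \<le> mass"
  unfolding Lp_norm_pow_def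
proof (rule sum_mono)
  fix e assume e: "e \<in> arcs G"
  have "(LBINT x:edge_interior (len e). \<bar>f e x\<bar> ^ 6) \<le> (LBINT x:edge_interior (len e). (f e x)\<^sup>2)"
  proof (rule set_integral_mono[OF H1_edge_power6_integrable[OF H1_edge[OF e] le1[OF e]]
        H1_edge_mult_integrable(2)[OF H1_edge[OF e]]])
    fix x assume "x \<in> edge_interior (len e)"
    then have "\<bar>f e x\<bar> ^ 6 \<le> \<bar>f e x\<bar> ^ 2"
      using le1[OF e, of x] edge_interior_subset by (intro power_decreasing) auto
    then show "\<bar>f e x\<bar> ^ 6 \<le> (f e x)\<^sup>2" by simp
  qed auto
  then show "(LBINT x:edge_interior (len e). \<bar>f e x\<bar> ^ 6) \<le> (LBINT x:edge_interior (len e). \<bar>f e x\<bar> ^ 2)"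
    by simp
qed

lemma Lp_nonneg: "0 \<le> mass" "0 \<le> energy" "0 \<le> power6"
  unfolding Lp_norm_pow_def set_lebesgue_integral_def
  by (auto intro!: sum_nonneg Bochner_Integration.integral_nonneg)

text \<open>Cauchy-Schwarz on the bounded edges, linearised with a parameter \<kappa> so that the
  edges can simply be summed. Their finite total length keeps the last term bounded.\<close>

lemma energy_ge_variation:
  assumes \<kappa>: "0 < \<kappa>"
  shows "(\<Sum>e\<in>arcs G - half_lines G len. \<bar>q e - p e\<bar>) \<le>
    \<kappa> / 2 * energy + 1 / (2 * \<kappa>) * (\<Sum>e\<in>arcs G - half_lines G len. real_of_ereal (len e))"
proof -
  let ?B = "arcs G - half_lines G len"
  have "\<bar>q e - p e\<bar> \<le> \<kappa> / 2 * (LBINT x:edge_interior (len e). \<bar>g e x\<bar> ^ 2) + 1 / (2 * \<kappa>) * real_of_ereal (len e)"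
    if e: "e \<in> ?B" for e
  proof -
    obtain L where L: "len e = ereal L" "0 < L"
      using e len_pos[of e] by (cases "len e") (auto simp: half_lines_def)
    have I: "edge_interior (len e) = {0<..<L}" by (auto simp: edge_interior_def L)
    have H: "H1_edge (len e) (f e) (g e)" using H1_edge e by auto
    have i1: "set_integrable lborel (edge_interior (len e)) (\<lambda>x. \<bar>g e x\<bar>)"
      using H by (intro set_integrable_abs L2_on_set_integrable[of _ "g e"]) (auto simp: H1_edge_def I)
    have i2: "set_integrable lborel (edge_interior (len e)) (\<lambda>x. \<kappa> / 2 * \<bar>g e x\<bar> ^ 2)"
      using set_integrable_mult_right[OF H1_edge_mult_integrable(3)[OF H]] by simp
    have i3: "set_integrable lborel (edge_interior (len e)) (\<lambda>_. 1 / (2 * \<kappa>))"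
      using L2_on_set_integrable[OF L2_on_const[of "edge_interior (len e)"]] by (auto simp: I)
    have "\<bar>q e - p e\<bar> \<le> (LBINT x:edge_interior (len e). \<bar>g e x\<bar>)" using variation[OF e] .
    also have "\<dots> \<le> (LBINT x:edge_interior (len e). \<kappa> / 2 * \<bar>g e x\<bar> ^ 2 + 1 / (2 * \<kappa>))"
    proof (rule set_integral_mono[OF i1 set_integral_add(1)[OF i2 i3]])
      fix x
      have "0 \<le> (\<kappa> * \<bar>g e x\<bar> - 1)\<^sup>2" by simp
      then have "2 * \<kappa> * \<bar>g e x\<bar> \<le> \<kappa>\<^sup>2 * \<bar>g e x\<bar> ^ 2 + 1" by (simp add: power2_diff power_mult_distrib)
      then show "\<bar>g e x\<bar> \<le> \<kappa> / 2 * \<bar>g e x\<bar> ^ 2 + 1 / (2 * \<kappa>)"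
        using \<kappa> by (simp add: field_simps power2_eq_square)
    qed
    also have "\<dots> = \<kappa> / 2 * (LBINT x:edge_interior (len e). \<bar>g e x\<bar> ^ 2) + 1 / (2 * \<kappa>) * L"
    proof -
      have "(LBINT x:edge_interior (len e). 1 / (2 * \<kappa>)) = 1 / (2 * \<kappa>) * L"
        using L(2) by (simp add: I set_lebesgue_integral_def)
      then show ?thesis by (simp only: set_integral_add(2)[OF i2 i3] set_integral_mult_right)
    qed
    finally show ?thesis by (simp add: L)
  qed
  then have "(\<Sum>e\<in>?B. \<bar>q e - p e\<bar>) \<le> (\<Sum>e\<in>?B. \<kappa> / 2 * (LBINT x:edge_interior (len e). \<bar>g e x\<bar> ^ 2) +
      1 / (2 * \<kappa>) * real_of_ereal (len e))" by (rule sum_mono)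
  also have "\<dots> = \<kappa> / 2 * (\<Sum>e\<in>?B. LBINT x:edge_interior (len e). \<bar>g e x\<bar> ^ 2) +
      1 / (2 * \<kappa>) * (\<Sum>e\<in>?B. real_of_ereal (len e))" by (simp only: sum.distrib sum_distrib_left)
  also have "(\<Sum>e\<in>?B. LBINT x:edge_interior (len e). \<bar>g e x\<bar> ^ 2) \<le> energy"
    unfolding Lp_norm_pow_def set_lebesgue_integral_def
    by (rule sum_mono2) (auto intro!: Bochner_Integration.integral_nonneg)
  finally show ?thesis using \<kappa> by simp
qed

end

lemma half_line_mass_pos: "0 < half_line_mass"
  by (simp add: half_line_mass_def)

lemma two_sqrt3_pi: "2 * sqrt 3 * (x * pi / 8) = x * half_line_mass"
  by (simp add: half_line_mass_def)

context normalized_profile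
begin

text \<open>With \<beta> = \<nu> / mass the term \<beta>^2 a^4 mass / 3 equals \<beta> a^4 \<nu> / 3
  and cancels against the lower bound on I. What remains is \<beta>^2 power6 \<le> 3 energy, for any
  a. I may be a crossing integral or one enlarged by a plateau term.\<close>

lemma GN_of_integral_bound:
  assumes a: "1 \<le> a" and \<nu>: "0 < \<nu>" and m: "0 < mass"
    and I: "a ^ 4 * \<nu> \<le> 2 * sqrt 3 * I"
    and le: "2 * (\<nu> / mass) / sqrt 3 * I \<le> energy + (\<nu> / mass)\<^sup>2 / 3 * (a ^ 4 * mass - power6)"
  shows "\<nu>\<^sup>2 * power6 \<le> 3 * mass\<^sup>2 * energy"
proof -
  define \<beta> where "\<beta> = \<nu> / mass"
  have \<beta>: "0 < \<beta>" "\<beta> * mass = \<nu>" using m \<nu> by (auto simp: \<beta>_def)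
  have "2 * \<beta> / sqrt 3 * I = \<beta> / 3 * (2 * sqrt 3 * I)"
    by (simp add: field_simps)
  moreover have "\<beta> / 3 * (a ^ 4 * \<nu>) \<le> \<beta> / 3 * (2 * sqrt 3 * I)"
    using I \<beta>(1) by (intro mult_left_mono) auto
  moreover have "\<beta>\<^sup>2 / 3 * (a ^ 4 * mass - power6) = \<beta> / 3 * (a ^ 4 * \<nu>) - \<beta>\<^sup>2 / 3 * power6"
    by (simp add: \<beta>(2)[symmetric] power2_eq_square algebra_simps)
  ultimately have "\<beta>\<^sup>2 * power6 \<le> 3 * energy"
    using le unfolding \<beta>_def[symmetric] by linarith
  then have "mass\<^sup>2 * (\<beta>\<^sup>2 * power6) \<le> mass\<^sup>2 * (3 * energy)" by (intro mult_left_mono) auto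
  moreover have "mass\<^sup>2 * (\<beta>\<^sup>2 * power6) = \<nu>\<^sup>2 * power6"
    by (simp add: \<beta>(2)[symmetric] power_mult_distrib mult_ac)
  ultimately have "\<nu>\<^sup>2 * power6 \<le> mass\<^sup>2 * (3 * energy)" by linarith
  then show ?thesis by (simp add: mult_ac)
qed

text \<open>One crossing per level already yields the half-line constant. Applied to the half-line
  itself, this bounds its quotients, as needed for the real supremum there.\<close>

lemma GN_half_line_bound: "half_line_mass\<^sup>2 * power6 \<le> 3 * mass\<^sup>2 * energy"
proof (cases "mass = 0")
  case True
  then show ?thesis using power6_le_mass Lp_nonneg by simp
next
  case False
  then have m: "0 < mass" using Lp_nonneg by simp
  let ?I = "integral {0..1} (\<lambda>t. real (\<Sum>e\<in>arcs G. crossings e t) * soliton_weight 1 t)"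
  have "integral {0..1} (soliton_weight 1) \<le> ?I"
  proof (rule integral_le[OF soliton_weight_integrable total_crossings_integrable])
    fix t :: real assume t: "t \<in> {0..1}"
    show "soliton_weight 1 t \<le> real (\<Sum>e\<in>arcs G. crossings e t) * soliton_weight 1 t"
    proof (cases "t = 0")
      case False
      then have "1 \<le> (\<Sum>e\<in>arcs G. crossings e t)" using t by (intro sum_crossings_ge_1) auto
      then have "1 * soliton_weight 1 t \<le> real (\<Sum>e\<in>arcs G. crossings e t) * soliton_weight 1 t"
        using t by (intro mult_right_mono soliton_weight_nonneg) (auto simp only: real_of_nat_ge_one_iff atLeastAtMost_iff)
      then show ?thesis by simp
    qed (simp add: soliton_weight_def)
  qed auto
  then have "2 * sqrt 3 * (1 * pi / 8) \<le> 2 * sqrt 3 * ?I"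
    using integral_soliton_weight[of 1] by (intro mult_left_mono) auto
  then have I: "1 ^ 4 * half_line_mass \<le> 2 * sqrt 3 * ?I"
    unfolding two_sqrt3_pi by simp
  show ?thesis
    by (rule GN_of_integral_bound[OF order_refl half_line_mass_pos m I])
       (rule soliton_inequality, use m half_line_mass_pos in auto)
qed

text \<open>Two crossings on every level would give pi / 4. A level with a single one lies in the
  range of \<bar>u\<bar> on some bounded edge, and the weight is at most 1, so the deficit is at
  most the sum of the ranges.\<close>

lemma crossings_integral_ge:
  assumes tips: "tips G len = {}" and two: "card (half_lines G len) \<ge> 2"
  shows "pi / 4 - (\<Sum>e\<in>arcs G - half_lines G len. \<bar>q e - p e\<bar>) \<le>
    integral {0..1} (\<lambda>t. real (\<Sum>e\<in>arcs G. crossings e t) * soliton_weight 1 t)"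
proof -
  let ?B = "arcs G - half_lines G len" and ?s = "soliton_weight 1"
  let ?G = "\<lambda>x. integral {0..x} ?s"
  have nonneg: "0 \<le> ?s t" if "t \<in> {0..1}" for t using that by (intro soliton_weight_nonneg) auto
  have c: "((\<lambda>t. real (cross (p e) (q e) t) * ?s t) has_integral \<bar>?G (q e) - ?G (p e)\<bar>) {0..1}"
    if "e \<in> ?B" for e
    using pq[of e] that nonneg by (intro cross_has_integral continuous_soliton_weight) auto
  have var: "\<bar>?G (q e) - ?G (p e)\<bar> \<le> \<bar>q e - p e\<bar>" if "e \<in> ?B" for e
  proof -
    have "norm (?G (p e) - ?G (q e)) \<le> 1 * norm (p e - q e)"
    proof (rule field_differentiable_bound[of "{0..1}" ?G ?s])
      fix t :: real assume t: "t \<in> {0..1}"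
      show "(?G has_real_derivative ?s t) (at t within {0..1})"
        by (rule integral_has_real_derivative[OF continuous_soliton_weight t])
      show "norm (?s t) \<le> 1" using soliton_weight_le[of t 1] nonneg[OF t] t by auto
    qed (use pq[of e] that in auto)
    then show ?thesis by (simp add: abs_minus_commute)
  qed
  have S: "((\<lambda>t. \<Sum>e\<in>?B. real (cross (p e) (q e) t) * ?s t) has_integral (\<Sum>e\<in>?B. \<bar>?G (q e) - ?G (p e)\<bar>)) {0..1}"
    by (rule has_integral_sum) (use c finite_arcs in auto)
  have s2: "((\<lambda>t. 2 * ?s t) has_integral 2 * integral {0..1} ?s) {0..1}"
    by (intro has_integral_mult_right integrable_integral soliton_weight_integrable)
  have "pi / 4 - (\<Sum>e\<in>?B. \<bar>q e - p e\<bar>) \<le> 2 * integral {0..1} ?s - (\<Sum>e\<in>?B. \<bar>?G (q e) - ?G (p e)\<bar>)"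
  proof -
    have "(\<Sum>e\<in>?B. \<bar>?G (q e) - ?G (p e)\<bar>) \<le> (\<Sum>e\<in>?B. \<bar>q e - p e\<bar>)" by (rule sum_mono[OF var])
    then show ?thesis using integral_soliton_weight[of 1] by simp
  qed
  also have "\<dots> = integral {0..1} (\<lambda>t. 2 * ?s t - (\<Sum>e\<in>?B. real (cross (p e) (q e) t) * ?s t))"
    by (rule integral_unique[symmetric, OF has_integral_diff[OF s2 S]])
  also have "\<dots> \<le> integral {0..1} (\<lambda>t. real (\<Sum>e\<in>arcs G. crossings e t) * ?s t)"
  proof (rule integral_le[OF has_integral_integrable[OF has_integral_diff[OF s2 S]] total_crossings_integrable])
    fix t :: real assume t: "t \<in> {0..1}"
    \<comment> \<open>The level 0 is exempt, since crossings are guaranteed only for positive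
      levels; the weight vanishes there.\<close>
    have "2 \<le> real (\<Sum>e\<in>arcs G. crossings e t) + (\<Sum>e\<in>?B. real (cross (p e) (q e) t))" if "t \<noteq> 0"
    proof (cases "(\<Sum>e\<in>arcs G. crossings e t) < 2")
      case True
      have t0: "0 < t" "t \<le> 1" using t that by auto
      obtain e where e: "e \<in> ?B" "min (p e) (q e) < t \<and> t \<le> max (p e) (q e)"
        using single_crossing(1)[OF tips two t0 True] by blast
      then have "cross (p e) (q e) t = 1" by (auto simp: cross_def)
      then have "1 \<le> (\<Sum>e\<in>?B. real (cross (p e) (q e) t))"
        using member_le_sum[OF e(1), of "\<lambda>e. real (cross (p e) (q e) t)"] finite_arcs by simp
      moreover have "1 \<le> real (\<Sum>e\<in>arcs G. crossings e t)"
        using sum_crossings_ge_1[OF t0] by linarith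
      ultimately show ?thesis by simp
    next
      case False
      then have "2 \<le> real (\<Sum>e\<in>arcs G. crossings e t)" by linarith
      then show ?thesis by (simp add: sum_nonneg add_increasing2)
    qed
    then have "2 * ?s t \<le> (real (\<Sum>e\<in>arcs G. crossings e t) + (\<Sum>e\<in>?B. real (cross (p e) (q e) t))) * ?s t"
      using nonneg[OF t] by (cases "t = 0") (auto simp: soliton_weight_def intro: mult_right_mono)
    then show "2 * ?s t - (\<Sum>e\<in>?B. real (cross (p e) (q e) t) * ?s t) \<le> real (\<Sum>e\<in>arcs G. crossings e t) * ?s t"
      by (simp add: distrib_right sum_distrib_right)
  qed auto
  finally show ?thesis .
qed

end

section \<open>The uniform gain on a graph without tips\<close>

lemma (in metric_graph) bounded_lengths:
  obtains c L where "0 < c" "0 < L" "\<And>e. e \<in> arcs G - half_lines G len \<Longrightarrow> c \<le> real_of_ereal (len e)"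
    "(\<Sum>e\<in>arcs G - half_lines G len. real_of_ereal (len e)) \<le> L"
proof -
  let ?B = "arcs G - half_lines G len"
  \<comment> \<open>The extra 1, here and in the total length, keeps both constants positive when
    the graph has no bounded edge.\<close>
  let ?C = "insert 1 ((\<lambda>e. real_of_ereal (len e)) ` ?B)"
  have pos: "0 < real_of_ereal (len e)" if "e \<in> ?B" for e
    using that len_pos[of e] by (cases "len e") (auto simp: half_lines_def)
  show thesis
  proof (rule that[of "Min ?C" "1 + (\<Sum>e\<in>?B. real_of_ereal (len e))"])
    have "Min ?C \<in> ?C" by (rule Min_in) (use finite_arcs in auto)
    then show "0 < Min ?C" using pos by auto
    show "0 < 1 + (\<Sum>e\<in>?B. real_of_ereal (len e))" by (intro add_pos_nonneg sum_nonneg less_imp_le[OF pos]) auto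
    show "Min ?C \<le> real_of_ereal (len e)" if "e \<in> ?B" for e
      by (rule Min_le) (use that finite_arcs in auto)
  qed auto
qed

text \<open>\<nu> is fixed before the profile and depends only on the bounded edge lengths. Each of
  the four cases allows a certain excess over \<open>half_line_mass\<close>, and the smallest one is
  taken.\<close>

lemma (in metric_graph) GN_improved:
  assumes tips: "tips G len = {}" and two: "card (half_lines G len) \<ge> 2"
  obtains \<nu> where "half_line_mass < \<nu>"
    "\<And>w p q f g. normalized_profile G len w p q f g \<Longrightarrow>
       \<nu>\<^sup>2 * Lp_norm_pow G len 6 f \<le> 3 * (Lp_norm_pow G len 2 f)\<^sup>2 * Lp_norm_pow G len 2 g"
proof -
  let ?B = "arcs G - half_lines G len" and ?\<nu>0 = half_line_mass
  obtain c L where c: "0 < c" "\<And>e. e \<in> ?B \<Longrightarrow> c \<le> real_of_ereal (len e)"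
    and L: "0 < L" "(\<Sum>e\<in>?B. real_of_ereal (len e)) \<le> L"
    using bounded_lengths by blast
  \<comment> \<open>Tuned to the case of large variation: there the energy is at least 1 / (64 L),
    while \<beta>^2 power6 \<le> \<beta> \<nu> \<le> 2 \<eta> \<open>half_line_mass\<close> = 3 /
    (64 L).\<close>
  define \<eta> where "\<eta> = 3 / (128 * L * ?\<nu>0)"
  have \<eta>: "0 < \<eta>" using L half_line_mass_pos by (simp add: \<eta>_def)
  obtain a \<delta> \<epsilon> where a: "1 < a" and \<delta>: "0 < \<delta>" "\<delta> < 1" and \<epsilon>: "0 < \<epsilon>"
    and par: "\<And>t. 1 - \<delta> \<le> t \<Longrightarrow> t \<le> 1 \<Longrightarrow>
      2 * sqrt 3 * ((a - t) * (a * sqrt (a ^ 4 - t ^ 4))) + a ^ 4 * \<epsilon> \<le> \<eta> * c * (a ^ 4 - 1) * t\<^sup>2"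
    using soliton_parameters[of "\<eta> * c"] \<eta> c(1) by auto
  define \<kappa> where "\<kappa> = integral {1 - \<delta>..1} (soliton_weight 1)"
  have \<kappa>: "0 < \<kappa>" unfolding \<kappa>_def using \<delta> by (intro integral_soliton_weight_1_pos) auto
  \<comment> \<open>In order: the excess for a plateau, for doubled top levels and for small
    variation. The last entry only ensures \<nu> \<le> 2 \<open>half_line_mass\<close>, used in the
    case of large variation.\<close>
  define h where "h = min (min \<epsilon> (2 * sqrt 3 * \<kappa>)) (min (sqrt 3 / 4) ?\<nu>0)"
  have h: "0 < h" "h \<le> \<epsilon>" "h \<le> 2 * sqrt 3 * \<kappa>" "h \<le> sqrt 3 / 4" "h \<le> ?\<nu>0"
    using \<epsilon> \<kappa> half_line_mass_pos by (auto simp: h_def)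
  define \<nu> where "\<nu> = ?\<nu>0 + h"
  have \<nu>: "?\<nu>0 < \<nu>" "0 < \<nu>" "\<nu> \<le> 2 * ?\<nu>0" using h half_line_mass_pos by (auto simp: \<nu>_def)
  show thesis
  proof (rule that[OF \<nu>(1)])
    fix w p q f g
    assume "normalized_profile G len w p q f g"
    then interpret normalized_profile G len w p q f g .
    show "\<nu>\<^sup>2 * power6 \<le> 3 * mass\<^sup>2 * energy"
    proof (cases "mass = 0")
      case True
      then show ?thesis using power6_le_mass Lp_nonneg by simp
    next
      case False
      then have m: "0 < mass" using Lp_nonneg by simp
      define \<beta> where "\<beta> = \<nu> / mass"
      have \<beta>: "0 < \<beta>" "\<beta> * mass = \<nu>" using m \<nu> by (auto simp: \<beta>_def)
      let ?I = "integral {0..1} (\<lambda>t. real (\<Sum>e\<in>arcs G. crossings e t) * soliton_weight 1 t)"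
      have by_I: ?thesis if "\<nu> \<le> 2 * sqrt 3 * ?I"
        by (rule GN_of_integral_bound[OF order_refl \<nu>(2) m])
           (use that soliton_inequality[of 1 "\<nu> / mass"] m \<nu> in auto)
      \<comment> \<open>Small variation needs no condition on \<beta>. If the variation is at least
        1/8, then small \<beta> is settled by the energy; for large \<beta> either all levels near
        the top are doubled or one of them has a single crossing.\<close>
      consider (var) "\<beta> \<le> \<eta>" "1 / 8 \<le> (\<Sum>e\<in>?B. \<bar>q e - p e\<bar>)"
        | (flat) "(\<Sum>e\<in>?B. \<bar>q e - p e\<bar>) < 1 / 8"
        | (dbl) "\<And>t. 1 - \<delta> \<le> t \<Longrightarrow> t \<le> 1 \<Longrightarrow> 2 \<le> (\<Sum>e\<in>arcs G. crossings e t)"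
        | (plateau) t where "\<eta> < \<beta>" "1 - \<delta> \<le> t" "t \<le> 1" "(\<Sum>e\<in>arcs G. crossings e t) < 2"
        by (meson not_le)
      then show ?thesis
      proof cases
        case var
        \<comment> \<open>With \<kappa> = 8 L the length term is at most 1/16, half of the
          variation, so the energy term must supply the other half.\<close>
        have "1 / 8 \<le> 8 * L / 2 * energy + 1 / (2 * (8 * L)) * (\<Sum>e\<in>?B. real_of_ereal (len e))"
          using energy_ge_variation[of "8 * L"] var(2) L(1) by simp
        also have "\<dots> \<le> 8 * L / 2 * energy + 1 / (2 * (8 * L)) * L"
          using L by (intro add_left_mono mult_left_mono) auto
        finally have "1 \<le> 64 * L * energy" using L(1) by (simp add: field_simps)
        then have E: "1 / (64 * L) \<le> energy" using L(1) by (simp add: field_simps)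
        have "\<beta>\<^sup>2 * power6 \<le> \<beta>\<^sup>2 * mass" using power6_le_mass by (intro mult_left_mono) auto
        also have "\<dots> = \<beta> * \<nu>" by (simp add: \<beta>(2)[symmetric] power2_eq_square mult_ac)
        also have "\<dots> \<le> \<eta> * (2 * ?\<nu>0)" using var(1) \<nu> \<eta> by (intro mult_mono) auto
        also have "\<dots> = 3 * (1 / (64 * L))" using half_line_mass_pos by (simp add: \<eta>_def)
        also have "\<dots> \<le> 3 * energy" using E by simp
        finally have "mass\<^sup>2 * (\<beta>\<^sup>2 * power6) \<le> mass\<^sup>2 * (3 * energy)" by (intro mult_left_mono) auto
        moreover have "mass\<^sup>2 * (\<beta>\<^sup>2 * power6) = \<nu>\<^sup>2 * power6"
          by (simp add: \<beta>(2)[symmetric] power_mult_distrib mult_ac)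
        ultimately have "\<nu>\<^sup>2 * power6 \<le> mass\<^sup>2 * (3 * energy)" by linarith
        then show ?thesis by (simp add: mult_ac)
      next
        case flat
        then have "pi / 4 - 1 / 8 \<le> ?I" using crossings_integral_ge[OF tips two] by simp
        then have "2 * sqrt 3 * (pi / 4 - 1 / 8) \<le> 2 * sqrt 3 * ?I" by (intro mult_left_mono) auto
        \<comment> \<open>Two crossings per level double the constant, and the deficit 1/8 costs
          sqrt 3 / 4. As pi \<ge> 2, the constant is at least twice that cost, which leaves an
          excess of at least sqrt 3 / 4.\<close>
        moreover have "2 * sqrt 3 * (pi / 4 - 1 / 8) = 2 * ?\<nu>0 - sqrt 3 / 4"
          by (simp add: half_line_mass_def right_diff_distrib)
        moreover have "2 * (sqrt 3 / 4) \<le> ?\<nu>0"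
        proof -
          have "sqrt 3 / 4 * 2 \<le> sqrt 3 / 4 * pi" using pi_ge_two by (intro mult_left_mono) auto
          then show ?thesis by (simp add: half_line_mass_def mult_ac)
        qed
        ultimately show ?thesis using h(4) by (intro by_I) (simp add: \<nu>_def)
      next
        case dbl
        let ?r = "\<lambda>t. if t \<in> {1 - \<delta>..1} then soliton_weight 1 t else 0"
        have sub: "{1 - \<delta>..1} \<inter> {0..1} = {1 - \<delta>..1}" using \<delta> by auto
        have r: "?r integrable_on {0..1}" "integral {0..1} ?r = \<kappa>"
          unfolding integrable_restrict_Int integral_restrict_Int sub \<kappa>_def
          by (simp_all add: soliton_weight_integrable)
        have "integral {0..1} (soliton_weight 1) + \<kappa> = integral {0..1} (\<lambda>t. soliton_weight 1 t + ?r t)"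
          unfolding r(2)[symmetric]
          by (rule Henstock_Kurzweil_Integration.integral_add[symmetric, OF soliton_weight_integrable r(1)])
        also have "\<dots> \<le> ?I"
        proof (rule integral_le[OF integrable_add[OF soliton_weight_integrable r(1)] total_crossings_integrable])
          fix t :: real assume t: "t \<in> {0..1}"
          have nonneg: "0 \<le> soliton_weight 1 t" using t by (intro soliton_weight_nonneg) auto
          let ?n = "\<Sum>e\<in>arcs G. crossings e t"
          show "soliton_weight 1 t + ?r t \<le> real ?n * soliton_weight 1 t"
          proof (cases "t = 0")
            case False
            have "1 \<le> real ?n"
              unfolding real_of_nat_ge_one_iff by (rule sum_crossings_ge_1) (use t False in auto)
            moreover have "2 \<le> real ?n" if "1 - \<delta> \<le> t"
              using dbl[OF that] t by (simp only: of_nat_le_iff[of 2, symmetric, where 'a = real]) simp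
            ultimately have "(if t \<in> {1 - \<delta>..1} then 2 else 1) * soliton_weight 1 t \<le> real ?n * soliton_weight 1 t"
              using nonneg by (intro mult_right_mono) auto
            moreover have "(if t \<in> {1 - \<delta>..1} then 2 else 1) * soliton_weight 1 t = soliton_weight 1 t + ?r t"
              by simp
            ultimately show ?thesis by linarith
          qed (simp add: soliton_weight_def)
        qed auto
        finally have "2 * sqrt 3 * (pi / 8 + \<kappa>) \<le> 2 * sqrt 3 * ?I"
          using integral_soliton_weight[of 1] by (intro mult_left_mono) auto
        then have "?\<nu>0 + 2 * sqrt 3 * \<kappa> \<le> 2 * sqrt 3 * ?I"
          using two_sqrt3_pi[of 1] by (simp add: distrib_left)
        then show ?thesis using h(3) by (intro by_I) (simp add: \<nu>_def)
      next
        case plateau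
        have t: "0 < t" using plateau \<delta> by simp
        obtain e where e: "e \<in> ?B" "t \<le> min (p e) (q e)"
          using single_crossing(2)[OF tips two t plateau(3,4)] by blast
        then obtain l where l: "len e = ereal l" using len_pos[of e] by (cases "len e") (auto simp: half_lines_def)
        have cl: "c \<le> l" using c(2)[OF e(1)] l by simp
        let ?J = "integral {0..t} (soliton_weight a)"
        have J: "a ^ 4 * ?\<nu>0 - 2 * sqrt 3 * ((a - t) * (a * sqrt (a ^ 4 - t ^ 4))) \<le> 2 * sqrt 3 * ?J"
        proof -
          have "2 * sqrt 3 * (a ^ 4 * pi / 8 - (a - t) * (a * sqrt (a ^ 4 - t ^ 4))) \<le> 2 * sqrt 3 * ?J"
            using integral_soliton_weight_ge[of t a] t plateau(3) a by (intro mult_left_mono) auto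
          then show ?thesis using two_sqrt3_pi[of "a ^ 4"] by (simp only: right_diff_distrib)
        qed
        \<comment> \<open>The plateau surplus in units of the soliton term. Because \<beta> > \<eta>
          and l \<ge> c, it dominates \<eta> c (a^4 - 1) t^2, the quantity for which a and \<delta>
          were chosen.\<close>
        define R where "R = \<beta> * ((a ^ 4 - 1) * t\<^sup>2 * l)"
        have "\<eta> * c * (a ^ 4 - 1) * t\<^sup>2 \<le> R"
        proof -
          have "\<eta> * (c * ((a ^ 4 - 1) * t\<^sup>2)) \<le> \<beta> * (l * ((a ^ 4 - 1) * t\<^sup>2))"
            using plateau(1) cl c(1) \<eta> a by (intro mult_mono mult_nonneg_nonneg) auto
          then show ?thesis by (simp add: R_def mult_ac)
        qed
        then have "a ^ 4 * ?\<nu>0 + a ^ 4 * \<epsilon> \<le> 2 * sqrt 3 * ?J + R"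
          using par[OF plateau(2,3)] J by linarith
        moreover have "a ^ 4 * \<nu> \<le> a ^ 4 * (?\<nu>0 + \<epsilon>)" using h(2) a by (intro mult_left_mono) (auto simp: \<nu>_def)
        ultimately have I: "a ^ 4 * \<nu> \<le> 2 * sqrt 3 * (?J + R / (2 * sqrt 3))" by (simp add: distrib_left)
        have "2 * \<beta> / sqrt 3 * (?J + R / (2 * sqrt 3)) = 2 * \<beta> / sqrt 3 * ?J + \<beta>\<^sup>2 / 3 * ((a ^ 4 - 1) * t\<^sup>2 * l)"
          by (simp add: R_def distrib_left power2_eq_square)
        also have "\<dots> \<le> energy + \<beta>\<^sup>2 / 3 * (a ^ 4 * mass - power6)"
          by (rule plateau_inequality) (use a \<beta> e l t plateau in auto)
        finally show ?thesis
          unfolding \<beta>_def using a by (intro GN_of_integral_bound[OF _ \<nu>(2) m I]) auto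
      qed
    qed
  qed
qed

section \<open>Reduction to normalised functions\<close>

lemma L2_on_divide:
  assumes "L2_on I f" shows "L2_on I (\<lambda>x. f x / M)"
proof -
  have "set_borel_measurable lborel I (\<lambda>x. f x / M)"
    using borel_measurable_divide[OF assms[unfolded L2_on_def set_borel_measurable_def, THEN conjunct1]
        borel_measurable_const[of M]]
    unfolding set_borel_measurable_def by simp
  moreover have "set_integrable lborel I (\<lambda>x. (f x / M)\<^sup>2)"
    using assms set_integrable_divide[of "M\<^sup>2" lborel I "\<lambda>x. (f x)\<^sup>2"]
    by (cases "M = 0") (auto simp: L2_on_def power_divide set_integrable_def)
  ultimately show ?thesis by (simp add: L2_on_def)
qed

lemma H1_edge_divide:
  assumes "H1_edge l f g" shows "H1_edge l (\<lambda>x. f x / M) (\<lambda>x. g x / M)"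
proof (cases "M = 0")
  case True
  then show ?thesis by (auto simp: H1_edge_def L2_on_def set_borel_measurable_def set_integrable_def)
next
  case False
  have "f y / M - f x / M = integral {x..y} (\<lambda>x. g x / M)" if "0 \<le> x" "x \<le> y" "ereal y \<le> l" for x y
    using assms that by (simp add: H1_edge_def flip: diff_divide_distrib)
  then show ?thesis
    using assms False by (auto simp: H1_edge_def intro!: L2_on_divide continuous_intros)
qed

lemma Lp_norm_pow_divide:
  assumes "0 < M"
  shows "Lp_norm_pow G len n (\<lambda>e x. u e x / M) = Lp_norm_pow G len n u / M ^ n"
  using assms by (simp add: Lp_norm_pow_def power_divide sum_divide_distrib)

context metric_graph
begin

lemma H1_edge_of_H1:
  assumes u: "u \<in> H1 G len" and e: "e \<in> arcs G"
  shows "H1_edge (len e) (u e) (graph_deriv len u e)"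
proof (rule H1_edgeI)
  show "continuous_on (edge_points (len e)) (u e)"
    using u e by (auto simp: H1_def continuous_on_graph_def)
  have H: "H1_on (edge_interior (len e)) (u e)" using u e by (auto simp: H1_def)
  then show "L2_on (edge_interior (len e)) (u e)" by (simp add: H1_on_def)
  obtain g where "has_weak_L2_deriv (edge_interior (len e)) (u e) g" using H by (auto simp: H1_on_def)
  then show "has_weak_L2_deriv (edge_interior (len e)) (u e) (graph_deriv len u e)"
    unfolding graph_deriv_def weak_deriv_def
    by (rule someI[of "has_weak_L2_deriv (edge_interior (len e)) (u e)"])
qed

text \<open>Division by the maximum of \<bar>u\<bar>, which exists: it is attained on each edge,
  also on a half-line because u tends to 0, and there are finitely many edges.\<close>

lemma normalized_profile_of_H1:
  assumes conn: "Digraph_Component.connected G" and nc: "noncompact G len"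
    and u: "u \<in> H1 G len" and nz: "nonzero_on G len u"
  obtains M w p q where "0 < M"
    "normalized_profile G len w p q (\<lambda>e x. u e x / M) (\<lambda>e x. graph_deriv len u e x / M)"
proof -
  have "\<forall>e\<in>arcs G. \<exists>x\<in>edge_points (len e). \<forall>y\<in>edge_points (len e). \<bar>u e y\<bar> \<le> \<bar>u e x\<bar>"
    using H1_edge_attains_sup[OF H1_edge_of_H1[OF u] len_pos] by blast
  then obtain X where X: "\<And>e. e \<in> arcs G \<Longrightarrow> X e \<in> edge_points (len e)"
    "\<And>e y. e \<in> arcs G \<Longrightarrow> y \<in> edge_points (len e) \<Longrightarrow> \<bar>u e y\<bar> \<le> \<bar>u e (X e)\<bar>"
    by metis
  obtain e0 x0 where e0: "e0 \<in> arcs G" "x0 \<in> edge_points (len e0)" "u e0 x0 \<noteq> 0"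
    using nz by (auto simp: nonzero_on_def)
  define M where "M = Max ((\<lambda>e. \<bar>u e (X e)\<bar>) ` arcs G)"
  have M_ge: "\<bar>u e (X e)\<bar> \<le> M" if "e \<in> arcs G" for e
    unfolding M_def by (rule Max_ge) (use that finite_arcs in auto)
  have "M \<in> (\<lambda>e. \<bar>u e (X e)\<bar>) ` arcs G"
    unfolding M_def by (rule Max_in) (use e0 finite_arcs in auto)
  then obtain e1 where e1: "e1 \<in> arcs G" "\<bar>u e1 (X e1)\<bar> = M" by auto
  have M: "0 < M" using M_ge[OF e0(1)] X(2)[OF e0(1,2)] e0(3) by linarith
  let ?f = "\<lambda>e x. u e x / M" and ?g = "\<lambda>e x. graph_deriv len u e x / M"
  have H: "H1_edge (len e) (?f e) (?g e)" if "e \<in> arcs G" for e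
    by (rule H1_edge_divide[OF H1_edge_of_H1[OF u that]])
  have le1: "\<bar>?f e x\<bar> \<le> 1" if "e \<in> arcs G" "x \<in> edge_points (len e)" for e x
    using order_trans[OF X(2)[OF that] M_ge[OF that(1)]] M by (simp add: field_simps)
  obtain w0 where w0: "\<And>e. e \<in> arcs G \<Longrightarrow> u e 0 = w0 (tail G e)"
    "\<And>e. e \<in> arcs G \<Longrightarrow> len e \<noteq> \<infinity> \<Longrightarrow> u e (real_of_ereal (len e)) = w0 (head G e)"
    using u by (auto simp: H1_def continuous_on_graph_def)
  \<comment> \<open>Continuity leaves \<open>w0\<close> unconstrained at the vertices at infinity;
    the value 0 chosen there is the limit of u along the half-line.\<close>
  define w where "w v = (if v \<in> verts_at_inf G len then 0 else \<bar>w0 v / M\<bar>)" for v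
  have w_tail: "w (tail G e) = \<bar>?f e 0\<bar>" if "e \<in> arcs G" for e
    using that w0(1) tail_not_at_inf by (simp add: w_def)
  have w_head: "w (head G e) = (if len e = \<infinity> then 0 else \<bar>?f e (real_of_ereal (len e))\<bar>)" if "e \<in> arcs G" for e
    using that w0(2) head_not_at_inf by (auto simp: w_def verts_at_inf_def half_lines_def)
  \<comment> \<open>The conclusion of \<open>H1_edge_crossings\<close> as a predicate, so that p and
    q can be selected simultaneously on all edges.\<close>
  define P where "P e p q \<longleftrightarrow> 0 \<le> p \<and> 0 \<le> q \<and>
      (\<forall>x\<in>edge_points (len e). \<bar>?f e x\<bar> \<in> {min p q..max p q}) \<and>
      (\<exists>x\<in>edge_points (len e). \<bar>?f e x\<bar> = max p q) \<and> (len e = \<infinity> \<longrightarrow> q = 0) \<and>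
      w (head G e) \<in> {min p q..max p q} \<and>
      (\<forall>\<gamma>. continuous_on {0..1} \<gamma> \<longrightarrow> (\<forall>s\<in>{0..1}. 0 \<le> \<gamma> s) \<longrightarrow>
        set_integrable lborel (edge_interior (len e)) (\<lambda>x. \<gamma> \<bar>?f e x\<bar> * \<bar>?g e x\<bar>) \<longrightarrow>
        integral {0..1} (\<lambda>t. real (chain_crossings (w (tail G e)) p q (w (head G e)) t) * \<gamma> t) \<le>
          (LBINT x:edge_interior (len e). \<gamma> \<bar>?f e x\<bar> * \<bar>?g e x\<bar>)) \<and>
      (len e \<noteq> \<infinity> \<longrightarrow> \<bar>q - p\<bar> \<le> (LBINT x:edge_interior (len e). \<bar>?g e x\<bar>))" for e p q
  have "\<exists>p q. P e p q" if e: "e \<in> arcs G" for e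
  proof (rule H1_edge_crossings[OF H[OF e] len_pos[OF e] le1[OF e]], assumption)
    fix p q
    assume *: "0 \<le> p" "0 \<le> q" "\<And>x. x \<in> edge_points (len e) \<Longrightarrow> \<bar>?f e x\<bar> \<in> {min p q..max p q}"
      "\<exists>x\<in>edge_points (len e). \<bar>?f e x\<bar> = max p q" "len e = \<infinity> \<Longrightarrow> q = 0"
      "(if len e = \<infinity> then 0 else \<bar>?f e (real_of_ereal (len e))\<bar>) \<in> {min p q..max p q}"
      "\<And>\<gamma>. continuous_on {0..1} \<gamma> \<Longrightarrow> (\<And>s. s \<in> {0..1} \<Longrightarrow> 0 \<le> \<gamma> s) \<Longrightarrow>
         set_integrable lborel (edge_interior (len e)) (\<lambda>x. \<gamma> \<bar>?f e x\<bar> * \<bar>?g e x\<bar>) \<Longrightarrow>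
         integral {0..1} (\<lambda>t. real (chain_crossings \<bar>?f e 0\<bar> p q
             (if len e = \<infinity> then 0 else \<bar>?f e (real_of_ereal (len e))\<bar>) t) * \<gamma> t) \<le>
           (LBINT x:edge_interior (len e). \<gamma> \<bar>?f e x\<bar> * \<bar>?g e x\<bar>)"
      "len e \<noteq> \<infinity> \<Longrightarrow> \<bar>q - p\<bar> \<le> (LBINT x:edge_interior (len e). \<bar>?g e x\<bar>)"
    have "P e p q"
      unfolding P_def w_tail[OF e] w_head[OF e]
      by (intro conjI ballI allI impI) (use * in \<open>blast+\<close>)
    then show ?thesis by blast
  qed
  then obtain p q where P: "\<And>e. e \<in> arcs G \<Longrightarrow> P e (p e) (q e)" by metis
  have pq: "0 \<le> p e \<and> 0 \<le> q e"
    "x \<in> edge_points (len e) \<Longrightarrow> \<bar>?f e x\<bar> \<in> {min (p e) (q e)..max (p e) (q e)}"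
    "\<exists>x\<in>edge_points (len e). \<bar>?f e x\<bar> = max (p e) (q e)"
    "len e = \<infinity> \<Longrightarrow> q e = 0"
    "w (head G e) \<in> {min (p e) (q e)..max (p e) (q e)}"
    "continuous_on {0..1} \<gamma> \<Longrightarrow> \<forall>s\<in>{0..1}. 0 \<le> \<gamma> s \<Longrightarrow>
        set_integrable lborel (edge_interior (len e)) (\<lambda>x. \<gamma> \<bar>?f e x\<bar> * \<bar>?g e x\<bar>) \<Longrightarrow>
        integral {0..1} (\<lambda>t. real (chain_crossings (w (tail G e)) (p e) (q e) (w (head G e)) t) * \<gamma> t) \<le>
          (LBINT x:edge_interior (len e). \<gamma> \<bar>?f e x\<bar> * \<bar>?g e x\<bar>)"
    "len e \<noteq> \<infinity> \<Longrightarrow> \<bar>q e - p e\<bar> \<le> (LBINT x:edge_interior (len e). \<bar>?g e x\<bar>)"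
    if "e \<in> arcs G" for e x \<gamma>
    using P[OF that] unfolding P_def by blast+
  have zero_pt: "0 \<in> edge_points (len e)" if "e \<in> arcs G" for e
    using len_pos[OF that] by (cases "len e") (auto simp: edge_points_def)
  have lp: "level_profile G len w p q"
  proof (intro level_profile.intro level_profile_axioms.intro)
    show "metric_graph G len" by (rule metric_graph_axioms)
    show "half_lines G len \<noteq> {}" using nc by (simp add: noncompact_def)
    show "\<exists>e\<in>arcs G. 1 \<le> max (p e) (q e)"
      using pq(2)[OF e1(1) X(1)[OF e1(1)]] e1 M by (intro bexI[of _ e1]) auto
    show "w (tail G e) \<in> {min (p e) (q e)..max (p e) (q e)}" if "e \<in> arcs G" for e
      unfolding w_tail[OF that] by (rule pq(2)[OF that zero_pt[OF that]])
  qed (use conn pq in \<open>auto simp: w_def half_lines_def\<close>)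
  have "normalized_profile G len w p q ?f ?g"
  proof (intro normalized_profile.intro normalized_profile_axioms.intro lp)
    fix e assume e: "e \<in> arcs G"
    show "p e \<in> {0..1} \<and> q e \<in> {0..1}"
    proof -
      obtain x where "x \<in> edge_points (len e)" "\<bar>?f e x\<bar> = max (p e) (q e)" using pq(3)[OF e] by blast
      then have "max (p e) (q e) \<le> 1" using le1[OF e] by metis
      then show ?thesis using pq(1)[OF e] by simp
    qed
    show "H1_edge (len e) (?f e) (?g e)" by (rule H[OF e])
    show "\<bar>?f e x\<bar> \<le> 1" if "x \<in> edge_points (len e)" for x by (rule le1[OF e that])
    show "min (p e) (q e) \<le> \<bar>?f e x\<bar>" if "x \<in> edge_points (len e)" for x using pq(2)[OF e that] by simp
    show "integral {0..1} (\<lambda>t. real (level_profile.crossings G w p q e t) * \<gamma> t) \<le>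
         (LBINT x:edge_interior (len e). \<gamma> \<bar>?f e x\<bar> * \<bar>?g e x\<bar>)"
      if "continuous_on {0..1} \<gamma>" "\<And>s. s \<in> {0..1} \<Longrightarrow> 0 \<le> \<gamma> s"
        "set_integrable lborel (edge_interior (len e)) (\<lambda>x. \<gamma> \<bar>?f e x\<bar> * \<bar>?g e x\<bar>)" for \<gamma>
      unfolding level_profile.crossings_def[OF lp] by (rule pq(6)[OF e]) (use that in auto)
  next
    fix e assume "e \<in> arcs G - half_lines G len"
    then show "\<bar>q e - p e\<bar> \<le> (LBINT x:edge_interior (len e). \<bar>?g e x\<bar>)"
      using pq(7)[of e] by (auto simp: half_lines_def)
  qed
  then show thesis using that M by blast
qed

lemma GN_quotient_le:
  assumes conn: "Digraph_Component.connected G" and nc: "noncompact G len" and \<nu>: "0 < \<nu>"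
    and GN: "\<And>w p q f g. normalized_profile G len w p q f g \<Longrightarrow>
       \<nu>\<^sup>2 * Lp_norm_pow G len 6 f \<le> 3 * (Lp_norm_pow G len 2 f)\<^sup>2 * Lp_norm_pow G len 2 g"
    and u: "u \<in> H1 G len" "nonzero_on G len u"
  shows "\<nu>\<^sup>2 * Lp_norm_pow G len 6 u \<le> 3 * ((Lp_norm_pow G len 2 u)\<^sup>2 * Lp_norm_pow G len 2 (graph_deriv len u))"
    "GN_quotient G len u \<le> 3 / \<nu>\<^sup>2"
proof -
  obtain M w p q where M: "0 < M"
    and np: "normalized_profile G len w p q (\<lambda>e x. u e x / M) (\<lambda>e x. graph_deriv len u e x / M)"
    using normalized_profile_of_H1[OF conn nc u] .
  let ?X = "Lp_norm_pow G len 6 u" and ?m = "Lp_norm_pow G len 2 u" and ?D = "Lp_norm_pow G len 2 (graph_deriv len u)"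
  have "\<nu>\<^sup>2 * (?X / M ^ 6) \<le> 3 * (?m / M ^ 2)\<^sup>2 * (?D / M ^ 2)"
    using GN[OF np] by (simp only: Lp_norm_pow_divide[OF M])
  \<comment> \<open>The quotient is homogeneous of degree 0: both sides carry the sixth power of
    M.\<close>
  also have "\<dots> = 3 * (?m\<^sup>2 * ?D) / M ^ 6" by (simp add: power_divide flip: power_mult power_add)
  finally show le: "\<nu>\<^sup>2 * ?X \<le> 3 * (?m\<^sup>2 * ?D)" using M by (simp add: divide_le_cancel)
  have "0 \<le> ?D" unfolding Lp_norm_pow_def set_lebesgue_integral_def
    by (auto intro!: sum_nonneg Bochner_Integration.integral_nonneg)
  then have "0 \<le> ?m\<^sup>2 * ?D" by simp
  then show "GN_quotient G len u \<le> 3 / \<nu>\<^sup>2"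
  proof (cases "?m\<^sup>2 * ?D = 0")
    \<comment> \<open>Division by zero yields 0 here, so the bound on the quotient persists for a
      vanishing denominator.\<close>
    case True
    then show ?thesis unfolding GN_quotient_def by (simp only: True) simp
  next
    case False
    then have "0 < ?m\<^sup>2 * ?D" using \<open>0 \<le> ?m\<^sup>2 * ?D\<close> by linarith
    then show ?thesis unfolding GN_quotient_def using le \<nu>
      by (simp add: divide_le_eq pos_le_divide_eq mult.commute)
  qed
qed

end

section \<open>Uniqueness of weak derivatives and their agreement with classical ones\<close>

text \<open>The closed left rays generate the Borel sets and are stable under intersection, so by
  the induction for disjoint unions and complements all Borel integrals of h vanish. Complements
  require the total integral, obtained from growing rays.\<close>

lemma AE_zero_of_atMost_integrals:
  fixes h :: "real \<Rightarrow> real"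
  assumes h: "integrable lborel h" and zero: "\<And>a. (LBINT x:{..a}. h x) = 0"
  shows "AE x in lborel. h x = 0"
proof (rule density_unique_real[OF h])
  have hA: "set_integrable lborel A h" if "A \<in> sets borel" for A
    using integrable_mult_indicator[OF _ h, of A] that by (simp add: set_integrable_def)
  have UNIV: "(LBINT x:UNIV. h x) = 0"
  proof -
    have "(\<lambda>n. LBINT x:{..real n}. h x) \<longlonglongrightarrow> (LBINT x:(\<Union>n. {..real n}). h x)"
      by (rule set_integral_cont_up) (auto simp: incseq_def intro: hA)
    moreover have "(\<Union>n. {..real n}) = UNIV" using real_arch_simple by auto
    ultimately show ?thesis using zero by (simp add: LIMSEQ_const_iff)
  qed
  fix A assume "A \<in> sets (lborel :: real measure)"
  then have A: "A \<in> sigma_sets UNIV (range (\<lambda>a::real. {..a}))"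
    by (simp add: borel_eq_atMost)
  have "Int_stable (range (\<lambda>a::real. {..a}))" by (auto simp: Int_stable_def)
  moreover have "range (\<lambda>a::real. {..a}) \<subseteq> Pow UNIV" by simp
  ultimately have "A \<in> sets borel \<and> (LBINT x:A. h x) = 0"
    using A
  proof (induction rule: sigma_sets_induct_disjoint)
    case (compl A)
    then have A: "A \<in> sets borel" by simp
    have "(LBINT x:A \<union> (UNIV - A). h x) = (LBINT x:A. h x) + (LBINT x:UNIV - A. h x)"
      using A by (intro set_integral_Un hA) auto
    then show ?case using compl A UNIV by (simp add: Un_Diff_cancel)
  next
    case (union A)
    then have A: "\<And>i. A i \<in> sets borel" by auto
    have "(LBINT x:(\<Union>i. A i). h x) = (\<Sum>i. LBINT x:A i. h x)"
      using A union(1) by (intro lebesgue_integral_countable_add hA) (auto simp: disjoint_family_on_def)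
    then show ?case using union A by auto
  qed (use zero in \<open>auto simp: Int_stable_def set_lebesgue_integral_def\<close>)
  then show "(LBINT x:A. h x) = (LBINT x:A. 0)" by (simp add: set_lebesgue_integral_def)
qed auto

lemma edge_interior_eq_UN:
  "\<exists>a b :: nat \<Rightarrow> real. edge_interior l = (\<Union>n. {a n..b n})"
proof -
  let ?Q = "{p :: rat \<times> rat. {of_rat (fst p)..of_rat (snd p)} \<subseteq> edge_interior l} :: (rat \<times> rat) set"
  have "\<exists>p\<in>?Q. x \<in> {of_rat (fst p)..of_rat (snd p)}" if x: "x \<in> edge_interior l" for x
  proof -
    obtain e where e: "e > 0" "ball x e \<subseteq> edge_interior l"
      using open_edge_interior x open_contains_ball by blast
    obtain r where r: "x - e < of_rat r" "of_rat r < x" using of_rat_dense[of "x - e" x] e(1) by auto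
    obtain s where s: "x < of_rat s" "of_rat s < x + e" using of_rat_dense[of x "x + e"] e(1) by auto
    have "{of_rat r..of_rat s} \<subseteq> ball x e" using r s by (auto simp: dist_real_def)
    then show ?thesis using e(2) r s by (intro bexI[of _ "(r, s)"]) auto
  qed
  then have eq: "edge_interior l = (\<Union>p\<in>?Q. {of_rat (fst p)..of_rat (snd p)})" by blast
  \<comment> \<open>The empty interval from 1 to 0 keeps the index set nonempty, so that it can be
    enumerated even if the open set is empty.\<close>
  have "(1, 0) \<in> ?Q" by simp
  then have "?Q \<noteq> {}" by blast
  then have range: "range (from_nat_into ?Q) = ?Q" by (rule range_from_nat_into) (rule countableI_type)
  have "edge_interior l = (\<Union>p\<in>range (from_nat_into ?Q). {of_rat (fst p)..of_rat (snd p)})"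
    unfolding range by (rule eq)
  from this[unfolded image_image] show ?thesis by (intro exI) (rule HOL.trans, assumption, rule refl)
qed

text \<open>\<open>weak_deriv\<close> is an arbitrary choice; this is what allows its norm to be
  computed for the soliton. On a compact subinterval both derivatives have the integrals prescribed
  by the increments of \<open>f\<close>.\<close>

lemma weak_deriv_unique_AE:
  assumes g1: "has_weak_L2_deriv (edge_interior l) f g1" and g2: "has_weak_L2_deriv (edge_interior l) f g2"
    and f: "continuous_on (edge_interior l) f"
  shows "AE x in lborel. x \<in> edge_interior l \<longrightarrow> g1 x = g2 x"
proof -
  let ?I = "edge_interior l"
  have L2: "L2_on ?I g1" "L2_on ?I g2" using g1 g2 by (auto simp: has_weak_L2_deriv_def)
  have Icc: "AE x in lborel. x \<in> {a..b} \<longrightarrow> g1 x = g2 x" if ab: "{a..b} \<subseteq> ?I" for a b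
  proof -
    have int: "set_integrable lborel {a..b} g1" "set_integrable lborel {a..b} g2"
      using L2 ab by (auto intro!: L2_on_set_integrable)
    have "AE x in lborel. indicator {a..b} x * (g1 x - g2 x) = 0"
    proof (rule AE_zero_of_atMost_integrals)
      show "integrable lborel (\<lambda>x. indicator {a..b} x * (g1 x - g2 x))"
        using set_integral_diff(1)[OF int] by (simp add: set_integrable_def)
      fix c :: real
      let ?d = "min b c"
      have sub: "{a..?d} \<subseteq> ?I" using ab by auto
      have i: "set_integrable lborel {a..?d} g1" "set_integrable lborel {a..?d} g2"
        using L2 sub by (auto intro!: L2_on_set_integrable)
      have "(LBINT x:{..c}. indicator {a..b} x * (g1 x - g2 x)) = (LBINT x:{a..?d}. g1 x - g2 x)"
        unfolding set_lebesgue_integral_def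
        by (rule Bochner_Integration.integral_cong) (auto simp: indicator_def)
      also have "\<dots> = integral {a..?d} g1 - integral {a..?d} g2"
        using set_integral_diff(2)[OF i] set_borel_integral_eq_integral(2)[OF i(1)]
          set_borel_integral_eq_integral(2)[OF i(2)] by simp
      also have "\<dots> = 0"
      proof (cases "a < ?d")
        case True
        then show ?thesis
          using weak_deriv_FTC_interior[OF g1 open_edge_interior f True sub]
            weak_deriv_FTC_interior[OF g2 open_edge_interior f True sub] by simp
      next
        case False
        then have "{a..?d} = {} \<or> {a..?d} = {a}" by auto
        then show ?thesis by auto
      qed
      finally show "(LBINT x:{..c}. indicator {a..b} x * (g1 x - g2 x)) = 0" .
    qed
    then show ?thesis by eventually_elim (auto simp: indicator_def)
  qed
  obtain a b :: "nat \<Rightarrow> real" where I: "?I = (\<Union>n. {a n..b n})" using edge_interior_eq_UN by blast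
  have "AE x in lborel. \<forall>n. x \<in> {a n..b n} \<longrightarrow> g1 x = g2 x"
    unfolding AE_all_countable using Icc I by blast
  then show ?thesis unfolding I by eventually_elim auto
qed

text \<open>Integration by parts on a compact interval that contains the support of the test
  function and at whose ends the test function vanishes.\<close>

lemma has_weak_L2_deriv_C1:
  assumes f: "\<And>x. x \<in> edge_interior l \<Longrightarrow> (f has_real_derivative f' x) (at x)"
    and f': "continuous_on (edge_interior l) f'" "L2_on (edge_interior l) f'"
  shows "has_weak_L2_deriv (edge_interior l) f f'"
  unfolding has_weak_L2_deriv_def
proof (intro conjI allI impI f'(2))
  let ?I = "edge_interior l"
  fix \<phi> \<phi>' assume "test_function ?I \<phi> \<phi>'"
  then obtain K where \<phi>: "\<And>x. (\<phi> has_real_derivative \<phi>' x) (at x)" "continuous_on UNIV \<phi>'"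
    and K: "compact K" "K \<subseteq> ?I" and \<phi>0: "\<And>x. x \<notin> K \<Longrightarrow> \<phi> x = 0"
    by (auto simp: test_function_def)
  have \<phi>'0: "\<phi>' x = 0" if "x \<notin> K" for x
  proof -
    have "((\<lambda>_. 0) has_real_derivative \<phi>' x) (at x)"
      by (rule has_field_derivative_transform_within_open[OF \<phi>(1), of "- K"])
         (use that K(1) \<phi>0 compact_imp_closed in auto)
    then show ?thesis using DERIV_unique DERIV_const by blast
  qed
  \<comment> \<open>The extreme points of the support are moved outward a little inside the open
    edge. An empty support gets the empty interval from 1 to 0.\<close>
  obtain c d where cd: "K \<subseteq> {c..d}" "{c..d} \<subseteq> ?I" "\<phi> c = 0" "\<phi> d = 0" "c \<le> d \<or> K = {}"
  proof (cases "K = {}")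
    case True
    then show thesis using that[of 1 0] \<phi>0 by auto
  next
    case False
    obtain s t where s: "s \<in> K" "\<And>x. x \<in> K \<Longrightarrow> s \<le> x" and t: "t \<in> K" "\<And>x. x \<in> K \<Longrightarrow> x \<le> t"
      using compact_attains_inf[OF K(1) False] compact_attains_sup[OF K(1) False] by metis
    obtain e1 where e1: "e1 > 0" "cball s e1 \<subseteq> ?I"
      using open_edge_interior s(1) K(2) open_contains_cball by (metis subsetD)
    obtain e2 where e2: "e2 > 0" "cball t e2 \<subseteq> ?I"
      using open_edge_interior t(1) K(2) open_contains_cball by (metis subsetD)
    have "s - e1 \<in> ?I" by (rule subsetD[OF e1(2)]) (use e1(1) in \<open>simp add: dist_real_def\<close>)
    moreover have "t + e2 \<in> ?I" by (rule subsetD[OF e2(2)]) (use e2(1) in \<open>simp add: dist_real_def\<close>)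
    ultimately have "0 < s - e1" "ereal (t + e2) < l" by (simp_all add: edge_interior_def)
    then have sub: "{s - e1..t + e2} \<subseteq> ?I"
      by (auto simp: edge_interior_def) (metis ereal_less_eq(3) order_le_less_trans)
    show thesis
    proof (rule that[OF _ sub])
      show "K \<subseteq> {s - e1..t + e2}" using s(2) t(2) e1(1) e2(1) by fastforce
      show "\<phi> (s - e1) = 0" using s(2)[of "s - e1"] e1(1) by (intro \<phi>0) auto
      show "\<phi> (t + e2) = 0" using t(2)[of "t + e2"] e2(1) by (intro \<phi>0) auto
      show "s - e1 \<le> t + e2 \<or> K = {}" using s(2)[OF t(1)] e1(1) e2(1) by auto
    qed
  qed
  show "(LBINT x:?I. f x * \<phi>' x) = - (LBINT x:?I. f' x * \<phi> x)"
  proof (cases "K = {}")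
    case True
    then show ?thesis using \<phi>0 \<phi>'0 by (simp add: set_lebesgue_integral_def)
  next
    case False
    then have le: "c \<le> d" using cd by auto
    have cf: "continuous_on {c..d} f"
      using f cd(2) by (intro continuous_at_imp_continuous_on ballI) (meson DERIV_isCont subsetD)
    have c\<phi>: "continuous_on {c..d} \<phi>" using \<phi>(1) by (intro continuous_at_imp_continuous_on ballI) (meson DERIV_isCont)
    have i1: "set_integrable lborel {c..d} (\<lambda>x. f x * \<phi>' x)"
      by (intro borel_integrable_atLeastAtMost' continuous_intros cf continuous_on_subset[OF \<phi>(2)]) auto
    have i2: "set_integrable lborel {c..d} (\<lambda>x. f' x * \<phi> x)"
      by (intro borel_integrable_atLeastAtMost' continuous_intros c\<phi> continuous_on_subset[OF f'(1) cd(2)])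
    have "((\<lambda>x. f x * \<phi>' x + f' x * \<phi> x) has_integral f d * \<phi> d - f c * \<phi> c) {c..d}"
    proof (rule fundamental_theorem_of_calculus[OF le])
      fix x assume "x \<in> {c..d}"
      then have "((\<lambda>x. f x * \<phi> x) has_real_derivative f' x * \<phi> x + \<phi>' x * f x) (at x)"
        using f cd(2) \<phi>(1) by (intro DERIV_mult) auto
      then show "((\<lambda>x. f x * \<phi> x) has_vector_derivative f x * \<phi>' x + f' x * \<phi> x) (at x within {c..d})"
        by (simp add: has_field_derivative_at_within has_real_derivative_iff_has_vector_derivative[symmetric] add.commute mult.commute)
    qed
    then have "integral {c..d} (\<lambda>x. f x * \<phi>' x + f' x * \<phi> x) = 0" using cd by (simp add: integral_unique)
    then have "(LBINT x:{c..d}. f x * \<phi>' x) + (LBINT x:{c..d}. f' x * \<phi> x) = 0"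
      using set_borel_integral_eq_integral(2)[OF set_integral_add(1)[OF i1 i2]] set_integral_add(2)[OF i1 i2] by simp
    moreover have "(LBINT x:?I. f x * \<phi>' x) = (LBINT x:{c..d}. f x * \<phi>' x)"
      unfolding set_lebesgue_integral_def
    proof (rule Bochner_Integration.integral_cong[OF refl])
      fix x show "indicator ?I x *\<^sub>R (f x * \<phi>' x) = indicator {c..d} x *\<^sub>R (f x * \<phi>' x)"
        using cd(2) \<phi>'0[of x] subsetD[OF cd(1), of x] by (cases "x \<in> K") (auto simp: indicator_def)
    qed
    moreover have "(LBINT x:?I. f' x * \<phi> x) = (LBINT x:{c..d}. f' x * \<phi> x)"
      unfolding set_lebesgue_integral_def
    proof (rule Bochner_Integration.integral_cong[OF refl])
      fix x show "indicator ?I x *\<^sub>R (f' x * \<phi> x) = indicator {c..d} x *\<^sub>R (f' x * \<phi> x)"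
        using cd(2) \<phi>0[of x] subsetD[OF cd(1), of x] by (cases "x \<in> K") (auto simp: indicator_def)
    qed
    ultimately show ?thesis by simp
  qed
qed

section \<open>The half-soliton\<close>

text \<open>Solves u' = - u sqrt(1 - u^4) / 2 for x \<ge> 0 with u(0) = 1, the equality case of the
  completed square with a = 1 and \<beta> = sqrt 3 / 2; restricted to the half-line it is the
  optimiser.\<close>

definition soliton :: "real \<Rightarrow> real" where
  "soliton x = 1 / sqrt (cosh x)"

definition soliton' :: "real \<Rightarrow> real" where
  "soliton' x = - sinh x / (2 * cosh x * sqrt (cosh x))"

lemma soliton_deriv: "(soliton has_real_derivative soliton' x) (at x)"
proof -
  define S where "S = sqrt (cosh x)"
  have S: "S > 0" "cosh x = S * S" by (auto simp: S_def cosh_real_pos less_imp_le)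
  have "((\<lambda>x. sqrt (cosh x)) has_real_derivative inverse (sqrt (cosh x)) / 2 * sinh x) (at x)"
    by (rule DERIV_chain2[OF DERIV_real_sqrt]) (auto intro!: derivative_eq_intros simp: cosh_real_pos)
  from DERIV_inverse'[OF this]
  have "(soliton has_real_derivative - (inverse S * (inverse S / 2 * sinh x) * inverse S)) (at x)"
    using S(1) by (simp add: soliton_def[abs_def] S_def inverse_eq_divide)
  moreover have "- (inverse S * (inverse S / 2 * sinh x) * inverse S) = soliton' x"
    unfolding soliton'_def S_def[symmetric] unfolding S(2) using S(1) by (simp add: field_simps)
  ultimately show ?thesis by simp
qed

lemma continuous_soliton: "continuous_on A soliton" "continuous_on A soliton'"
  unfolding soliton_def[abs_def] soliton'_def[abs_def]
  by (auto intro!: continuous_intros)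

lemma edge_interior_inf: "edge_interior \<infinity> = {0<..}"
  by (auto simp: edge_interior_def)

lemma half_line_FTC_nonneg:
  fixes F f :: "real \<Rightarrow> real"
  assumes deriv: "\<And>x. (F has_real_derivative f x) (at x)" and cont: "continuous_on UNIV f"
    and nonneg: "\<And>x. 0 \<le> f x" and lim: "(F \<longlongrightarrow> B) at_top"
  shows "set_integrable lborel {0<..} f" "(LBINT x:{0<..}. f x) = B - F 0"
proof -
  have "isCont F 0" using deriv by (rule DERIV_isCont)
  then have "(F \<longlongrightarrow> F 0) (at_right 0)"
    by (auto simp: isCont_def intro: tendsto_mono[OF at_le])
  then have l0: "((F \<circ> real_of_ereal) \<longlongrightarrow> F 0) (at_right 0)"
    unfolding zero_ereal_def ereal_tendsto_simps .
  have l1: "((F \<circ> real_of_ereal) \<longlongrightarrow> B) (at_left \<infinity>)"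
    unfolding ereal_tendsto_simps by (rule lim)
  have ei: "einterval 0 \<infinity> = {0<..}" by (auto simp: einterval_def)
  have c: "isCont f x" for x using cont by (simp add: continuous_on_eq_continuous_at)
  note FTC = interval_integral_FTC_nonneg[of 0 \<infinity> F f, OF _ deriv c _ l0 l1]
  show "set_integrable lborel {0<..} f" "(LBINT x:{0<..}. f x) = B - F 0"
    using FTC nonneg by (simp_all add: ei interval_lebesgue_integral_def)
qed

lemma sech_integral:
  "set_integrable lborel {0<..} (\<lambda>x::real. 1 / cosh x)" "(LBINT x:{0<..}. 1 / cosh x) = pi / 2"
proof -
  have lim: "((\<lambda>x. arctan (sinh x)) \<longlongrightarrow> pi / 2) at_top"
    by (rule filterlim_compose[OF tendsto_arctan_at_top sinh_real_at_top])
  have d: "((\<lambda>x. arctan (sinh x)) has_real_derivative 1 / cosh x) (at x)" for x :: real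
  proof -
    have "((\<lambda>x. arctan (sinh x)) has_real_derivative inverse (1 + (sinh x)\<^sup>2) * cosh x) (at x)"
      by (rule DERIV_chain2[OF DERIV_arctan]) (auto intro!: derivative_eq_intros)
    moreover have "inverse (1 + (sinh x)\<^sup>2) * cosh x = 1 / cosh x"
    proof -
      have "1 + (sinh x)\<^sup>2 = (cosh x)\<^sup>2" by (simp add: cosh_square_eq)
      then show ?thesis using cosh_real_pos[of x] by (simp add: field_simps power2_eq_square)
    qed
    ultimately show ?thesis by simp
  qed
  have c: "continuous_on UNIV (\<lambda>x::real. 1 / cosh x)" by (intro continuous_intros) auto
  show "set_integrable lborel {0<..} (\<lambda>x::real. 1 / cosh x)" "(LBINT x:{0<..}. 1 / cosh x) = pi / 2"
    using half_line_FTC_nonneg[OF d c _ lim] by (simp_all add: cosh_real_nonneg)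
qed

lemma sech_cube_integral:
  "set_integrable lborel {0<..} (\<lambda>x::real. 1 / cosh x ^ 3)" "(LBINT x:{0<..}. 1 / cosh x ^ 3) = pi / 4"
proof -
  \<comment> \<open>The reduction formula for the cube of sech: one integration by parts leads back
    to the primitive arctan(sinh x) of sech.\<close>
  define F where "F x = (sinh x / (cosh x)\<^sup>2 + arctan (sinh x)) / 2" for x :: real
  have inv: "((\<lambda>x::real. inverse (cosh x)) \<longlongrightarrow> 0) at_top"
    by (rule tendsto_inverse_0_at_top[OF cosh_real_at_top])
  have "((\<lambda>x::real. tanh x * inverse (cosh x)) \<longlongrightarrow> 1 * 0) at_top"
    by (intro tendsto_mult tanh_real_at_top inv)
  then have "((\<lambda>x::real. sinh x / (cosh x)\<^sup>2) \<longlongrightarrow> 0) at_top"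
    by (simp add: tanh_def field_simps power2_eq_square)
  then have lim: "(F \<longlongrightarrow> (0 + pi / 2) / 2) at_top" unfolding F_def
    by (intro tendsto_intros filterlim_compose[OF tendsto_arctan_at_top sinh_real_at_top]) auto
  have d: "(F has_real_derivative 1 / cosh x ^ 3) (at x)" for x :: real
  proof -
    have at: "((\<lambda>x. arctan (sinh x)) has_real_derivative inverse (1 + (sinh x)\<^sup>2) * cosh x) (at x)"
      by (rule DERIV_chain2[OF DERIV_arctan]) (auto intro!: derivative_eq_intros)
    have q: "((\<lambda>x. sinh x / (cosh x)\<^sup>2) has_real_derivative
        (cosh x * (cosh x)\<^sup>2 - sinh x * (2 * cosh x * sinh x)) / ((cosh x)\<^sup>2 * (cosh x)\<^sup>2)) (at x)"
      by (auto intro!: derivative_eq_intros)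
    have "(F has_real_derivative ((cosh x * (cosh x)\<^sup>2 - sinh x * (2 * cosh x * sinh x)) / ((cosh x)\<^sup>2 * (cosh x)\<^sup>2)
        + inverse (1 + (sinh x)\<^sup>2) * cosh x) / 2) (at x)"
      unfolding F_def by (intro DERIV_cdivide DERIV_add q at)
    moreover have "((cosh x * (cosh x)\<^sup>2 - sinh x * (2 * cosh x * sinh x)) / ((cosh x)\<^sup>2 * (cosh x)\<^sup>2)
        + inverse (1 + (sinh x)\<^sup>2) * cosh x) / 2 = 1 / cosh x ^ 3"
    proof -
      define c where "c = cosh x"
      have c: "c > 0" "1 + (sinh x)\<^sup>2 = c\<^sup>2" by (auto simp: c_def cosh_square_eq cosh_real_pos)
      have s2: "sinh x * (2 * c * sinh x) = 2 * c * (c\<^sup>2 - 1)"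
      proof -
        have "(sinh x)\<^sup>2 = c\<^sup>2 - 1" using c(2) by simp
        then show ?thesis by (simp add: power2_eq_square)
      qed
      show ?thesis unfolding c_def[symmetric] c(2) s2
        using c(1) by (simp add: field_simps power2_eq_square power3_eq_cube)
    qed
    ultimately show ?thesis by simp
  qed
  have c: "continuous_on UNIV (\<lambda>x::real. 1 / cosh x ^ 3)" by (intro continuous_intros) auto
  show "set_integrable lborel {0<..} (\<lambda>x::real. 1 / cosh x ^ 3)" "(LBINT x:{0<..}. 1 / cosh x ^ 3) = pi / 4"
    using half_line_FTC_nonneg[OF d c _ lim] by (simp_all add: cosh_real_nonneg F_def)
qed

lemma soliton_powers:
  "\<bar>soliton x\<bar> ^ 2 = 1 / cosh x" "\<bar>soliton x\<bar> ^ 6 = 1 / cosh x ^ 3"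
  "\<bar>soliton' x\<bar> ^ 2 = (1 / cosh x - 1 / cosh x ^ 3) / 4"
proof -
  have s: "sqrt (cosh x) ^ 2 = cosh x" by (simp add: cosh_real_pos less_imp_le)
  show 2: "\<bar>soliton x\<bar> ^ 2 = 1 / cosh x" by (simp add: soliton_def power_divide s)
  have "\<bar>soliton x\<bar> ^ 6 = (\<bar>soliton x\<bar> ^ 2) ^ 3" by (simp flip: power_mult)
  then show "\<bar>soliton x\<bar> ^ 6 = 1 / cosh x ^ 3" unfolding 2 by (simp add: power_divide)
  have sq: "(sinh x)\<^sup>2 = (cosh x)\<^sup>2 - 1" by (simp add: cosh_square_eq)
  have "\<bar>soliton' x\<bar> ^ 2 = (sinh x)\<^sup>2 / (4 * (cosh x)\<^sup>2 * cosh x)"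
    by (simp add: soliton'_def power_divide power_mult_distrib s)
  also have "\<dots> = (1 / cosh x - 1 / cosh x ^ 3) / 4"
    unfolding sq using cosh_real_pos[of x] by (simp add: field_simps power2_eq_square power3_eq_cube)
  finally show "\<bar>soliton' x\<bar> ^ 2 = (1 / cosh x - 1 / cosh x ^ 3) / 4" .
qed

lemma soliton'_integral:
  "set_integrable lborel {0<..} (\<lambda>x. \<bar>soliton' x\<bar> ^ 2)" "(LBINT x:{0<..}. \<bar>soliton' x\<bar> ^ 2) = pi / 16"
proof -
  note d = set_integral_diff[OF sech_integral(1) sech_cube_integral(1)]
  show "set_integrable lborel {0<..} (\<lambda>x. \<bar>soliton' x\<bar> ^ 2)"
    unfolding soliton_powers by (rule set_integrable_divide) (use d(1) in auto)
  show "(LBINT x:{0<..}. \<bar>soliton' x\<bar> ^ 2) = pi / 16"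
    unfolding soliton_powers using d(2) sech_integral(2) sech_cube_integral(2) by simp
qed

lemma L2_on_soliton: "L2_on (edge_interior \<infinity>) soliton" "L2_on (edge_interior \<infinity>) soliton'"
proof -
  have m: "set_borel_measurable lborel {0<..} f" if "continuous_on UNIV f" for f :: "real \<Rightarrow> real"
    unfolding set_borel_measurable_def
    using borel_measurable_continuous_onI[OF that] by (intro borel_measurable_scaleR) auto
  show "L2_on (edge_interior \<infinity>) soliton" "L2_on (edge_interior \<infinity>) soliton'"
    using sech_integral(1) soliton'_integral(1) soliton_powers(1)
    by (simp_all add: L2_on_def edge_interior_inf m continuous_soliton)
qed

lemma has_weak_L2_deriv_soliton: "has_weak_L2_deriv (edge_interior \<infinity>) soliton soliton'"
  by (rule has_weak_L2_deriv_C1[OF soliton_deriv continuous_soliton(2) L2_on_soliton(2)])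

lemma weak_deriv_soliton:
  "(LBINT x:{0<..}. \<bar>weak_deriv (edge_interior \<infinity>) soliton x\<bar> ^ 2) = pi / 16"
proof -
  let ?I = "edge_interior \<infinity>" and ?g = "weak_deriv (edge_interior \<infinity>) soliton"
  have g: "has_weak_L2_deriv ?I soliton ?g"
    unfolding weak_deriv_def by (rule someI[of "has_weak_L2_deriv ?I soliton", OF has_weak_L2_deriv_soliton])
  have ae: "AE x in lborel. x \<in> ?I \<longrightarrow> ?g x = soliton' x"
    by (rule weak_deriv_unique_AE[OF g has_weak_L2_deriv_soliton continuous_soliton(1)])
  have "(LBINT x:?I. \<bar>?g x\<bar> ^ 2) = (LBINT x:?I. \<bar>soliton' x\<bar> ^ 2)"
    unfolding set_lebesgue_integral_def
  proof (rule integral_cong_AE)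
    show "(\<lambda>x. indicator ?I x *\<^sub>R \<bar>?g x\<bar> ^ 2) \<in> borel_measurable lborel"
      using g by (auto simp: has_weak_L2_deriv_def L2_on_def set_integrable_def)
    show "(\<lambda>x. indicator ?I x *\<^sub>R \<bar>soliton' x\<bar> ^ 2) \<in> borel_measurable lborel"
      using soliton'_integral(1) by (auto simp: set_integrable_def edge_interior_inf)
    show "AE x in lborel. indicator ?I x *\<^sub>R \<bar>?g x\<bar> ^ 2 = indicator ?I x *\<^sub>R \<bar>soliton' x\<bar> ^ 2"
      using ae by eventually_elim (auto simp: indicator_def)
  qed
  then show ?thesis using soliton'_integral(2) by (simp add: edge_interior_inf)
qed


text \<open>Half-solitons start with value 1, so the constant 1 on bounded edges makes them match at
  all vertices. On the half-line this is the optimiser; on a general graph it is merely a competitor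
  showing that the supremum is positive.\<close>

definition soliton_graph :: "('e \<Rightarrow> ereal) \<Rightarrow> 'e \<Rightarrow> real \<Rightarrow> real" where
  "soliton_graph len e = (if len e = \<infinity> then soliton else (\<lambda>_. 1))"

context metric_graph
begin

lemma soliton_graph_H1: "soliton_graph len \<in> H1 G len"
proof -
  have "continuous_on_graph G len (soliton_graph len)"
    unfolding continuous_on_graph_def
  proof (intro conjI exI[of _ "\<lambda>_. 1"] ballI impI)
    show "continuous_on (edge_points (len e)) (soliton_graph len e)" for e
      by (auto simp: soliton_graph_def continuous_soliton)
  qed (auto simp: soliton_graph_def soliton_def)
  moreover have "H1_on (edge_interior (len e)) (soliton_graph len e)" if e: "e \<in> arcs G" for e
  proof (cases "len e = \<infinity>")
    case True
    then show ?thesis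
      using L2_on_soliton(1) has_weak_L2_deriv_soliton by (auto simp: H1_on_def soliton_graph_def)
  next
    case False
    then obtain L where L: "len e = ereal L" using len_pos[OF e] by (cases "len e") auto
    have I: "edge_interior (len e) = {0<..<L}" by (auto simp: edge_interior_def L)
    have "L2_on (edge_interior (len e)) (\<lambda>_. c)" for c by (rule L2_on_const) (auto simp: I)
    moreover from this have "has_weak_L2_deriv (edge_interior (len e)) (\<lambda>_. 1) (\<lambda>_. 0)"
      by (intro has_weak_L2_deriv_C1) auto
    ultimately show ?thesis using False by (auto simp: H1_on_def soliton_graph_def)
  qed
  ultimately show ?thesis by (simp add: H1_def)
qed

lemma soliton_graph_nonzero:
  assumes "noncompact G len" shows "nonzero_on G len (soliton_graph len)"
proof -
  obtain e where "e \<in> arcs G" "len e = \<infinity>" using assms by (auto simp: noncompact_def half_lines_def)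
  then show ?thesis unfolding nonzero_on_def
    by (intro bexI[of _ e] bexI[of _ 0]) (auto simp: soliton_graph_def soliton_def edge_points_def)
qed

lemma soliton_graph_power6_pos:
  assumes "noncompact G len" shows "0 < Lp_norm_pow G len 6 (soliton_graph len)"
proof -
  obtain e where e: "e \<in> arcs G" "len e = \<infinity>" using assms by (auto simp: noncompact_def half_lines_def)
  let ?X = "\<lambda>e. LBINT x:edge_interior (len e). \<bar>soliton_graph len e x\<bar> ^ 6"
  have "soliton_graph len e = soliton" using e(2) by (simp add: soliton_graph_def)
  then have "?X e = pi / 4"
    by (simp only: e(2) edge_interior_inf soliton_powers sech_cube_integral)
  then have "0 < ?X e" using pi_gt_zero by linarith
  also have "?X e \<le> (\<Sum>e\<in>arcs G. ?X e)"
    by (rule member_le_sum[OF e(1)]) (auto intro!: Bochner_Integration.integral_nonneg simp: set_lebesgue_integral_def)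
  finally show ?thesis by (simp add: Lp_norm_pow_def)
qed

end

text \<open>Both sides are 16 / pi^2: the sixth-power integral is pi / 4, the mass pi / 2 and the
  energy pi / 16.\<close>

lemma half_line_quotient:
  "GN_quotient half_line_graph half_line_len (soliton_graph half_line_len) = 3 / half_line_mass\<^sup>2"
proof -
  have e: "soliton_graph half_line_len = (\<lambda>_. soliton)" by (auto simp: soliton_graph_def half_line_len_def)
  have "Lp_norm_pow half_line_graph half_line_len 6 (soliton_graph half_line_len) = pi / 4"
    unfolding Lp_norm_pow_def e soliton_powers
    by (simp add: half_line_graph_def half_line_len_def edge_interior_inf sech_cube_integral UNIV_unit)
  moreover have "Lp_norm_pow half_line_graph half_line_len 2 (soliton_graph half_line_len) = pi / 2"
    unfolding Lp_norm_pow_def e soliton_powers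
    by (simp add: half_line_graph_def half_line_len_def edge_interior_inf sech_integral UNIV_unit)
  moreover have "Lp_norm_pow half_line_graph half_line_len 2 (graph_deriv half_line_len (soliton_graph half_line_len)) = pi / 16"
    unfolding Lp_norm_pow_def graph_deriv_def e using weak_deriv_soliton
    by (simp add: half_line_graph_def half_line_len_def edge_interior_inf UNIV_unit)
  ultimately have "GN_quotient half_line_graph half_line_len (soliton_graph half_line_len) = (pi / 4) / ((pi / 2)\<^sup>2 * (pi / 16))"
    by (simp only: GN_quotient_def)
  also have "\<dots> = 3 / half_line_mass\<^sup>2"
    by (simp add: half_line_mass_def field_simps power2_eq_square)
  finally show ?thesis .
qed

lemma half_line_connected: "Digraph_Component.connected half_line_graph"
proof -
  interpret metric_graph half_line_graph half_line_len by (rule metric_graph_half_line)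
  let ?S = "mk_symmetric half_line_graph"
  have parcs: "parcs ?S = {(False, True), (True, False)}"
    by (auto simp: parcs_mk_symmetric half_line_graph_def)
  have V: "pverts ?S = UNIV" by (simp add: half_line_graph_def)
  have "u \<rightarrow>\<^sup>*\<^bsub>with_proj ?S\<^esub> v" for u v
  proof -
    have "(u, v) \<in> rtrancl_on UNIV {(False, True), (True, False)}"
      by (cases u; cases v) (auto intro: rtrancl_on.intros)
    then show ?thesis unfolding reachable_def using V parcs by simp
  qed
  then show ?thesis
    unfolding Digraph_Component.connected_def strongly_connected_def using V by auto
qed

lemma half_line_noncompact: "noncompact half_line_graph half_line_len"
  by (auto simp: noncompact_def half_lines_def half_line_graph_def half_line_len_def)

section \<open>Comparison of the critical masses\<close>

definition GN_quotients :: "('v, 'e) pre_digraph \<Rightarrow> ('e \<Rightarrow> ereal) \<Rightarrow> real set" where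
  "GN_quotients G len = GN_quotient G len ` {u \<in> H1 G len. nonzero_on G len u}"

text \<open>A positive supremum makes the definite description unique; the comparison of critical
  masses becomes the reversed comparison of suprema.\<close>

lemma critical_mass_eq_sqrt:
  assumes "0 < Sup (GN_quotients G len)"
  shows "critical_mass G len = sqrt (3 / Sup (GN_quotients G len))"
proof -
  let ?K = "Sup (GN_quotients G len)"
  show ?thesis
    unfolding critical_mass_def GN_quotients_def[symmetric]
  proof (rule the_equality)
    show "0 < sqrt (3 / ?K) \<and> 3 / (sqrt (3 / ?K))\<^sup>2 = ?K" using assms by simp
    fix m assume m: "0 < m \<and> 3 / m\<^sup>2 = ?K"
    then have "m\<^sup>2 = 3 / ?K" using assms by (auto simp: field_simps)
    then show "m = sqrt (3 / ?K)" using m by (metis less_imp_le real_sqrt_unique)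
  qed
qed

theorem corollary1p3:
  fixes G :: "('v, 'e) pre_digraph" and len :: "'e \<Rightarrow> ereal"
  assumes "metric_graph G len"
    and "noncompact G len"
    and "Digraph_Component.connected G"
    and "tips G len = {}"
    and "\<not> admits_cycle_covering G len"
    and "card (half_lines G len) \<ge> 2"
  shows "critical_mass G len > critical_mass half_line_graph half_line_len"
proof -
  interpret G: metric_graph G len by (rule assms(1))
  interpret R: metric_graph half_line_graph half_line_len by (rule metric_graph_half_line)
  obtain \<nu> where \<nu>: "half_line_mass < \<nu>"
    and GN: "\<And>w p q f g. normalized_profile G len w p q f g \<Longrightarrow>
       \<nu>\<^sup>2 * Lp_norm_pow G len 6 f \<le> 3 * (Lp_norm_pow G len 2 f)\<^sup>2 * Lp_norm_pow G len 2 g"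
    using G.GN_improved[OF assms(4,6)] by blast
  have \<nu>0: "0 < \<nu>" using \<nu> half_line_mass_pos by simp
  have GN_G: "\<nu>\<^sup>2 * Lp_norm_pow G len 6 u \<le> 3 * ((Lp_norm_pow G len 2 u)\<^sup>2 * Lp_norm_pow G len 2 (graph_deriv len u))"
    "GN_quotient G len u \<le> 3 / \<nu>\<^sup>2" if "u \<in> H1 G len" "nonzero_on G len u" for u
    by (rule G.GN_quotient_le[OF assms(3,2) \<nu>0 _ that], rule GN, assumption)+
  let ?K = "Sup (GN_quotients G len)" and ?H = "Sup (GN_quotients half_line_graph half_line_len)"
  let ?s = "soliton_graph len"
  have s: "GN_quotient G len ?s \<in> GN_quotients G len"
    using G.soliton_graph_H1 G.soliton_graph_nonzero[OF assms(2)] by (auto simp: GN_quotients_def)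
  have bdd: "x \<le> 3 / \<nu>\<^sup>2" if "x \<in> GN_quotients G len" for x
    using that GN_G(2) by (auto simp: GN_quotients_def)
  have K_le: "?K \<le> 3 / \<nu>\<^sup>2" by (rule cSup_least) (use s bdd in auto)
  \<comment> \<open>The denominator for the competitor need not be computed: the inequality already
    proved bounds it below by a positive multiple of its sixth-power integral.\<close>
  have K_pos: "0 < ?K"
  proof -
    have "0 < \<nu>\<^sup>2 * Lp_norm_pow G len 6 ?s" using \<nu>0 G.soliton_graph_power6_pos[OF assms(2)] by simp
    then have "0 < (Lp_norm_pow G len 2 ?s)\<^sup>2 * Lp_norm_pow G len 2 (graph_deriv len ?s)"
      using GN_G(1)[OF G.soliton_graph_H1 G.soliton_graph_nonzero[OF assms(2)]] by linarith
    then have "0 < GN_quotient G len ?s"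
      unfolding GN_quotient_def using G.soliton_graph_power6_pos[OF assms(2)] by (intro divide_pos_pos)
    also have "\<dots> \<le> ?K" by (rule cSup_upper[OF s bdd_aboveI[OF bdd]])
    finally show ?thesis .
  qed
  \<comment> \<open>The half-soliton attains this value; the upper bound on the half-line quotients
    enters because the supremum of an unbounded real set would say nothing.\<close>
  have H_ge: "3 / half_line_mass\<^sup>2 \<le> ?H"
  proof (rule cSup_upper)
    show "3 / half_line_mass\<^sup>2 \<in> GN_quotients half_line_graph half_line_len"
      unfolding GN_quotients_def half_line_quotient[symmetric]
      using R.soliton_graph_H1 R.soliton_graph_nonzero[OF half_line_noncompact] by blast
    have "GN_quotient half_line_graph half_line_len u \<le> 3 / half_line_mass\<^sup>2"
      if "u \<in> H1 half_line_graph half_line_len" "nonzero_on half_line_graph half_line_len u" for u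
      by (rule R.GN_quotient_le(2)[OF half_line_connected half_line_noncompact half_line_mass_pos _ that])
         (rule normalized_profile.GN_half_line_bound)
    then show "bdd_above (GN_quotients half_line_graph half_line_len)"
      by (auto simp: GN_quotients_def intro!: bdd_aboveI)
  qed
  have "3 / \<nu>\<^sup>2 < 3 / half_line_mass\<^sup>2"
    using \<nu> half_line_mass_pos by (intro divide_strict_left_mono) (auto simp: power_strict_mono)
  then have "?K < ?H" using K_le H_ge by linarith
  then have "3 / ?H < 3 / ?K" using K_pos by (intro divide_strict_left_mono) auto
  then have "sqrt (3 / ?H) < sqrt (3 / ?K)" by simp
  then show ?thesis
    using critical_mass_eq_sqrt[OF K_pos] critical_mass_eq_sqrt[of half_line_graph half_line_len] \<open>?K < ?H\<close> K_pos by simp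
qed

end
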